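(* Let $(G,\Pi)$ be a connected Poisson-Lie group of dimension $n$ with Lie algebra $\mathfrak{g}$ and identity element $e$, and let $H\in C^\infty(G)$ be a function which is Morse at $e$. If the Hamiltonian vector field $X_H^\Pi$ preserves a volume form $\Phi$ on $G$, then the dual Lie algebra $(\mathfrak{g}^*,[\cdot,\cdot]_{\mathfrak{g}^*})$ is unimodular and, therefore, for every $\nu\in\wedge^n\mathfrak{g}^*$ with $\nu\neq 0$, the volume form $\sqrt{f_0}\,\nu^l$ is preserved by all Hamiltonian vector fields on $(G,\Pi)$ (in particular, by $X_H^\Pi$). Here $\nu^l$ is the left-invariant volume form on $G$ with value $\nu$ at $e$, and $f_0:G\to\mathbb{R}$ is $f_0(g)=\det(\mathrm{Ad}^n_g)$, with $\mathrm{Ad}^n:G\times\wedge^n\mathfrak{g}\to\wedge^n\mathfrak{g}$ the adjoint action of $G$ on $\wedge^n\mathfrak{g}$.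
   Context: A Poisson structure on a manifold $M$ is a bivector field $\Pi$ with $[\Pi,\Pi]=0$ (Schouten-Nijenhuis bracket). The map $\Pi^\sharp:T^*M\to TM$ is defined by $\langle\Pi^\sharp(\alpha),\beta\rangle=\Pi(\alpha,\beta)$, and the Hamiltonian vector field of $H\in C^\infty(M)$ is $X_H^\Pi=\Pi^\sharp(\mathrm{d}H)$. A Poisson-Lie group $(G,\Pi)$ is a Lie group $G$ with a Poisson structure $\Pi$ that is multiplicative: $\Pi(gh)=(L_g)_*(\Pi(h))+(R_h)_*(\Pi(g))$ for all $g,h\in G$. Then $\Pi(e)=0$. The differential of $\Pi$ at $e$ (intrinsic derivative) defines a linear map $\delta=\mathrm{d}_e\Pi:\mathfrak{g}\to\wedge^2\mathfrak{g}$, where $\mathfrak{g}=T_eG$, and its dual map $\delta^*=[\cdot,\cdot]_{\mathfrak{g}^*}:\wedge^2\mathfrak{g}^*\to\mathfrak{g}^*$ is a Lie bracket on $\mathfrak{g}^*$; $(\mathfrak{g}^*,[\cdot,\cdot]_{\mathfrak{g}^*})$ is called the dual Lie algebra. A finite-dimensional Lie algebra $\mathfrak{h}$ is unimodular if its modular character $\mathcal{M}_{\mathfrak{h}}\in\mathfrak{h}^*$, $\mathcal{M}_{\mathfrak{h}}(\xi)=\mathrm{Tr}(\mathrm{ad}_\xi)$, vanishes. (An orientable Poisson manifold is called unimodular if it has a volume form preserved by all Hamiltonian vector fields; it is known that a connected Poisson-Lie group $(G,\Pi)$ is unimodular in this sense if and only if $\mathfrak{g}^*$ is a unimodular Lie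 algebra.) A function $H\in C^\infty(G)$ is Morse at $e$ if (i) $\mathrm{d}H(e)=0$, and (ii) the Hessian of $H$ at $e$ is nondegenerate, where the Hessian is the symmetric bilinear form on $\mathfrak{g}$ given by $(\mathrm{Hess}\,H)(e)(\xi,\eta)=\xi(X^\eta(H))$ for $\xi,\eta\in\mathfrak{g}$, with $X^\eta$ any vector field on $G$ such that $X^\eta(e)=\eta$. A volume form is a nowhere vanishing form of top degree. Since $G$ is connected and $f_0(e)=1$, the function $f_0$ is everywhere positive. A vector field $X$ preserves a volume form $\Phi$ if $\mathcal{L}_X\Phi=0$. *)

theory Defs
  imports "HOL-Analysis.Analysis" "HOL-Algebra.Group"
begin

section \<open>Smooth manifolds\<close>

text \<open>Meant for open \<^term>\<open>S\<close>: every iterated directional derivative exists and is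
  continuous.\<close>

fun higher_differentiable_on ::
    "'e::real_normed_vector set \<Rightarrow> ('e \<Rightarrow> 'f::real_normed_vector) \<Rightarrow> nat \<Rightarrow> bool" where
  "higher_differentiable_on S f 0 \<longleftrightarrow> continuous_on S f"
| "higher_differentiable_on S f (Suc k) \<longleftrightarrow> (\<forall>x\<in>S. f differentiable (at x)) \<and>
     (\<forall>v. higher_differentiable_on S (\<lambda>x. frechet_derivative f (at x) v) k)"

definition smooth_on :: "'e::real_normed_vector set \<Rightarrow> ('e \<Rightarrow> 'f::real_normed_vector) \<Rightarrow> bool" where
  "smooth_on S f \<longleftrightarrow> (\<forall>k. higher_differentiable_on S f k)"

text \<open>A chart is a pair of an open domain and a coordinate map; the values of the coordinate map
  outside the domain are irrelevant.\<close>

type_synonym ('a, 'e) chart = "'a set \<times> ('a \<Rightarrow> 'e)"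

definition chart_inv :: "('a, 'e) chart \<Rightarrow> 'e \<Rightarrow> 'a" where
  "chart_inv c = inv_into (fst c) (snd c)"

definition smooth_atlas ::
    "('a::{t2_space,second_countable_topology}, 'e::euclidean_space) chart set \<Rightarrow> bool" where
  "smooth_atlas A \<longleftrightarrow>
     (\<forall>c\<in>A. open (fst c) \<and> open (snd c ` fst c) \<and>
        homeomorphism (fst c) (snd c ` fst c) (snd c) (chart_inv c)) \<and>
     (\<forall>c\<in>A. \<forall>d\<in>A. smooth_on (snd c ` (fst c \<inter> fst d)) (snd d \<circ> chart_inv c))"

definition atlas_carrier :: "('a, 'e) chart set \<Rightarrow> 'a set" where
  "atlas_carrier A = (\<Union>c\<in>A. fst c)"

definition euclidean_atlas :: "('e, 'e) chart set" where
  "euclidean_atlas = {(UNIV, id)}"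

definition product_atlas ::
    "('a, 'e) chart set \<Rightarrow> ('b, 'f) chart set \<Rightarrow> ('a \<times> 'b, 'e \<times> 'f) chart set" where
  "product_atlas A B = {(fst c \<times> fst d, map_prod (snd c) (snd d)) | c d. c \<in> A \<and> d \<in> B}"

definition smooth_map ::
    "('a::topological_space, 'e::euclidean_space) chart set \<Rightarrow>
     ('b::topological_space, 'f::euclidean_space) chart set \<Rightarrow> ('a \<Rightarrow> 'b) \<Rightarrow> bool" where
  "smooth_map A B F \<longleftrightarrow>
     F ` atlas_carrier A \<subseteq> atlas_carrier B \<and> continuous_on (atlas_carrier A) F \<and>
     (\<forall>c\<in>A. \<forall>d\<in>B. smooth_on (snd c ` (fst c \<inter> F -` fst d)) (snd d \<circ> F \<circ> chart_inv c))"

abbreviation smooth_function ::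
    "('a::topological_space, 'e::euclidean_space) chart set \<Rightarrow> ('a \<Rightarrow> real) \<Rightarrow> bool" where
  "smooth_function A f \<equiv> smooth_map A euclidean_atlas f"

section \<open>Tangent maps\<close>

text \<open>At every point \<^term>\<open>p\<close> one chart of the atlas is singled out, and the tangent space
  at \<^term>\<open>p\<close> is the model space \<^typ>\<open>'e\<close>, a vector being given by its components in
  that chart.  Accordingly the cotangent space at \<^term>\<open>p\<close> is \<^typ>\<open>'e \<Rightarrow>\<^sub>L real\<close>, and
  a vector field is a function with values in \<^typ>\<open>'e\<close>.  As the singled-out chart varies with the
  point, regularity and derivatives of tensor fields are always expressed through the
  representations in one fixed chart introduced below.\<close>

definition chart_at :: "('a, 'e) chart set \<Rightarrow> 'a \<Rightarrow> ('a, 'e) chart" where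
  "chart_at A p = (SOME c. c \<in> A \<and> p \<in> fst c)"

definition tangent_map ::
    "('a, 'e::euclidean_space) chart set \<Rightarrow> ('b, 'f::euclidean_space) chart set \<Rightarrow>
     ('a \<Rightarrow> 'b) \<Rightarrow> 'a \<Rightarrow> ('e \<Rightarrow>\<^sub>L 'f)" where
  "tangent_map A B F p =
     Blinfun (frechet_derivative (snd (chart_at B (F p)) \<circ> F \<circ> chart_inv (chart_at A p))
       (at (snd (chart_at A p) p)))"

abbreviation differential ::
    "('a, 'e::euclidean_space) chart set \<Rightarrow> ('a \<Rightarrow> real) \<Rightarrow> 'a \<Rightarrow> ('e \<Rightarrow>\<^sub>L real)" where
  "differential A f p \<equiv> tangent_map A euclidean_atlas f p"

text \<open>For \<^term>\<open>p\<close> in the domain of the chart \<^term>\<open>c\<close>, these are mutually inverse: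
  \<open>to_coords\<close> sends a tangent vector at \<^term>\<open>p\<close> to its components in \<^term>\<open>c\<close>, and
  \<open>from_coords\<close> sends the standard basis to the coordinate vectors of \<^term>\<open>c\<close>.\<close>

definition to_coords ::
    "('a, 'e::euclidean_space) chart set \<Rightarrow> ('a, 'e) chart \<Rightarrow> 'a \<Rightarrow> ('e \<Rightarrow>\<^sub>L 'e)" where
  "to_coords A c p = tangent_map A euclidean_atlas (snd c) p"

definition from_coords ::
    "('a, 'e::euclidean_space) chart set \<Rightarrow> ('a, 'e) chart \<Rightarrow> 'a \<Rightarrow> ('e \<Rightarrow>\<^sub>L 'e)" where
  "from_coords A c p = tangent_map euclidean_atlas A (chart_inv c) (snd c p)"

section \<open>Vector fields\<close>

definition local_vector ::
    "('a, 'e::euclidean_space) chart set \<Rightarrow> ('a \<Rightarrow> 'e) \<Rightarrow> ('a, 'e) chart \<Rightarrow> 'e \<Rightarrow> 'e" where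
  "local_vector A X c x = to_coords A c (chart_inv c x) (X (chart_inv c x))"

definition smooth_vector_field ::
    "('a, 'e::euclidean_space) chart set \<Rightarrow> ('a \<Rightarrow> 'e) \<Rightarrow> bool" where
  "smooth_vector_field A X \<longleftrightarrow> (\<forall>c\<in>A. smooth_on (snd c ` fst c) (local_vector A X c))"

definition apply_vector_field ::
    "('a, 'e::euclidean_space) chart set \<Rightarrow> ('a \<Rightarrow> 'e) \<Rightarrow> ('a \<Rightarrow> real) \<Rightarrow> 'a \<Rightarrow> real" where
  "apply_vector_field A X f p = differential A f p (X p)"

section \<open>Differential forms of top degree\<close>

text \<open>Alternating multilinear forms whose arguments are indexed by a finite type.  Over
  \<^typ>\<open>real^'n\<close> and with index type \<^typ>\<open>'n\<close> these are the forms of top degree.\<close>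

definition alternating_form :: "(('i::finite \<Rightarrow> 'v::real_vector) \<Rightarrow> real) \<Rightarrow> bool" where
  "alternating_form \<omega> \<longleftrightarrow>
     (\<forall>v i. linear (\<lambda>x. \<omega> (v(i := x)))) \<and> (\<forall>v i j. i \<noteq> j \<and> v i = v j \<longrightarrow> \<omega> v = 0)"

definition local_form ::
    "('a, real^'n) chart set \<Rightarrow> ('a \<Rightarrow> ('n \<Rightarrow> real^'n) \<Rightarrow> real) \<Rightarrow> ('a, real^'n) chart \<Rightarrow>
     real^'n \<Rightarrow> ('n \<Rightarrow> real^'n) \<Rightarrow> real" where
  "local_form A \<Phi> c x v = \<Phi> (chart_inv c x) (\<lambda>i. from_coords A c (chart_inv c x) (v i))"

definition volume_form ::
    "('a, real^'n) chart set \<Rightarrow> ('a \<Rightarrow> ('n \<Rightarrow> real^'n) \<Rightarrow> real) \<Rightarrow> bool" where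
  "volume_form A \<Phi> \<longleftrightarrow>
     (\<forall>p\<in>atlas_carrier A. alternating_form (\<Phi> p) \<and> \<Phi> p \<noteq> (\<lambda>v. 0)) \<and>
     (\<forall>c\<in>A. \<forall>v. smooth_on (snd c ` fst c) (\<lambda>x. local_form A \<Phi> c x v))"

text \<open>The coordinate formula
  \<open>(L\<^sub>X \<Phi>)(v\<^sub>1,\<dots>,v\<^sub>n) = D\<Phi>(X)(v\<^sub>1,\<dots>,v\<^sub>n) + (\<Sum>i. \<Phi>(v\<^sub>1,\<dots>,DX(v\<^sub>i),\<dots>,v\<^sub>n))\<close> in the chart at
  \<^term>\<open>p\<close>, i.e. \<open>X(\<Phi>(Y\<^sub>1,\<dots>,Y\<^sub>n)) - (\<Sum>i. \<Phi>(Y\<^sub>1,\<dots>,[X,Y\<^sub>i],\<dots>,Y\<^sub>n))\<close> for the fields \<open>Y\<^sub>i\<close> that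
  extend \<open>v\<^sub>i\<close> with constant components, for which \<open>[X,Y\<^sub>i] = -DX(v\<^sub>i)\<close>.\<close>

definition lie_derivative ::
    "('a, real^'n) chart set \<Rightarrow> ('a \<Rightarrow> real^'n) \<Rightarrow> ('a \<Rightarrow> ('n \<Rightarrow> real^'n) \<Rightarrow> real) \<Rightarrow>
     'a \<Rightarrow> ('n \<Rightarrow> real^'n) \<Rightarrow> real" where
  "lie_derivative A X \<Phi> p v =
     (let c = chart_at A p; x = snd c p in
       frechet_derivative (\<lambda>y. local_form A \<Phi> c y v) (at x) (X p) +
       (\<Sum>i\<in>UNIV. \<Phi> p (v(i := frechet_derivative (local_vector A X c) (at x) (v i)))))"

definition preserves ::
    "('a, real^'n) chart set \<Rightarrow> ('a \<Rightarrow> real^'n) \<Rightarrow> ('a \<Rightarrow> ('n \<Rightarrow> real^'n) \<Rightarrow> real) \<Rightarrow> bool" where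
  "preserves A X \<Phi> \<longleftrightarrow> (\<forall>p\<in>atlas_carrier A. \<forall>v. lie_derivative A X \<Phi> p v = 0)"

section \<open>Bivector fields and Poisson structures\<close>

text \<open>A bivector at a point is an alternating bilinear form on the cotangent space.\<close>

type_synonym 'e bivector = "('e \<Rightarrow>\<^sub>L real) \<Rightarrow> ('e \<Rightarrow>\<^sub>L real) \<Rightarrow> real"

definition push_bivector ::
    "('e::euclidean_space \<Rightarrow>\<^sub>L 'f::euclidean_space) \<Rightarrow> 'e bivector \<Rightarrow> 'f bivector" where
  "push_bivector T P \<alpha> \<beta> = P (\<alpha> o\<^sub>L T) (\<beta> o\<^sub>L T)"

definition local_bivector ::
    "('a, 'e::euclidean_space) chart set \<Rightarrow> ('a \<Rightarrow> 'e bivector) \<Rightarrow> ('a, 'e) chart \<Rightarrow>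
     'e \<Rightarrow> 'e bivector" where
  "local_bivector A P c x = push_bivector (to_coords A c (chart_inv c x)) (P (chart_inv c x))"

definition bivector_field ::
    "('a, 'e::euclidean_space) chart set \<Rightarrow> ('a \<Rightarrow> 'e bivector) \<Rightarrow> bool" where
  "bivector_field A P \<longleftrightarrow>
     (\<forall>p\<in>atlas_carrier A. bilinear (P p) \<and> (\<forall>\<alpha>. P p \<alpha> \<alpha> = 0)) \<and>
     (\<forall>c\<in>A. \<forall>\<alpha> \<beta>. smooth_on (snd c ` fst c) (\<lambda>x. local_bivector A P c x \<alpha> \<beta>))"

text \<open>The Schouten-Nijenhuis bracket of two bivector fields, in the chart at \<^term>\<open>p\<close>:
  \<open>[P,Q]\<^sup>i\<^sup>j\<^sup>k = (\<Sum>l. Q\<^sup>l\<^sup>k \<partial>\<^sub>l P\<^sup>i\<^sup>j + P\<^sup>l\<^sup>k \<partial>\<^sub>l Q\<^sup>i\<^sup>j)\<close> summed over the cyclic permutations of \<open>i, j, k\<close>.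
  It is normalised so that \<open>[\<pi>,\<pi>](df,dg,dh)\<close> is twice the cyclic sum of \<open>{{f,g},h}\<close>; sign
  conventions in the literature differ.\<close>

definition schouten_bracket ::
    "('a, 'e::euclidean_space) chart set \<Rightarrow> ('a \<Rightarrow> 'e bivector) \<Rightarrow> ('a \<Rightarrow> 'e bivector) \<Rightarrow> 'a \<Rightarrow>
     ('e \<Rightarrow>\<^sub>L real) \<Rightarrow> ('e \<Rightarrow>\<^sub>L real) \<Rightarrow> ('e \<Rightarrow>\<^sub>L real) \<Rightarrow> real" where
  "schouten_bracket A P Q p \<alpha> \<beta> \<gamma> =
     (let c = chart_at A p; x = snd c p;
          D = (\<lambda>R \<alpha> \<beta>. Blinfun (frechet_derivative (\<lambda>y. local_bivector A R c y \<alpha> \<beta>) (at x)));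
          T = (\<lambda>\<alpha> \<beta> \<gamma>. Q p (D P \<alpha> \<beta>) \<gamma> + P p (D Q \<alpha> \<beta>) \<gamma>)
      in T \<alpha> \<beta> \<gamma> + T \<beta> \<gamma> \<alpha> + T \<gamma> \<alpha> \<beta>)"

definition poisson_structure ::
    "('a, 'e::euclidean_space) chart set \<Rightarrow> ('a \<Rightarrow> 'e bivector) \<Rightarrow> bool" where
  "poisson_structure A \<pi> \<longleftrightarrow> bivector_field A \<pi> \<and>
     (\<forall>p\<in>atlas_carrier A. \<forall>\<alpha> \<beta> \<gamma>. schouten_bracket A \<pi> \<pi> p \<alpha> \<beta> \<gamma> = 0)"

definition sharp :: "'e::euclidean_space bivector \<Rightarrow> ('e \<Rightarrow>\<^sub>L real) \<Rightarrow> 'e" where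
  "sharp P \<alpha> = (THE v. \<forall>\<beta>. blinfun_apply \<beta> v = P \<alpha> \<beta>)"

definition hamiltonian_vector_field ::
    "('a, 'e::euclidean_space) chart set \<Rightarrow> ('a \<Rightarrow> 'e bivector) \<Rightarrow> ('a \<Rightarrow> real) \<Rightarrow> 'a \<Rightarrow> 'e" where
  "hamiltonian_vector_field A \<pi> H p = sharp (\<pi> p) (differential A H p)"

section \<open>Lie groups and Poisson-Lie groups\<close>

definition lie_group ::
    "('a::{t2_space,second_countable_topology}, 'm) monoid_scheme \<Rightarrow>
     ('a, 'e::euclidean_space) chart set \<Rightarrow> bool" where
  "lie_group G A \<longleftrightarrow> group G \<and> smooth_atlas A \<and> atlas_carrier A = carrier G \<and>
     smooth_map (product_atlas A A) A (\<lambda>(g, h). g \<otimes>\<^bsub>G\<^esub> h) \<and>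
     smooth_map A A (\<lambda>g. inv\<^bsub>G\<^esub> g)"

definition multiplicative ::
    "('a, 'm) monoid_scheme \<Rightarrow> ('a, 'e::euclidean_space) chart set \<Rightarrow>
     ('a \<Rightarrow> 'e bivector) \<Rightarrow> bool" where
  "multiplicative G A \<pi> \<longleftrightarrow>
     (\<forall>g\<in>carrier G. \<forall>h\<in>carrier G. \<forall>\<alpha> \<beta>.
        \<pi> (g \<otimes>\<^bsub>G\<^esub> h) \<alpha> \<beta> =
          push_bivector (tangent_map A A (\<lambda>x. g \<otimes>\<^bsub>G\<^esub> x) h) (\<pi> h) \<alpha> \<beta> +
          push_bivector (tangent_map A A (\<lambda>x. x \<otimes>\<^bsub>G\<^esub> h) g) (\<pi> g) \<alpha> \<beta>)"

definition poisson_lie_group ::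
    "('a::{t2_space,second_countable_topology}, 'm) monoid_scheme \<Rightarrow>
     ('a, 'e::euclidean_space) chart set \<Rightarrow> ('a \<Rightarrow> 'e bivector) \<Rightarrow> bool" where
  "poisson_lie_group G A \<pi> \<longleftrightarrow>
     lie_group G A \<and> poisson_structure A \<pi> \<and> multiplicative G A \<pi>"

text \<open>The Lie algebra, as the tangent space at the identity, is the model space.  The intrinsic
  derivative of a section at a zero is its derivative in any local trivialisation, here the one
  given by the chart at the identity.\<close>

definition intrinsic_derivative ::
    "('a, 'm) monoid_scheme \<Rightarrow> ('a, 'e::euclidean_space) chart set \<Rightarrow>
     ('a \<Rightarrow> 'e bivector) \<Rightarrow> 'e \<Rightarrow> 'e bivector" where
  "intrinsic_derivative G A \<pi> \<xi> \<alpha> \<beta> =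
     (let c = chart_at A \<one>\<^bsub>G\<^esub> in
       frechet_derivative (\<lambda>x. local_bivector A \<pi> c x \<alpha> \<beta>) (at (snd c \<one>\<^bsub>G\<^esub>)) \<xi>)"

definition dual_bracket ::
    "('a, 'm) monoid_scheme \<Rightarrow> ('a, 'e::euclidean_space) chart set \<Rightarrow> ('a \<Rightarrow> 'e bivector) \<Rightarrow>
     ('e \<Rightarrow>\<^sub>L real) \<Rightarrow> ('e \<Rightarrow>\<^sub>L real) \<Rightarrow> ('e \<Rightarrow>\<^sub>L real)" where
  "dual_bracket G A \<pi> \<alpha> \<beta> = Blinfun (\<lambda>\<xi>. intrinsic_derivative G A \<pi> \<xi> \<alpha> \<beta>)"

definition dual_basis :: "'n::finite \<Rightarrow> ((real^'n) \<Rightarrow>\<^sub>L real)" where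
  "dual_basis j = Blinfun (\<lambda>v. v $ j)"

text \<open>Trace of \<open>ad \<alpha>\<close> for a Lie bracket on the dual of \<^typ>\<open>real^'n\<close>, via its matrix in the
  dual basis.\<close>

definition modular_character ::
    "(((real^'n) \<Rightarrow>\<^sub>L real) \<Rightarrow> ((real^'n) \<Rightarrow>\<^sub>L real) \<Rightarrow> ((real^'n) \<Rightarrow>\<^sub>L real)) \<Rightarrow>
     ((real^'n) \<Rightarrow>\<^sub>L real) \<Rightarrow> real" where
  "modular_character br \<alpha> = trace (\<chi> i j. blinfun_apply (br \<alpha> (dual_basis j)) (axis i 1))"

definition unimodular ::
    "(((real^'n) \<Rightarrow>\<^sub>L real) \<Rightarrow> ((real^'n) \<Rightarrow>\<^sub>L real) \<Rightarrow> ((real^'n) \<Rightarrow>\<^sub>L real)) \<Rightarrow> bool" where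
  "unimodular br \<longleftrightarrow> (\<forall>\<alpha>. modular_character br \<alpha> = 0)"

text \<open>The choice of the vector field extending \<^term>\<open>\<eta>\<close> is immaterial when \<^term>\<open>p\<close> is a
  critical point of \<^term>\<open>H\<close>.\<close>

definition hessian ::
    "('a, 'e::euclidean_space) chart set \<Rightarrow> ('a \<Rightarrow> real) \<Rightarrow> 'a \<Rightarrow> 'e \<Rightarrow> 'e \<Rightarrow> real" where
  "hessian A H p \<xi> \<eta> =
     (let X = (SOME X. smooth_vector_field A X \<and> X p = \<eta>)
      in differential A (apply_vector_field A X H) p \<xi>)"

definition morse_at :: "('a, 'e::euclidean_space) chart set \<Rightarrow> ('a \<Rightarrow> real) \<Rightarrow> 'a \<Rightarrow> bool" where
  "morse_at A H p \<longleftrightarrow> differential A H p = 0 \<and>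
     (\<forall>\<xi>. (\<forall>\<eta>. hessian A H p \<xi> \<eta> = 0) \<longrightarrow> \<xi> = 0)"

definition left_invariant_form ::
    "('a, 'm) monoid_scheme \<Rightarrow> ('a, real^'n) chart set \<Rightarrow> (('n \<Rightarrow> real^'n) \<Rightarrow> real) \<Rightarrow>
     'a \<Rightarrow> ('n \<Rightarrow> real^'n) \<Rightarrow> real" where
  "left_invariant_form G A \<nu> g v = \<nu> (\<lambda>i. tangent_map A A (\<lambda>x. inv\<^bsub>G\<^esub> g \<otimes>\<^bsub>G\<^esub> x) g (v i))"

definition Ad ::
    "('a, 'm) monoid_scheme \<Rightarrow> ('a, 'e::euclidean_space) chart set \<Rightarrow> 'a \<Rightarrow> ('e \<Rightarrow>\<^sub>L 'e)" where
  "Ad G A g = tangent_map A A (\<lambda>x. g \<otimes>\<^bsub>G\<^esub> x \<otimes>\<^bsub>G\<^esub> inv\<^bsub>G\<^esub> g) \<one>\<^bsub>G\<^esub>"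

text \<open>Multivectors of top degree are alternating forms on the dual of the Lie algebra, on which
  \<^term>\<open>g\<close> acts by \<open>w \<mapsto> w \<circ> (Ad\<^sub>g\<^sup>*)\<^sup>n\<close>, that is,
  \<open>\<xi>\<^sub>1 \<and> \<dots> \<and> \<xi>\<^sub>n \<mapsto> Ad\<^sub>g \<xi>\<^sub>1 \<and> \<dots> \<and> Ad\<^sub>g \<xi>\<^sub>n\<close>.\<close>

definition Ad_top ::
    "('a, 'm) monoid_scheme \<Rightarrow> ('a, real^'n) chart set \<Rightarrow> 'a \<Rightarrow>
     (('n \<Rightarrow> ((real^'n) \<Rightarrow>\<^sub>L real)) \<Rightarrow> real) \<Rightarrow> ('n \<Rightarrow> ((real^'n) \<Rightarrow>\<^sub>L real)) \<Rightarrow> real" where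
  "Ad_top G A g w = (\<lambda>\<alpha>. w (\<lambda>i. \<alpha> i o\<^sub>L Ad G A g))"

text \<open>The multivectors of top degree form a line, and the determinant of an endomorphism of a
  line is the scalar by which it acts.\<close>

definition det_Ad_top :: "('a, 'm) monoid_scheme \<Rightarrow> ('a, real^'n) chart set \<Rightarrow> 'a \<Rightarrow> real" where
  "det_Ad_top G A g =
     (THE r. \<forall>w. alternating_form w \<longrightarrow> Ad_top G A g w = (\<lambda>\<alpha>. r * w \<alpha>))"

end

theory Submission
  imports Defs
begin

text \<open>
  In a chart, a bivector field has a skew matrix of components \<open>p i j\<close>, a volume form has a density
  \<open>\<phi>\<close>, and the Hamiltonian vector field of \<open>F\<close> has components \<open>\<Sum>i. \<partial>\<^sub>i F * p i j\<close>.  In its divergence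
  the second derivatives of \<open>F\<close> are contracted with the skew matrix and cancel.  So \<open>L\<^sub>X \<Phi> = 0\<close> becomes
  \<open>\<Sum>i. \<partial>\<^sub>i F * m i = 0\<close> with \<open>m i = \<Sum>j. p i j * \<partial>\<^sub>j \<phi> + \<phi> * \<partial>\<^sub>j (p i j)\<close>: these are the components of the
  modular vector field, up to the factor \<open>\<phi>\<close> (\<open>weighted_divergence_hamiltonian\<close>).

  A multiplicative bivector field vanishes at the identity, hence there \<open>m i = \<phi> * (\<Sum>j. \<partial>\<^sub>j (p i j))\<close>, which is
  \<open>\<phi>\<close> times the modular character of the dual Lie algebra on \<open>dx\<^sup>i\<close>.  If \<open>H\<close> is Morse at the identity
  and its Hamiltonian vector field preserves a volume form, then \<open>\<Sum>i. \<partial>\<^sub>i H * m i\<close> vanishes near the identity;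
  differentiating it at the critical point leaves the Hessian of \<open>H\<close> applied to \<open>m\<close>, and
  nondegeneracy gives \<open>m = 0\<close> (\<open>modular_coeff_zero_at_morse_point\<close>).

  For the invariant volume form, note that the right-invariant form with value \<open>\<nu>\<close> is \<open>f\<^sub>0\<close> times the
  left-invariant one; so \<open>\<Psi> = \<surd>f\<^sub>0 \<nu>\<^sup>l\<close> is, up to a constant factor, the geometric mean of the two, and
  its density is a constant multiple of \<open>1 / \<surd>(det L * det R)\<close>, where \<open>L\<close> and \<open>R\<close> are the matrices of
  the left- and right-invariant frames.  To see that its modular vector field vanishes at \<open>g\<close>, translate
  \<open>g\<close> to the identity on the left.  This multiplies \<open>\<Psi>\<close> by a constant, because \<open>f\<^sub>0\<close> is a homomorphism.  The
  bivector field becomes \<open>q \<mapsto> (L\<^sub>g)\<^sup>-\<^sup>1 \<pi> (g q)\<close>, and multiplicativity, applied to \<open>g q\<close> and to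
  \<open>(g q g\<^sup>-\<^sup>1) g\<close>, splits it near the identity in two ways:
    \<^item> as \<open>\<pi>\<close> plus the right-invariant bivector field with value \<open>c\<close> at the identity
      (\<open>translated_bivector_right\<close>);
    \<^item> as the transport of \<open>\<pi>\<close> under conjugation plus the left-invariant bivector field with the same value \<open>c\<close>
      (\<open>translated_bivector_left\<close>).
  The first summands vanish at the identity, and unimodularity says that their linear parts do
  not contribute to \<open>m\<close>.  For the second summands, averaged over the two splittings, everything is expressed by
  the mixed second derivative \<open>\<beta>\<close> of the multiplication at the identity: the terms \<open>c k l * \<beta> k l\<close> and
  \<open>c k l * \<beta> l k\<close> cancel since \<open>c\<close> is skew, and the remaining traces of \<open>\<beta>\<close> are cancelled
  by the derivative of \<open>1 / \<surd>(det L * det R)\<close> (\<open>modular_coeff_zero_of_two_splittings\<close>).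

  As the Lie derivative at a point is computed in the chart singled out there, both arguments need
  that the vanishing of the divergence does not depend on coordinates; this is
  \<open>weighted_divergence_natural\<close>.
\<close>

section \<open>Calculus of smooth maps\<close>

lemma higher_differentiable_on_subset:
  assumes "higher_differentiable_on S f k" "T \<subseteq> S"
  shows "higher_differentiable_on T f k"
  using assms by (induction k arbitrary: f) (auto intro: continuous_on_subset)

lemma higher_differentiable_on_cong:
  assumes "open S" "\<And>x. x \<in> S \<Longrightarrow> f x = g x" "higher_differentiable_on S f k"
  shows "higher_differentiable_on S g k"
  using assms(2,3)
proof (induction k arbitrary: f g)
  case 0
  then show ?case by (simp cong: continuous_on_cong)
next
  case (Suc k)
  have d: "(g has_derivative frechet_derivative f (at x)) (at x)" if "x \<in> S" for x
  proof (rule has_derivative_transform_within_open[OF _ assms(1) that])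
    show "(f has_derivative frechet_derivative f (at x)) (at x)"
      using Suc.prems(2) that by (simp add: frechet_derivative_works)
  qed (use Suc.prems(1) in auto)
  have "higher_differentiable_on S (\<lambda>x. frechet_derivative g (at x) v) k" for v
  proof (rule Suc.IH)
    show "higher_differentiable_on S (\<lambda>x. frechet_derivative f (at x) v) k"
      using Suc.prems(2) by simp
  qed (simp add: frechet_derivative_at[OF d])
  then show ?case using d by (auto simp: differentiable_def)
qed

lemma higher_differentiable_on_SucI:
  assumes "open S" "\<And>x. x \<in> S \<Longrightarrow> (f has_derivative f' x) (at x)"
    "\<And>v. higher_differentiable_on S (\<lambda>x. f' x v) k"
  shows "higher_differentiable_on S f (Suc k)"
proof -
  have "higher_differentiable_on S (\<lambda>x. frechet_derivative f (at x) v) k" for v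
    by (rule higher_differentiable_on_cong[OF assms(1) _ assms(3)[of v]])
      (simp add: frechet_derivative_at[OF assms(2)])
  then show ?thesis using assms(2) by (auto simp: differentiable_def)
qed

lemma higher_differentiable_on_SucD:
  "higher_differentiable_on S f (Suc k) \<Longrightarrow> higher_differentiable_on S f k"
proof (induction k arbitrary: f)
  case 0
  then show ?case
    by (simp add: differentiable_at_imp_differentiable_on differentiable_imp_continuous_on)
next
  case (Suc k)
  then show ?case by simp
qed

lemma higher_differentiable_on_has_derivative:
  "higher_differentiable_on S f (Suc k) \<Longrightarrow> x \<in> S \<Longrightarrow>
    (f has_derivative frechet_derivative f (at x)) (at x)"
  by (simp add: frechet_derivative_works)

lemma higher_differentiable_on_const:
  assumes "open S" shows "higher_differentiable_on S (\<lambda>x. c) k"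
proof (induction k arbitrary: c)
  case (Suc k)
  show ?case
    by (rule higher_differentiable_on_SucI[OF assms, where f' = "\<lambda>x v. 0"]) (auto intro: Suc)
qed simp

lemma higher_differentiable_on_add:
  assumes "open S" "higher_differentiable_on S f k" "higher_differentiable_on S g k"
  shows "higher_differentiable_on S (\<lambda>x. f x + g x) k"
  using assms(2,3)
proof (induction k arbitrary: f g)
  case (Suc k)
  show ?case
  proof (rule higher_differentiable_on_SucI[OF assms(1)])
    show "((\<lambda>x. f x + g x) has_derivative
      (\<lambda>v. frechet_derivative f (at x) v + frechet_derivative g (at x) v)) (at x)" if "x \<in> S" for x
      by (intro has_derivative_add higher_differentiable_on_has_derivative[OF Suc.prems(1) that]
          higher_differentiable_on_has_derivative[OF Suc.prems(2) that])
  qed (use Suc in auto)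
qed (auto intro: continuous_on_add)

lemma higher_differentiable_on_bounded_linear:
  assumes "open S" "bounded_linear T" "higher_differentiable_on S f k"
  shows "higher_differentiable_on S (\<lambda>x. T (f x)) k"
  using assms(3)
proof (induction k arbitrary: f)
  case (Suc k)
  show ?case
  proof (rule higher_differentiable_on_SucI[OF assms(1)])
    show "((\<lambda>x. T (f x)) has_derivative (\<lambda>v. T (frechet_derivative f (at x) v))) (at x)"
      if "x \<in> S" for x
      by (intro bounded_linear.has_derivative[OF assms(2)]
          higher_differentiable_on_has_derivative[OF Suc.prems that])
  qed (use Suc in auto)
qed (auto intro: bounded_linear.continuous_on[OF assms(2)])

lemma higher_differentiable_on_bounded_bilinear:
  assumes "open S" "bounded_bilinear b" "higher_differentiable_on S f k" "higher_differentiable_on S g k"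
  shows "higher_differentiable_on S (\<lambda>x. b (f x) (g x)) k"
  using assms(3,4)
proof (induction k arbitrary: f g)
  case (Suc k)
  note fg = Suc.prems[THEN higher_differentiable_on_SucD]
  show ?case
  proof (rule higher_differentiable_on_SucI[OF assms(1)])
    show "((\<lambda>x. b (f x) (g x)) has_derivative
       (\<lambda>v. b (f x) (frechet_derivative g (at x) v) + b (frechet_derivative f (at x) v) (g x))) (at x)"
      if "x \<in> S" for x
      by (intro bounded_bilinear.FDERIV[OF assms(2)]
          higher_differentiable_on_has_derivative[OF Suc.prems(1) that]
          higher_differentiable_on_has_derivative[OF Suc.prems(2) that])
    show "higher_differentiable_on S (\<lambda>x. b (f x) (frechet_derivative g (at x) v) +
        b (frechet_derivative f (at x) v) (g x)) k" for v
      using Suc.prems by (intro higher_differentiable_on_add[OF assms(1)] Suc.IH fg) auto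
  qed
qed (auto intro: bounded_bilinear.continuous_on[OF assms(2)])

lemma higher_differentiable_on_sum:
  assumes "open S" "finite I" "\<And>i. i \<in> I \<Longrightarrow> higher_differentiable_on S (f i) k"
  shows "higher_differentiable_on S (\<lambda>x. \<Sum>i\<in>I. f i x) k"
  using assms(2,3)
  by (induction I rule: finite_induct)
    (auto intro: higher_differentiable_on_const[OF assms(1)] higher_differentiable_on_add[OF assms(1)])

text \<open>By the chain rule a directional derivative of \<open>f \<circ> g\<close> is a sum of products of components of the
  derivative of \<open>g\<close> with partial derivatives of \<open>f\<close> composed with \<open>g\<close>.  The latter are again compositions
  with \<open>g\<close>, which is why the induction on the order is carried out for all \<open>f\<close> at once.\<close>

lemma higher_differentiable_on_compose:
  fixes f :: "'e::euclidean_space \<Rightarrow> 'f::real_normed_vector" and g :: "'d::real_normed_vector \<Rightarrow> 'e"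
  assumes "open S" "g ` S \<subseteq> T" "higher_differentiable_on T f k" "higher_differentiable_on S g k"
  shows "higher_differentiable_on S (\<lambda>x. f (g x)) k"
  using assms(3,4)
proof (induction k arbitrary: f)
  case 0
  then show ?case using assms(2) by (auto intro: continuous_on_compose2)
next
  case (Suc k)
  have lin: "linear (frechet_derivative f (at (g x)))" if "x \<in> S" for x
    using Suc.prems(1) that assms(2) by (auto intro!: linear_frechet_derivative)
  show ?case
  proof (rule higher_differentiable_on_SucI[OF assms(1)])
    show "((\<lambda>x. f (g x)) has_derivative
       (\<lambda>v. \<Sum>b\<in>Basis. (frechet_derivative g (at x) v \<bullet> b) *\<^sub>R frechet_derivative f (at (g x)) b)) (at x)"
      if "x \<in> S" for x
    proof -
      have eq: "frechet_derivative f (at (g x)) u =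
        (\<Sum>b\<in>Basis. (u \<bullet> b) *\<^sub>R frechet_derivative f (at (g x)) b)" for u
        by (subst euclidean_representation[of u, symmetric])
          (simp add: linear_sum[OF lin[OF that]] linear_scale[OF lin[OF that]])
      have "((\<lambda>x. f (g x)) has_derivative
         (\<lambda>v. frechet_derivative f (at (g x)) (frechet_derivative g (at x) v))) (at x)"
        using that assms(2)
        by (intro has_derivative_compose[OF higher_differentiable_on_has_derivative[OF Suc.prems(2) that]]
          higher_differentiable_on_has_derivative[OF Suc.prems(1)]) auto
      then show ?thesis by (simp only: eq[symmetric])
    qed
    show "higher_differentiable_on S (\<lambda>x. \<Sum>b\<in>Basis. (frechet_derivative g (at x) v \<bullet> b) *\<^sub>R
        frechet_derivative f (at (g x)) b) k" for v
    proof (intro higher_differentiable_on_sum[OF assms(1)] finite_Basis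
        higher_differentiable_on_bounded_bilinear[OF assms(1) bounded_bilinear_scaleR]
        higher_differentiable_on_bounded_linear[OF assms(1) bounded_linear_inner_left])
      show "higher_differentiable_on S (\<lambda>x. frechet_derivative g (at x) v) k"
        using Suc.prems(2) by simp
      show "higher_differentiable_on S (\<lambda>x. frechet_derivative f (at (g x)) b) k" for b
        using Suc.IH[of "\<lambda>y. frechet_derivative f (at y) b"] Suc.prems(1)
          higher_differentiable_on_SucD[OF Suc.prems(2)] by simp
    qed
  qed
qed

text \<open>The derivative is a polynomial in the inverse itself and the derivative of \<open>f\<close>, so the order can be
  raised step by step; the same device works for the square root below.\<close>

lemma higher_differentiable_on_inverse:
  fixes f :: "'e::real_normed_vector \<Rightarrow> real"
  assumes "open S" "\<And>x. x \<in> S \<Longrightarrow> f x \<noteq> 0" "higher_differentiable_on S f k"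
  shows "higher_differentiable_on S (\<lambda>x. inverse (f x)) k"
  using assms(3)
proof (induction k)
  case (Suc k)
  note IH = Suc.IH[OF higher_differentiable_on_SucD[OF Suc.prems]]
  show ?case
  proof (rule higher_differentiable_on_SucI[OF assms(1)])
    show "((\<lambda>x. inverse (f x)) has_derivative
       (\<lambda>v. (inverse (f x) * (frechet_derivative f (at x) v * inverse (f x))) * (-1))) (at x)" if "x \<in> S" for x
      using Deriv.has_derivative_inverse[OF assms(2)[OF that] higher_differentiable_on_has_derivative[OF Suc.prems that]]
      by (simp add: mult.assoc)
    show "higher_differentiable_on S
        (\<lambda>x. (inverse (f x) * (frechet_derivative f (at x) v * inverse (f x))) * (-1)) k" for v
      using Suc.prems IH
      by (intro higher_differentiable_on_bounded_bilinear[OF assms(1) bounded_bilinear_mult]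
          higher_differentiable_on_const[OF assms(1)]) auto
  qed
qed (use assms(2) in \<open>auto intro: continuous_on_inverse\<close>)

lemma higher_differentiable_on_sqrt:
  fixes f :: "'e::real_normed_vector \<Rightarrow> real"
  assumes "open S" "\<And>x. x \<in> S \<Longrightarrow> f x > 0" "higher_differentiable_on S f k"
  shows "higher_differentiable_on S (\<lambda>x. sqrt (f x)) k"
  using assms(3)
proof (induction k)
  case (Suc k)
  note fk = higher_differentiable_on_SucD[OF Suc.prems]
  note IH = Suc.IH[OF fk]
  show ?case
  proof (rule higher_differentiable_on_SucI[OF assms(1)])
    show "((\<lambda>x. sqrt (f x)) has_derivative
       (\<lambda>v. frechet_derivative f (at x) v * ((sqrt (f x) * inverse (f x)) * (1/2)))) (at x)" if "x \<in> S" for x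
    proof -
      have "((\<lambda>x. sqrt (f x)) has_derivative
        (\<lambda>v. frechet_derivative f (at x) v * (inverse (sqrt (f x)) / 2))) (at x)"
        by (rule has_derivative_eq_rhs, rule DERIV_compose_FDERIV[where f=sqrt])
          (use assms(2)[OF that] in \<open>auto intro!: DERIV_real_sqrt
             higher_differentiable_on_has_derivative[OF Suc.prems that]\<close>)
      moreover have "inverse (sqrt (f x)) = sqrt (f x) * inverse (f x)"
        using assms(2)[OF that] by (simp add: field_simps)
      ultimately show ?thesis by simp
    qed
    show "higher_differentiable_on S
        (\<lambda>x. frechet_derivative f (at x) v * ((sqrt (f x) * inverse (f x)) * (1/2))) k" for v
      using Suc.prems IH less_imp_neq[OF assms(2)]
      by (intro higher_differentiable_on_bounded_bilinear[OF assms(1) bounded_bilinear_mult]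
          higher_differentiable_on_const[OF assms(1)] higher_differentiable_on_inverse[OF assms(1)] fk) auto
  qed
qed (auto intro: continuous_intros)

lemma smooth_on_subset: "smooth_on S f \<Longrightarrow> T \<subseteq> S \<Longrightarrow> smooth_on T f"
  by (auto simp: smooth_on_def intro: higher_differentiable_on_subset)

lemma smooth_on_cong:
  "open S \<Longrightarrow> (\<And>x. x \<in> S \<Longrightarrow> f x = g x) \<Longrightarrow> smooth_on S f \<Longrightarrow> smooth_on S g"
  unfolding smooth_on_def by (blast intro: higher_differentiable_on_cong)

lemma smooth_on_has_derivative:
  "smooth_on S f \<Longrightarrow> x \<in> S \<Longrightarrow> (f has_derivative frechet_derivative f (at x)) (at x)"
  unfolding smooth_on_def using higher_differentiable_on_has_derivative by blast

lemma smooth_on_differentiable: "smooth_on S f \<Longrightarrow> x \<in> S \<Longrightarrow> f differentiable (at x)"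
  by (rule differentiableI[OF smooth_on_has_derivative])

lemma smooth_on_frechet_derivative:
  "smooth_on S f \<Longrightarrow> smooth_on S (\<lambda>x. frechet_derivative f (at x) v)"
  unfolding smooth_on_def using higher_differentiable_on.simps(2) by blast

lemma smooth_on_continuous_on: "smooth_on S f \<Longrightarrow> continuous_on S f"
  unfolding smooth_on_def using higher_differentiable_on.simps(1) by blast

lemma smooth_on_const: "open S \<Longrightarrow> smooth_on S (\<lambda>x. c)"
  by (simp add: smooth_on_def higher_differentiable_on_const)

lemma smooth_on_bounded_linear:
  "open S \<Longrightarrow> bounded_linear T \<Longrightarrow> smooth_on S f \<Longrightarrow> smooth_on S (\<lambda>x. T (f x))"
  by (simp add: smooth_on_def higher_differentiable_on_bounded_linear)

lemma smooth_on_id: "open S \<Longrightarrow> smooth_on S (\<lambda>x. x)"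
proof -
  assume "open S"
  have "higher_differentiable_on S (\<lambda>x. x) k" for k
  proof (cases k)
    case (Suc j)
    show ?thesis unfolding Suc
      by (rule higher_differentiable_on_SucI[OF \<open>open S\<close> has_derivative_ident])
        (rule higher_differentiable_on_const[OF \<open>open S\<close>])
  qed simp
  then show ?thesis by (simp add: smooth_on_def)
qed

lemma smooth_on_add:
  "open S \<Longrightarrow> smooth_on S f \<Longrightarrow> smooth_on S g \<Longrightarrow> smooth_on S (\<lambda>x. f x + g x)"
  by (simp add: smooth_on_def higher_differentiable_on_add)

lemma smooth_on_sum:
  "open S \<Longrightarrow> finite I \<Longrightarrow> (\<And>i. i \<in> I \<Longrightarrow> smooth_on S (f i)) \<Longrightarrow> smooth_on S (\<lambda>x. \<Sum>i\<in>I. f i x)"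
  by (simp add: smooth_on_def higher_differentiable_on_sum)

lemma smooth_on_bounded_bilinear:
  "open S \<Longrightarrow> bounded_bilinear b \<Longrightarrow> smooth_on S f \<Longrightarrow> smooth_on S g \<Longrightarrow> smooth_on S (\<lambda>x. b (f x) (g x))"
  by (simp add: smooth_on_def higher_differentiable_on_bounded_bilinear)

lemma smooth_on_mult:
  fixes f g :: "_ \<Rightarrow> real"
  shows "open S \<Longrightarrow> smooth_on S f \<Longrightarrow> smooth_on S g \<Longrightarrow> smooth_on S (\<lambda>x. f x * g x)"
  by (rule smooth_on_bounded_bilinear[OF _ bounded_bilinear_mult])

lemma smooth_on_prod:
  fixes f :: "'i \<Rightarrow> _ \<Rightarrow> real"
  assumes "open S" "finite I" "\<And>i. i \<in> I \<Longrightarrow> smooth_on S (f i)"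
  shows "smooth_on S (\<lambda>x. \<Prod>i\<in>I. f i x)"
  using assms(2,3)
  by (induction I rule: finite_induct) (auto intro: smooth_on_const[OF assms(1)] smooth_on_mult[OF assms(1)])

lemma smooth_on_compose:
  fixes f :: "'e::euclidean_space \<Rightarrow> 'f::real_normed_vector" and g :: "'d::real_normed_vector \<Rightarrow> 'e"
  shows "open S \<Longrightarrow> g ` S \<subseteq> T \<Longrightarrow> smooth_on T f \<Longrightarrow> smooth_on S g \<Longrightarrow> smooth_on S (\<lambda>x. f (g x))"
  by (simp add: smooth_on_def higher_differentiable_on_compose)

lemma smooth_on_inverse:
  fixes f :: "'e::real_normed_vector \<Rightarrow> real"
  shows "open S \<Longrightarrow> (\<And>x. x \<in> S \<Longrightarrow> f x \<noteq> 0) \<Longrightarrow> smooth_on S f \<Longrightarrow> smooth_on S (\<lambda>x. inverse (f x))"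
  by (simp add: smooth_on_def higher_differentiable_on_inverse)

lemma smooth_on_sqrt:
  fixes f :: "'e::real_normed_vector \<Rightarrow> real"
  shows "open S \<Longrightarrow> (\<And>x. x \<in> S \<Longrightarrow> f x > 0) \<Longrightarrow> smooth_on S f \<Longrightarrow> smooth_on S (\<lambda>x. sqrt (f x))"
  by (simp add: smooth_on_def higher_differentiable_on_sqrt)

lemma smooth_on_Pair:
  fixes f :: "'e::real_normed_vector \<Rightarrow> 'f::real_normed_vector" and g :: "'e \<Rightarrow> 'g::real_normed_vector"
  assumes "open S" "smooth_on S f" "smooth_on S g"
  shows "smooth_on S (\<lambda>x. (f x, g x))"
proof -
  have "smooth_on S (\<lambda>x. (f x, 0) + (0, g x))"
    using assms
    by (intro smooth_on_add smooth_on_bounded_linear[of S "\<lambda>a. (a, 0)" f]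
      smooth_on_bounded_linear[of S "\<lambda>a. (0, a)" g])
      (auto intro!: bounded_linear_Pair bounded_linear_zero bounded_linear_ident)
  then show ?thesis by simp
qed

lemma smooth_on_det:
  fixes M :: "'e::real_normed_vector \<Rightarrow> real^'n^'n"
  assumes "open S" "\<And>i j. smooth_on S (\<lambda>x. M x $ i $ j)"
  shows "smooth_on S (\<lambda>x. det (M x))"
  unfolding det_def using assms
  by (intro smooth_on_sum smooth_on_mult smooth_on_const smooth_on_prod) (auto simp: finite_permutations)

section \<open>Symmetry of second derivatives\<close>

text \<open>The mean value theorem is applied to the increment in direction \<open>w\<close> as a function of the step in
  direction \<open>v\<close>, and then to the resulting derivative.  The second difference on the left is symmetric in \<open>v\<close> and
  \<open>w\<close>, so exchanging them compares the two mixed derivatives.\<close>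

lemma mixed_difference_mvt:
  fixes f :: "'e::real_normed_vector \<Rightarrow> real"
  assumes f: "\<And>s t. \<bar>s\<bar> \<le> h \<Longrightarrow> \<bar>t\<bar> \<le> h \<Longrightarrow> f differentiable (at (x + s *\<^sub>R v + t *\<^sub>R w))"
    and f2: "\<And>s t. \<bar>s\<bar> \<le> h \<Longrightarrow> \<bar>t\<bar> \<le> h \<Longrightarrow>
      (\<lambda>y. frechet_derivative f (at y) v) differentiable (at (x + s *\<^sub>R v + t *\<^sub>R w))"
    and h: "h > 0"
  shows "\<exists>s t. \<bar>s\<bar> \<le> h \<and> \<bar>t\<bar> \<le> h \<and>
     f (x + h *\<^sub>R v + h *\<^sub>R w) - f (x + h *\<^sub>R v) - f (x + h *\<^sub>R w) + f x =
       h * h * frechet_derivative (\<lambda>y. frechet_derivative f (at y) v) (at (x + s *\<^sub>R v + t *\<^sub>R w)) w"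
proof -
  define k where "k s = f (x + s *\<^sub>R v + h *\<^sub>R w) - f (x + s *\<^sub>R v)" for s
  define Df where "Df = (\<lambda>y. frechet_derivative f (at y))"
  have lin: "((\<lambda>r. f (x + r *\<^sub>R v + t *\<^sub>R w)) has_real_derivative Df (x + s *\<^sub>R v + t *\<^sub>R w) v) (at s)"
    if "\<bar>s\<bar> \<le> h" "\<bar>t\<bar> \<le> h" for s t
  proof -
    have D: "(f has_derivative Df (x + s *\<^sub>R v + t *\<^sub>R w)) (at (x + s *\<^sub>R v + t *\<^sub>R w))"
      unfolding Df_def using f[OF that] by (simp add: frechet_derivative_works)
    have "((\<lambda>r. f (x + r *\<^sub>R v + t *\<^sub>R w)) has_derivative (\<lambda>r. Df (x + s *\<^sub>R v + t *\<^sub>R w) (r *\<^sub>R v))) (at s)"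
      by (rule has_derivative_compose[of "\<lambda>r. x + r *\<^sub>R v + t *\<^sub>R w" "\<lambda>r. r *\<^sub>R v" s UNIV f, OF _ D])
        (auto intro!: derivative_eq_intros)
    moreover have "(\<lambda>r. Df (x + s *\<^sub>R v + t *\<^sub>R w) (r *\<^sub>R v)) = (*) (Df (x + s *\<^sub>R v + t *\<^sub>R w) v)"
      using linear_scale[OF has_derivative_linear[OF D]] by auto
    ultimately show ?thesis by (simp add: has_field_derivative_def)
  qed
  have kd: "(k has_real_derivative Df (x + s *\<^sub>R v + h *\<^sub>R w) v - Df (x + s *\<^sub>R v) v) (at s)"
    if "\<bar>s\<bar> \<le> h" for s
    unfolding k_def using DERIV_diff[OF lin[OF that, of h] lin[OF that, of 0]] h by simp
  have "\<exists>s>0. s < h \<and> k h - k 0 = (h - 0) * (Df (x + s *\<^sub>R v + h *\<^sub>R w) v - Df (x + s *\<^sub>R v) v)"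
    by (rule MVT2[OF h]) (auto intro!: kd)
  then obtain s where s: "0 < s" "s < h"
    "k h - k 0 = h * (Df (x + s *\<^sub>R v + h *\<^sub>R w) v - Df (x + s *\<^sub>R v) v)" by auto
  define l where "l t = Df (x + s *\<^sub>R v + t *\<^sub>R w) v" for t
  define DDf where "DDf t = frechet_derivative (\<lambda>y. Df y v) (at (x + s *\<^sub>R v + t *\<^sub>R w)) w" for t
  have ld: "(l has_real_derivative DDf t) (at t)"
    if "\<bar>t\<bar> \<le> h" for t
  proof -
    have D: "((\<lambda>y. Df y v) has_derivative frechet_derivative (\<lambda>y. Df y v) (at (x + s *\<^sub>R v + t *\<^sub>R w)))
       (at (x + s *\<^sub>R v + t *\<^sub>R w))"
      unfolding Df_def using f2[of s t] that s by (simp add: frechet_derivative_works)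
    have "(l has_derivative (\<lambda>r. frechet_derivative (\<lambda>y. Df y v) (at (x + s *\<^sub>R v + t *\<^sub>R w)) (r *\<^sub>R w))) (at t)"
      unfolding l_def
      by (rule has_derivative_compose[of "\<lambda>r. x + s *\<^sub>R v + r *\<^sub>R w" "\<lambda>r. r *\<^sub>R w" t UNIV "\<lambda>y. Df y v", OF _ D]) (auto intro!: derivative_eq_intros)
    moreover have "(\<lambda>r. frechet_derivative (\<lambda>y. Df y v) (at (x + s *\<^sub>R v + t *\<^sub>R w)) (r *\<^sub>R w)) = (*) (DDf t)"
      unfolding DDf_def using linear_scale[OF has_derivative_linear[OF D]] by auto
    ultimately show ?thesis by (simp add: has_field_derivative_def)
  qed
  have "\<exists>t>0. t < h \<and> l h - l 0 = (h - 0) * DDf t"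
    by (rule MVT2[OF h]) (auto intro!: ld)
  then obtain t where t: "0 < t" "t < h" "l h - l 0 = h * DDf t" by auto
  show ?thesis
    using s t unfolding l_def DDf_def Df_def k_def
    by (intro exI[of _ s] exI[of _ t]) (auto simp: algebra_simps)
qed

text \<open>Divided by \<open>h\<^sup>2\<close>, the same second difference tends to either mixed derivative, by continuity of both.\<close>

lemma second_derivative_symmetric_real:
  fixes f :: "'e::real_normed_vector \<Rightarrow> real"
  assumes S: "open S" "x \<in> S" and f: "smooth_on S f"
  shows "frechet_derivative (\<lambda>y. frechet_derivative f (at y) v) (at x) w =
         frechet_derivative (\<lambda>y. frechet_derivative f (at y) w) (at x) v"
proof -
  define A where "A v w y = frechet_derivative (\<lambda>y. frechet_derivative f (at y) v) (at y) w" for v w y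
  have contA: "continuous_on S (A v w)" for v w
    unfolding A_def using f by (intro smooth_on_continuous_on smooth_on_frechet_derivative)
  have close: "\<exists>d>0. \<forall>h. 0 < h \<and> h < d \<longrightarrow>
     \<bar>(f (x + h *\<^sub>R v + h *\<^sub>R w) - f (x + h *\<^sub>R v) - f (x + h *\<^sub>R w) + f x) - h * h * A v w x\<bar> < h * h * e"
    if e: "e > 0" for v w e
  proof -
    obtain r where r: "r > 0" "ball x r \<subseteq> S" using S openE by blast
    have "isCont (A v w) x" using contA S continuous_on_eq_continuous_at by blast
    then obtain q where q: "q > 0" "\<And>y. dist y x < q \<Longrightarrow> dist (A v w y) (A v w x) < e"
      using e unfolding continuous_at_eps_delta by blast
    \<comment> \<open>steps below \<open>d\<close> in both directions stay inside \<open>S\<close> and inside the ball of continuity\<close>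
    define d where "d = min r q / (norm v + norm w + 1)"
    have pos: "norm v + norm w + 1 > 0" by (simp add: add_nonneg_pos)
    have d: "d > 0" unfolding d_def using r q pos by simp
    have near: "dist (x + s *\<^sub>R v + t *\<^sub>R w) x < min r q" if "\<bar>s\<bar> \<le> h" "\<bar>t\<bar> \<le> h" "0 < h" "h < d" for s t h
    proof -
      have "dist (x + s *\<^sub>R v + t *\<^sub>R w) x \<le> \<bar>s\<bar> * norm v + \<bar>t\<bar> * norm w"
        by (simp add: dist_norm add.assoc) (metis norm_scaleR norm_triangle_ineq)
      also have "\<dots> \<le> h * norm v + h * norm w" using that by (intro add_mono mult_right_mono) auto
      also have "\<dots> \<le> h * (norm v + norm w + 1)" using that by (simp add: algebra_simps)
      also have "\<dots> < min r q" using that pos unfolding d_def by (simp add: pos_less_divide_eq)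
      finally show ?thesis .
    qed
    have "\<bar>(f (x + h *\<^sub>R v + h *\<^sub>R w) - f (x + h *\<^sub>R v) - f (x + h *\<^sub>R w) + f x) - h * h * A v w x\<bar> < h * h * e"
      if h: "0 < h" "h < d" for h
    proof -
      have inS: "x + s *\<^sub>R v + t *\<^sub>R w \<in> S" if "\<bar>s\<bar> \<le> h" "\<bar>t\<bar> \<le> h" for s t
        using near[OF that h] r by (auto simp: dist_commute subset_iff)
      have "\<exists>s t. \<bar>s\<bar> \<le> h \<and> \<bar>t\<bar> \<le> h \<and>
         f (x + h *\<^sub>R v + h *\<^sub>R w) - f (x + h *\<^sub>R v) - f (x + h *\<^sub>R w) + f x =
         h * h * frechet_derivative (\<lambda>y. frechet_derivative f (at y) v) (at (x + s *\<^sub>R v + t *\<^sub>R w)) w"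
        using inS h f smooth_on_frechet_derivative[OF f, of v]
        by (intro mixed_difference_mvt) (blast intro: differentiableI smooth_on_has_derivative)+
      then obtain s t where st: "\<bar>s\<bar> \<le> h" "\<bar>t\<bar> \<le> h"
        "f (x + h *\<^sub>R v + h *\<^sub>R w) - f (x + h *\<^sub>R v) - f (x + h *\<^sub>R w) + f x = h * h * A v w (x + s *\<^sub>R v + t *\<^sub>R w)"
        unfolding A_def by blast
      have "\<bar>A v w (x + s *\<^sub>R v + t *\<^sub>R w) - A v w x\<bar> < e"
        using q(2)[of "x + s *\<^sub>R v + t *\<^sub>R w"] near[OF st(1,2) h] by (simp add: dist_real_def)
      then have "h * h * \<bar>A v w (x + s *\<^sub>R v + t *\<^sub>R w) - A v w x\<bar> < h * h * e"
        using h by simp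
      then show ?thesis unfolding st(3)
        by (simp add: abs_mult flip: right_diff_distrib)
    qed
    then show ?thesis using d by blast
  qed
  have "\<bar>A v w x - A w v x\<bar> < 2 * e" if e: "e > 0" for e
  proof -
    obtain d1 where d1: "d1 > 0" "\<And>h. 0 < h \<and> h < d1 \<Longrightarrow>
      \<bar>(f (x + h *\<^sub>R v + h *\<^sub>R w) - f (x + h *\<^sub>R v) - f (x + h *\<^sub>R w) + f x) - h * h * A v w x\<bar> < h * h * e"
      using close[OF e] by meson
    obtain d2 where d2: "d2 > 0" "\<And>h. 0 < h \<and> h < d2 \<Longrightarrow>
      \<bar>(f (x + h *\<^sub>R w + h *\<^sub>R v) - f (x + h *\<^sub>R w) - f (x + h *\<^sub>R v) + f x) - h * h * A w v x\<bar> < h * h * e"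
      using close[OF e] by meson
    define h where "h = min d1 d2 / 2"
    have h: "0 < h" "h < d1" "h < d2" using d1 d2 unfolding h_def by auto
    have "\<bar>h * h * A v w x - h * h * A w v x\<bar> < h * h * e + h * h * e"
    proof -
      have "x + h *\<^sub>R w + h *\<^sub>R v = x + h *\<^sub>R v + h *\<^sub>R w" by (simp add: ac_simps)
      from d1(2)[OF conjI[OF h(1,2)]] d2(2)[OF conjI[OF h(1,3)], unfolded this] show ?thesis
        by linarith
    qed
    moreover have "\<bar>h * h * A v w x - h * h * A w v x\<bar> = h * h * \<bar>A v w x - A w v x\<bar>"
      by (simp add: abs_mult flip: right_diff_distrib)
    ultimately have "h * h * \<bar>A v w x - A w v x\<bar> < h * h * (2 * e)"
      by linarith
    then show ?thesis using h by simp
  qed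
  from this[of "\<bar>A v w x - A w v x\<bar> / 2"] have "A v w x = A w v x" by auto
  then show ?thesis unfolding A_def .
qed

section \<open>Alternating forms and determinants\<close>

lemma alternating_form_linear:
  "alternating_form \<omega> \<Longrightarrow> linear (\<lambda>x. \<omega> (v(i := x)))"
  by (simp add: alternating_form_def)

lemma alternating_form_repeat:
  "alternating_form \<omega> \<Longrightarrow> i \<noteq> j \<Longrightarrow> v i = v j \<Longrightarrow> \<omega> v = 0"
  unfolding alternating_form_def by blast

lemma alternating_form_swap:
  assumes "alternating_form \<omega>" "i \<noteq> j"
  shows "\<omega> (v(i := x, j := y)) = - \<omega> (v(i := y, j := x))"
proof -
  have add1: "\<omega> (v(i := a + b, j := z)) = \<omega> (v(i := a, j := z)) + \<omega> (v(i := b, j := z))" for a b z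
    using linear_add[OF alternating_form_linear[OF assms(1)], of "v(j := z)" i a b] assms(2)
    by (simp add: fun_upd_twist)
  have add2: "\<omega> (v(i := z, j := a + b)) = \<omega> (v(i := z, j := a)) + \<omega> (v(i := z, j := b))" for a b z
    using linear_add[OF alternating_form_linear[OF assms(1)], of "v(i := z)" j a b] .
  have z: "\<omega> (v(i := a, j := a)) = 0" for a
    using alternating_form_repeat[OF assms(1,2)] assms(2) by simp
  show ?thesis
    using add1[of x y "x + y"] add2[of x x y] add2[of y x y] z[of "x + y"] z[of x] z[of y] by simp
qed

lemma alternating_form_scale_all:
  assumes "alternating_form \<omega>"
  shows "\<omega> (\<lambda>i. c i *\<^sub>R v i) = (\<Prod>i\<in>UNIV. c i) * \<omega> v"
proof -
  have "\<omega> (\<lambda>i. if i \<in> I then c i *\<^sub>R v i else v i) = (\<Prod>i\<in>I. c i) * \<omega> v" if "finite I" for I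
    using that
  proof (induction I rule: finite_induct)
    case (insert k I)
    define u where "u = (\<lambda>i. if i \<in> I then c i *\<^sub>R v i else v i)"
    have "(\<lambda>i. if i \<in> insert k I then c i *\<^sub>R v i else v i) = u(k := c k *\<^sub>R v k)"
      by (auto simp: u_def)
    moreover have "u = u(k := v k)" using insert.hyps by (auto simp: u_def)
    ultimately show ?case
      using linear_scale[OF alternating_form_linear[OF assms], of u k "c k" "v k"] insert
      by (simp add: u_def)
  qed simp
  from this[OF finite_class.finite_UNIV] show ?thesis by simp
qed

text \<open>Both sides are multiplicative in the matrix, so elementary matrices suffice.\<close>

lemma alternating_form_matrix_mult:
  fixes \<omega> :: "('n::finite \<Rightarrow> real^'n) \<Rightarrow> real"
  assumes \<omega>: "alternating_form \<omega>"
  shows "\<omega> (\<lambda>i. (A ** B) $ i) = det A * \<omega> (\<lambda>i. B $ i)"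
proof (induction A arbitrary: B rule: induct_matrix_elementary_alt)
  case (1 A1 A2)
  then show ?case by (simp add: det_mul flip: matrix_mul_assoc)
next
  case (2 A i)
  have "(A ** B) $ i = 0"
    using 2 by (simp add: row_def matrix_matrix_mult_def vec_eq_iff)
  then have "(\<lambda>j. (A ** B) $ j) = (\<lambda>j. (A ** B) $ j)(i := 0)" by (auto simp: fun_eq_iff)
  then have "\<omega> (\<lambda>j. (A ** B) $ j) = 0"
    using linear_0[OF alternating_form_linear[OF \<omega>]] by metis
  then show ?case using 2 by (simp add: det_zero_row)
next
  case (3 A)
  have "(A ** B) $ i = A $ i $ i *\<^sub>R B $ i" for i
  proof -
    have "(\<Sum>k\<in>UNIV. A $ i $ k * B $ k $ j) = (\<Sum>k\<in>{i}. A $ i $ k * B $ k $ j)" for j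
    proof (rule sum.mono_neutral_right)
      show "\<forall>k\<in>UNIV - {i}. A $ i $ k * B $ k $ j = 0"
        using 3[of i] by (metis DiffE insertCI mult_zero_left)
    qed simp_all
    then show ?thesis by (simp add: matrix_matrix_mult_def vec_eq_iff)
  qed
  then show ?case
    using alternating_form_scale_all[OF \<omega>, of "\<lambda>i. A $ i $ i" "\<lambda>i. B $ i"] det_diagonal[OF 3]
    by simp
next
  case (4 m n)
  let ?A = "\<chi> i j. mat 1 $ i $ Transposition.transpose m n j :: real^'n^'n"
  have *: "(?A ** B) $ i = B $ Transposition.transpose m n i" for i
  proof -
    have "mat 1 $ i $ Transposition.transpose m n k * B $ k $ j =
      (if k = Transposition.transpose m n i then B $ Transposition.transpose m n i $ j else 0)" for k j
      by (auto simp: mat_def)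
    then show ?thesis by (simp add: matrix_matrix_mult_def vec_eq_iff)
  qed
  have "(\<lambda>i. (?A ** B) $ i) = (\<lambda>i. B $ i)(m := B $ n, n := B $ m)"
    unfolding * by (auto simp: fun_eq_iff Transposition.transpose_def)
  then have a1: "\<omega> (\<lambda>i. (?A ** B) $ i) = - \<omega> ((\<lambda>i. B $ i)(m := B $ m, n := B $ n))"
    using alternating_form_swap[OF \<omega> 4] by metis
  have "?A = (\<chi> i. (mat 1 :: real^'n^'n) $ Transposition.transpose m n i)"
    by (auto simp: vec_eq_iff mat_def)
  then have a2: "det ?A = - 1"
    using det_permute_rows[OF permutes_swap_id[of m UNIV n], of "mat 1 :: real^'n^'n"] 4
    by (simp add: sign_swap_id)
  show ?case using a1 a2 by (simp add: fun_upd_triv)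
next
  case (5 m n)
  let ?A = "\<chi> i j. of_bool (i = m \<and> j = n \<or> i = j) :: real^'n^'n"
  have row: "(?A ** B) $ i = (if i = m then B $ m + B $ n else B $ i)" for i
  proof -
    have "of_bool (i = m \<and> k = n \<or> i = k) * B $ k $ j =
        (if k = i then B $ i $ j else 0) + (if k = n then (if i = m then B $ n $ j else 0) else 0)" for k j
      using 5 by auto
    then show ?thesis by (simp add: matrix_matrix_mult_def vec_eq_iff sum.distrib)
  qed
  have upd: "(\<lambda>i. (?A ** B) $ i) = (\<lambda>i. B $ i)(m := B $ m + B $ n)"
    unfolding row by (auto simp: fun_eq_iff)
  have "\<omega> ((\<lambda>i. B $ i)(m := B $ n)) = 0"
    by (rule alternating_form_repeat[OF \<omega> 5]) (use 5 in auto)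
  then have "\<omega> ((\<lambda>i. B $ i)(m := B $ m + B $ n)) = \<omega> (\<lambda>i. B $ i)"
    using linear_add[OF alternating_form_linear[OF \<omega>], of "\<lambda>i. B $ i" m "B $ m" "B $ n"]
    by (simp add: fun_upd_triv)
  with arg_cong[OF upd, of \<omega>] have b1: "\<omega> (\<lambda>i. (?A ** B) $ i) = \<omega> (\<lambda>i. B $ i)"
    by (rule trans)
  have "det ?A = 1"
  proof -
    have "?A = (\<chi> k. if k = m then row m (mat 1) + 1 *s row n (mat 1) else row k (mat 1 :: real^'n^'n))"
      using 5 by (auto simp: vec_eq_iff row_def mat_def)
    then show ?thesis using det_row_operation[OF 5, of "mat 1 :: real^'n^'n" 1] by simp
  qed
  with b1 show ?case by simp
qed

text \<open>Forms of top degree make up a line; this reduces a volume form to its density.\<close>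

lemma alternating_form_eq_det:
  fixes \<omega> :: "('n::finite \<Rightarrow> real^'n) \<Rightarrow> real"
  assumes \<omega>: "alternating_form \<omega>"
  shows "\<omega> v = \<omega> (\<lambda>i. axis i 1) * det (\<chi> i. v i)"
proof -
  have "(\<lambda>i. (mat 1 :: real^'n^'n) $ i) = (\<lambda>i. axis i 1)"
    by (auto simp: fun_eq_iff mat_def axis_def vec_eq_iff)
  then show ?thesis
    using alternating_form_matrix_mult[OF \<omega>, of "\<chi> i. v i" "mat 1"]
    by (simp add: mult.commute)
qed

lemma alternating_form_det: "alternating_form (\<lambda>v::'n::finite \<Rightarrow> real^'n. det (\<chi> i. v i))"
proof -
  have *: "(\<chi> k. (v(i := x)) k) = (\<chi> k. if k = i then x else v k)" for v :: "'n \<Rightarrow> real^'n" and i x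
    by (simp add: vec_eq_iff)
  have "linear (\<lambda>x. det (\<chi> k. (v(i := x)) k))" for v :: "'n \<Rightarrow> real^'n" and i
    unfolding *
  proof (rule linearI)
    fix a b and c :: real
    show "det (\<chi> k. if k = i then a + b else v k) =
        det (\<chi> k. if k = i then a else v k) + det (\<chi> k. if k = i then b else v k)"
      by (rule det_row_add)
    show "det (\<chi> k. if k = i then c *\<^sub>R a else v k) = c *\<^sub>R det (\<chi> k. if k = i then a else v k)"
      using det_row_mul[of i c "\<lambda>_. a" v] by (simp add: scalar_mult_eq_scaleR cong: if_cong)
  qed
  moreover have "det (\<chi> k. v k) = 0" if "i \<noteq> j" "v i = v j" for v :: "'n \<Rightarrow> real^'n" and i j
    by (rule det_identical_rows[OF that(1)]) (simp add: row_def that vec_eq_iff)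
  ultimately show ?thesis unfolding alternating_form_def by blast
qed

text \<open>The left-hand side is again an alternating form in \<open>v\<close>, hence a multiple of \<open>\<omega>\<close>; the factor is found at
  the standard basis.\<close>

lemma alternating_form_trace:
  fixes \<omega> :: "('n::finite \<Rightarrow> real^'n) \<Rightarrow> real"
  assumes \<omega>: "alternating_form \<omega>" and f: "linear f"
  shows "(\<Sum>i\<in>UNIV. \<omega> (v(i := f (v i)))) = trace (matrix f) * \<omega> v"
proof -
  define \<theta> where "\<theta> v = (\<Sum>i\<in>UNIV. \<omega> (v(i := f (v i))))" for v
  have "alternating_form \<theta>"
    unfolding alternating_form_def
  proof (intro conjI allI impI)
    fix v :: "'n \<Rightarrow> real^'n" and k
    have "(\<lambda>x. \<theta> (v(k := x))) =
      (\<lambda>x. \<Sum>i\<in>UNIV. if i = k then \<omega> (v(k := f x)) else \<omega> ((v(i := f (v i)))(k := x)))"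
      unfolding \<theta>_def by (auto simp: fun_eq_iff fun_upd_twist intro!: sum.cong)
    moreover have "linear (\<lambda>x. if i = k then \<omega> (v(k := f x)) else \<omega> ((v(i := f (v i)))(k := x)))" for i
      using linear_compose[OF f alternating_form_linear[OF \<omega>, of v k]]
        alternating_form_linear[OF \<omega>, of "v(i := f (v i))" k]
      by (cases "i = k") (simp_all add: o_def)
    ultimately show "linear (\<lambda>x. \<theta> (v(k := x)))"
      by (simp add: linear_compose_sum)
  next
    fix v :: "'n \<Rightarrow> real^'n" and a b assume ab: "a \<noteq> b \<and> v a = v b"
    have z: "\<omega> (v(i := f (v i))) = 0" if "i \<noteq> a" "i \<noteq> b" for i
      by (rule alternating_form_repeat[OF \<omega>, of a b]) (use ab that in auto)
    have "\<theta> v = (\<Sum>i\<in>{a, b}. \<omega> (v(i := f (v i))))"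
      unfolding \<theta>_def
    proof (rule sum.mono_neutral_right)
      show "\<forall>i\<in>UNIV - {a, b}. \<omega> (v(i := f (v i))) = 0"
      proof
        fix i assume "i \<in> UNIV - {a, b}"
        then show "\<omega> (v(i := f (v i))) = 0" by (intro z) simp_all
      qed
    qed simp_all
    also have "\<dots> = \<omega> (v(a := f (v a), b := v a)) + \<omega> (v(a := v a, b := f (v a)))"
    proof -
      have ne: "a \<noteq> b" and eq: "v b = v a" using ab by simp_all
      have 1: "v(a := f (v a)) = v(a := f (v a), b := v a)"
        by (subst eq[symmetric]) (use ne in \<open>simp add: fun_upd_twist\<close>)
      have 2: "v(b := f (v b)) = v(a := v a, b := f (v a))"
        unfolding eq by (simp only: fun_upd_triv)
      have "(\<Sum>i\<in>{a, b}. \<omega> (v(i := f (v i)))) = \<omega> (v(a := f (v a))) + \<omega> (v(b := f (v b)))"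
        using ne by simp
      also have "\<omega> (v(a := f (v a))) = \<omega> (v(a := f (v a), b := v a))" by (rule arg_cong[OF 1])
      also have "\<omega> (v(b := f (v b))) = \<omega> (v(a := v a, b := f (v a)))" by (rule arg_cong[OF 2])
      finally show ?thesis .
    qed
    also have "\<dots> = 0" using alternating_form_swap[OF \<omega>, of a b v "f (v a)" "v a"] ab by simp
    finally show "\<theta> v = 0" .
  qed
  then have "\<theta> v = \<theta> (\<lambda>i. axis i 1) * det (\<chi> i. v i)" by (rule alternating_form_eq_det)
  also have "\<theta> (\<lambda>i. axis i 1) = trace (matrix f) * \<omega> (\<lambda>i. axis i 1)"
  proof -
    have "\<omega> ((\<lambda>i. axis i 1)(i := f (axis i 1))) = matrix f $ i $ i * \<omega> (\<lambda>i. axis i 1)" for i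
    proof -
      let ?e = "(\<lambda>i. axis i 1) :: 'n \<Rightarrow> real^'n"
      have "\<omega> (?e(i := f (?e i))) = \<omega> (?e(i := \<Sum>j\<in>UNIV. (f (?e i) $ j) *\<^sub>R ?e j))"
        by (subst (1) basis_expansion[of "f (?e i)", symmetric]) (simp add: scalar_mult_eq_scaleR)
      also have "\<dots> = (\<Sum>j\<in>UNIV. (f (?e i) $ j) * \<omega> (?e(i := ?e j)))"
        by (simp only: linear_sum[OF alternating_form_linear[OF \<omega>, of ?e i]]
            linear_scale[OF alternating_form_linear[OF \<omega>, of ?e i]] real_scaleR_def)
      also have "\<dots> = (\<Sum>j\<in>{i}. (f (?e i) $ j) * \<omega> (?e(i := ?e j)))"
      proof (rule sum.mono_neutral_right)
        show "\<forall>j\<in>UNIV - {i}. (f (?e i) $ j) * \<omega> (?e(i := ?e j)) = 0"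
          using alternating_form_repeat[OF \<omega>] by (auto simp: fun_upd_def)
      qed auto
      also have "\<dots> = (f (?e i) $ i) * \<omega> (?e(i := ?e i))" by (simp only: sum.insert[of "{}"] sum.empty finite.emptyI empty_iff not_False_eq_True add_0_right)
      also have "?e(i := ?e i) = ?e" by (rule fun_upd_triv)
      finally show ?thesis by (simp add: matrix_def fun_upd_def)
    qed
    then show ?thesis unfolding \<theta>_def trace_def by (simp add: sum_distrib_right)
  qed
  finally show ?thesis
    unfolding \<theta>_def using alternating_form_eq_det[OF \<omega>, of v] by simp
qed

text \<open>Every permutation other than the identity moves at least two indices, so differentiating one factor
  of its product still leaves an off-diagonal entry of the identity matrix.\<close>

lemma has_derivative_det_at_mat_1:
  fixes M :: "'e::real_normed_vector \<Rightarrow> real^'n^'n"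
  assumes M: "\<And>i j. ((\<lambda>y. M y $ i $ j) has_derivative (\<lambda>w. M' w $ i $ j)) (at x)"
    and M1: "M x = mat 1"
  shows "((\<lambda>y. det (M y)) has_derivative (\<lambda>w. trace (M' w))) (at x)"
proof -
  let ?t = "\<lambda>p w. \<Sum>i\<in>UNIV. M' w $ i $ p i * (\<Prod>j\<in>UNIV - {i}. M x $ j $ p j)"
  have "((\<lambda>y. det (M y)) has_derivative
     (\<lambda>w. \<Sum>p\<in>{p. p permutes UNIV}. of_int (sign p) * ?t p w)) (at x)"
    unfolding det_def
    by (intro has_derivative_sum has_derivative_mult_right has_derivative_prod M)
  moreover have "(\<Sum>p\<in>{p. p permutes UNIV}. of_int (sign p) * ?t p w) = trace (M' w)" for w
  proof -
    have "?t p w = 0" if p: "p permutes UNIV" "p \<noteq> id" for p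
    proof -
      obtain a where a: "p a \<noteq> a" using p by (auto simp: fun_eq_iff)
      have pa: "p (p a) \<noteq> p a" using a permutes_inj[OF p(1)] by (auto dest: injD)
      have "(\<Prod>j\<in>UNIV - {i}. M x $ j $ p j) = 0" for i
      proof (cases "i = a")
        case True
        then show ?thesis using a pa
          by (intro prod_zero bexI[of _ "p a"]) (auto simp: M1 mat_def)
      next
        case False
        then show ?thesis using a
          by (intro prod_zero bexI[of _ a]) (auto simp: M1 mat_def)
      qed
      then show ?thesis by (simp only: mult_zero_right sum.neutral_const)
    qed
    then have "(\<Sum>p\<in>{p. p permutes UNIV}. of_int (sign p) * ?t p w) = (\<Sum>p\<in>{id}. of_int (sign p) * ?t p w)"
      by (intro sum.mono_neutral_right) (auto simp: finite_permutations permutes_id)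
    then show ?thesis by (simp add: M1 mat_def trace_def sign_id)
  qed
  ultimately show ?thesis by simp
qed

text \<open>Jacobi's formula at an invertible matrix, reduced to the identity by multiplying with its inverse \<open>K\<close>.\<close>

lemma has_derivative_det:
  fixes M :: "'e::real_normed_vector \<Rightarrow> real^'n^'n"
  assumes M: "\<And>i j. ((\<lambda>y. M y $ i $ j) has_derivative (\<lambda>w. M' w $ i $ j)) (at x)"
    and K: "K ** M x = mat 1"
  shows "((\<lambda>y. det (M y)) has_derivative (\<lambda>w. det (M x) * trace (K ** M' w))) (at x)"
proof -
  have det: "det (M x) * det K = 1"
    using arg_cong[OF K, of det] by (simp add: det_mul mult.commute)
  have "((\<lambda>y. det (K ** M y)) has_derivative (\<lambda>w. trace (K ** M' w))) (at x)"
    by (rule has_derivative_det_at_mat_1[of "\<lambda>y. K ** M y" "\<lambda>w. K ** M' w" x, OF _ K])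
      (auto simp: matrix_matrix_mult_def intro!: has_derivative_sum has_derivative_mult_right M)
  then have "((\<lambda>y. det (M x) * det (K ** M y)) has_derivative (\<lambda>w. det (M x) * trace (K ** M' w))) (at x)"
    by (rule has_derivative_mult_right)
  moreover have "det (M x) * det (K ** M y) = det (M y)" for y
    using det by (simp add: det_mul flip: mult.assoc)
  ultimately show ?thesis by simp
qed

lemma has_derivative_vec_iff:
  fixes f :: "'e::real_normed_vector \<Rightarrow> real^'n"
  shows "(f has_derivative f') (at x) \<longleftrightarrow> (\<forall>i. ((\<lambda>y. f y $ i) has_derivative (\<lambda>w. f' w $ i)) (at x))"
proof -
  have "(\<forall>b\<in>Basis. ((\<lambda>y. f y \<bullet> b) has_derivative (\<lambda>w. f' w \<bullet> b)) (at x)) \<longleftrightarrow>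
    (\<forall>i. ((\<lambda>y. f y $ i) has_derivative (\<lambda>w. f' w $ i)) (at x))"
    by (auto simp: Basis_vec_def inner_axis)
  then show ?thesis using has_derivative_componentwise_within[of f f' x UNIV] by blast
qed

lemma smooth_on_vec_nth: "open S \<Longrightarrow> smooth_on S f \<Longrightarrow> smooth_on S (\<lambda>x. f x $ i)"
  by (rule smooth_on_bounded_linear[OF _ bounded_linear_vec_nth])

lemma frechet_derivative_vec_nth:
  fixes f :: "'e::real_normed_vector \<Rightarrow> real^'n"
  assumes "f differentiable (at x)"
  shows "frechet_derivative (\<lambda>y. f y $ i) (at x) v = frechet_derivative f (at x) v $ i"
proof -
  have "((\<lambda>y. f y $ i) has_derivative (\<lambda>v. frechet_derivative f (at x) v $ i)) (at x)"
    by (rule bounded_linear.has_derivative[OF bounded_linear_vec_nth])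
      (use assms in \<open>simp add: frechet_derivative_works\<close>)
  from frechet_derivative_at[OF this] show ?thesis by (metis)
qed

lemma linear_axis_expansion:
  fixes T :: "real^'n \<Rightarrow> 'v::real_vector"
  assumes "linear T"
  shows "T v = (\<Sum>j\<in>UNIV. v $ j *\<^sub>R T (axis j 1))"
proof -
  have "T v = T (\<Sum>j\<in>UNIV. v $ j *\<^sub>R axis j 1)"
    using basis_expansion[of v] by (simp add: scalar_mult_eq_scaleR cong: if_cong)
  then show ?thesis by (simp add: linear_sum[OF assms] linear_scale[OF assms])
qed

lemma second_derivative_symmetric:
  fixes f :: "'e::real_normed_vector \<Rightarrow> real^'n"
  assumes S: "open S" "x \<in> S" and f: "smooth_on S f"
  shows "frechet_derivative (\<lambda>y. frechet_derivative f (at y) v) (at x) w =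
         frechet_derivative (\<lambda>y. frechet_derivative f (at y) w) (at x) v"
proof (rule vec_eq_iff[THEN iffD2], rule allI)
  fix i
  have d: "f differentiable (at y)" if "y \<in> S" for y
    using smooth_on_has_derivative[OF f that] by (rule differentiableI)
  have dd: "(\<lambda>y. frechet_derivative f (at y) v) differentiable (at x)" for v
    using smooth_on_has_derivative[OF smooth_on_frechet_derivative[OF f] S(2)] by (rule differentiableI)
  have *: "frechet_derivative (\<lambda>y. frechet_derivative f (at y) v) (at x) w $ i =
      frechet_derivative (\<lambda>y. frechet_derivative (\<lambda>z. f z $ i) (at y) v) (at x) w" for v w
  proof -
    have "frechet_derivative (\<lambda>y. frechet_derivative f (at y) v $ i) (at x) =
       frechet_derivative (\<lambda>y. frechet_derivative (\<lambda>z. f z $ i) (at y) v) (at x)"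
    proof (rule frechet_derivative_transform_within_open[OF _ S])
      show "(\<lambda>y. frechet_derivative f (at y) v $ i) differentiable (at x)"
        using smooth_on_has_derivative[OF smooth_on_vec_nth[OF S(1) smooth_on_frechet_derivative[OF f]] S(2)]
        by (rule differentiableI)
    qed (simp add: frechet_derivative_vec_nth[OF d])
    then show ?thesis using frechet_derivative_vec_nth[OF dd[of v], of i w] by simp
  qed
  show "frechet_derivative (\<lambda>y. frechet_derivative f (at y) v) (at x) w $ i =
    frechet_derivative (\<lambda>y. frechet_derivative f (at y) w) (at x) v $ i"
    unfolding * by (rule second_derivative_symmetric_real[OF S smooth_on_vec_nth[OF S(1) f]])
qed

section \<open>Divergence with respect to a density\<close>

definition partial_deriv :: "'n::finite \<Rightarrow> (real^'n \<Rightarrow> real) \<Rightarrow> real^'n \<Rightarrow> real" where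
  "partial_deriv i f x = frechet_derivative f (at x) (axis i 1)"

text \<open>The Lie derivative along \<open>X\<close> of the volume form \<open>\<phi> dx\<close> is this function times \<open>dx\<close>; so it is
  \<open>\<phi>\<close> times the divergence of \<open>X\<close>.\<close>

definition weighted_divergence ::
    "(real^'n \<Rightarrow> real) \<Rightarrow> (real^'n \<Rightarrow> real^'n) \<Rightarrow> real^'n \<Rightarrow> real" where
  "weighted_divergence \<phi> X x =
     frechet_derivative \<phi> (at x) (X x) + \<phi> x * trace (matrix (frechet_derivative X (at x)))"

text \<open>In coordinates, the pullback along \<open>\<tau>\<close> commutes with the Lie derivative of volume forms.
  Differentiating the Jacobian determinant in \<open>pull\<close> produces the trace of \<open>D\<tau>\<^sup>-\<^sup>1 D\<^sup>2\<tau>(X, \<cdot>)\<close>, and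
  differentiating \<open>push\<close> produces the same trace in the divergence of \<open>X'\<close>, because \<open>D\<^sup>2\<tau>\<close> is symmetric.\<close>

lemma weighted_divergence_natural:
  fixes \<tau> X X' :: "real^'n \<Rightarrow> real^'n"
  assumes W: "open W" "x \<in> W" and \<tau>: "smooth_on W \<tau>"
    and nz: "det (matrix (frechet_derivative \<tau> (at x))) \<noteq> 0"
    and X: "X differentiable (at x)" and X': "X' differentiable (at (\<tau> x))"
    and \<phi>': "\<phi>' differentiable (at (\<tau> x))"
    and push: "\<And>y. y \<in> W \<Longrightarrow> X' (\<tau> y) = frechet_derivative \<tau> (at y) (X y)"
    and pull: "\<And>y. y \<in> W \<Longrightarrow> \<phi> y = \<phi>' (\<tau> y) * det (matrix (frechet_derivative \<tau> (at y)))"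
  shows "weighted_divergence \<phi> X x =
    det (matrix (frechet_derivative \<tau> (at x))) * weighted_divergence \<phi>' X' (\<tau> x)"
proof -
  define T where "T y = frechet_derivative \<tau> (at y)" for y
  have Td: "(\<tau> has_derivative T y) (at y)" if "y \<in> W" for y
    unfolding T_def by (rule smooth_on_has_derivative[OF \<tau> that])
  have Tlin: "linear (T y)" if "y \<in> W" for y
    by (rule has_derivative_linear[OF Td[OF that]])
  define E where "E j = frechet_derivative (\<lambda>y. T y (axis j 1)) (at x)" for j
  have Ed: "((\<lambda>y. T y (axis j 1)) has_derivative E j) (at x)" for j
    unfolding E_def T_def by (rule smooth_on_has_derivative[OF smooth_on_frechet_derivative[OF \<tau>] W(2)])
  \<comment> \<open>the second derivative of \<open>\<tau>\<close> at \<open>x\<close> as a bilinear map\<close>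
  define B where "B v w = (\<Sum>j\<in>UNIV. v $ j *\<^sub>R E j w)" for v w
  have Bd: "((\<lambda>y. T y v) has_derivative B v) (at x)" for v
  proof (rule has_derivative_transform_within_open[OF _ W])
    show "((\<lambda>y. \<Sum>j\<in>UNIV. v $ j *\<^sub>R T y (axis j 1)) has_derivative B v) (at x)"
      unfolding B_def by (intro has_derivative_sum has_derivative_scaleR_right Ed)
    show "(\<Sum>j\<in>UNIV. v $ j *\<^sub>R T y (axis j 1)) = T y v" if "y \<in> W" for y
      using linear_axis_expansion[OF Tlin[OF that], of v] by simp
  qed
  have Bsym: "B v w = B w v" for v w
    using second_derivative_symmetric[OF W \<tau>, of v w]
    unfolding T_def[symmetric] frechet_derivative_at[OF Bd, symmetric] .
  have Blin: "linear (B v)" for v by (rule has_derivative_linear[OF Bd])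
  define DX where "DX = frechet_derivative X (at x)"
  define DX' where "DX' = frechet_derivative X' (at (\<tau> x))"
  define D\<phi>' where "D\<phi>' = frechet_derivative \<phi>' (at (\<tau> x))"
  have DX: "(X has_derivative DX) (at x)" unfolding DX_def using X by (simp add: frechet_derivative_works)
  have DX': "(X' has_derivative DX') (at (\<tau> x))"
    unfolding DX'_def using X' by (simp add: frechet_derivative_works)
  have D\<phi>': "(\<phi>' has_derivative D\<phi>') (at (\<tau> x))"
    unfolding D\<phi>'_def using \<phi>' by (simp add: frechet_derivative_works)
  have lDX: "linear DX" and lDX': "linear DX'"
    using has_derivative_linear[OF DX] has_derivative_linear[OF DX'] by auto
  \<comment> \<open>the derivative of \<open>X' \<circ> \<tau>\<close> by the chain rule and, using \<open>push\<close>, by the product rule\<close>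
  have d1: "((\<lambda>y. X' (\<tau> y)) has_derivative (\<lambda>w. DX' (T x w))) (at x)"
    by (rule has_derivative_compose[OF Td[OF W(2)] DX'])
  have d2: "((\<lambda>y. X' (\<tau> y)) has_derivative (\<lambda>w. T x (DX w) + B (X x) w)) (at x)"
  proof (rule has_derivative_transform_within_open[OF _ W])
    have "((\<lambda>y. \<Sum>j\<in>UNIV. X y $ j *\<^sub>R T y (axis j 1)) has_derivative
      (\<lambda>w. \<Sum>j\<in>UNIV. X x $ j *\<^sub>R E j w + DX w $ j *\<^sub>R T x (axis j 1))) (at x)"
      using DX[unfolded has_derivative_vec_iff]
      by (intro has_derivative_sum has_derivative_scaleR Ed) auto
    moreover have "(\<Sum>j\<in>UNIV. X x $ j *\<^sub>R E j w + DX w $ j *\<^sub>R T x (axis j 1)) =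
        T x (DX w) + B (X x) w" for w
      using linear_axis_expansion[OF Tlin[OF W(2)], of "DX w"] by (simp add: B_def sum.distrib)
    ultimately show "((\<lambda>y. \<Sum>j\<in>UNIV. X y $ j *\<^sub>R T y (axis j 1)) has_derivative
        (\<lambda>w. T x (DX w) + B (X x) w)) (at x)" by simp
    show "(\<Sum>j\<in>UNIV. X y $ j *\<^sub>R T y (axis j 1)) = X' (\<tau> y)" if "y \<in> W" for y
      using linear_axis_expansion[OF Tlin[OF that], of "X y"] push[OF that] by (simp add: T_def)
  qed
  have eq: "DX' \<circ> T x = (\<lambda>w. T x (DX w) + B (X x) w)"
    using has_derivative_unique[OF d1 d2] by (simp add: o_def)
  define N where "N = matrix (T x)"
  have detN: "det N \<noteq> 0" using nz unfolding N_def T_def .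
  then obtain K where K: "K ** N = mat 1" "N ** K = mat 1"
    unfolding invertible_det_nz[symmetric] invertible_def by blast
  have mB: "matrix DX' ** N = N ** matrix DX + matrix (B (X x))"
  proof -
    have "matrix DX' ** N = matrix (DX' \<circ> T x)"
      unfolding N_def by (rule matrix_compose[symmetric, OF Tlin[OF W(2)] lDX'])
    also have "\<dots> = matrix (T x \<circ> DX) + matrix (B (X x))"
      unfolding eq by (simp add: matrix_def vec_eq_iff)
    also have "matrix (T x \<circ> DX) = N ** matrix DX"
      unfolding N_def by (rule matrix_compose[OF lDX Tlin[OF W(2)]])
    finally show ?thesis .
  qed
  have tr: "trace (matrix DX') = trace (matrix DX) + trace (K ** matrix (B (X x)))"
  proof -
    have "trace (matrix DX') = trace (matrix DX' ** N ** K)"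
      by (simp add: K flip: matrix_mul_assoc)
    also have "\<dots> = trace (K ** (N ** matrix DX + matrix (B (X x))))"
      unfolding mB by (rule trace_mul_sym)
    also have "\<dots> = trace (K ** N ** matrix DX) + trace (K ** matrix (B (X x)))"
      by (simp add: matrix_add_ldistrib trace_add matrix_mul_assoc)
    finally show ?thesis by (simp add: K)
  qed
  have "((\<lambda>y. det (matrix (T y))) has_derivative
      (\<lambda>w. det (matrix (T x)) * trace (K ** (\<chi> i j. E j w $ i)))) (at x)"
  proof (rule has_derivative_det)
    show "((\<lambda>y. matrix (T y) $ i $ j) has_derivative (\<lambda>w. (\<chi> i j. E j w $ i) $ i $ j)) (at x)" for i j
      using Ed[of j, unfolded has_derivative_vec_iff] by (simp add: matrix_def)
  qed (simp add: K flip: N_def)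
  moreover have "((\<lambda>y. \<phi>' (\<tau> y)) has_derivative (\<lambda>w. D\<phi>' (T x w))) (at x)"
    by (rule has_derivative_compose[OF Td[OF W(2)] D\<phi>'])
  ultimately have "((\<lambda>y. \<phi>' (\<tau> y) * det (matrix (T y))) has_derivative
    (\<lambda>w. \<phi>' (\<tau> x) * (det N * trace (K ** (\<chi> i j. E j w $ i))) + D\<phi>' (T x w) * det N)) (at x)"
    unfolding N_def by (intro has_derivative_mult)
  then have "(\<phi> has_derivative
    (\<lambda>w. \<phi>' (\<tau> x) * (det N * trace (K ** (\<chi> i j. E j w $ i))) + D\<phi>' (T x w) * det N)) (at x)"
    by (rule has_derivative_transform_within_open[OF _ W]) (simp add: pull T_def)
  then have D\<phi>: "frechet_derivative \<phi> (at x) =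
    (\<lambda>w. \<phi>' (\<tau> x) * (det N * trace (K ** (\<chi> i j. E j w $ i))) + D\<phi>' (T x w) * det N)"
    by (rule frechet_derivative_at[symmetric])
  have mE: "(\<chi> i j. E j (X x) $ i) = matrix (B (X x))"
  proof -
    have "B (X x) (axis j 1) = E j (X x)" for j
    proof -
      have "(axis j 1 :: real^'n) $ k *\<^sub>R E k (X x) = (if k = j then E j (X x) else 0)" for k
        by (simp add: axis_def)
      then show ?thesis unfolding Bsym[of "X x" "axis j 1"] unfolding B_def by simp
    qed
    then show ?thesis by (simp add: matrix_def vec_eq_iff)
  qed
  have "weighted_divergence \<phi> X x =
    \<phi>' (\<tau> x) * (det N * trace (K ** matrix (B (X x)))) + D\<phi>' (T x (X x)) * det N +
     \<phi>' (\<tau> x) * det N * trace (matrix DX)"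
    unfolding weighted_divergence_def D\<phi> mE DX_def[symmetric] pull[OF W(2)] T_def[symmetric] N_def[symmetric] ..
  also have "\<dots> = det N * weighted_divergence \<phi>' X' (\<tau> x)"
    unfolding weighted_divergence_def DX'_def[symmetric] D\<phi>'_def[symmetric] tr push[OF W(2)] T_def[symmetric]
    by (simp add: algebra_simps)
  finally show ?thesis by (simp add: N_def T_def)
qed

text \<open>Components of the modular vector field of the density \<open>\<phi>\<close>, multiplied by \<open>\<phi>\<close>.\<close>

definition modular_coeff ::
    "(real^'n \<Rightarrow> real) \<Rightarrow> ('n \<Rightarrow> 'n \<Rightarrow> real^'n \<Rightarrow> real) \<Rightarrow> real^'n \<Rightarrow> 'n \<Rightarrow> real" where
  "modular_coeff \<phi> p x i = (\<Sum>j\<in>UNIV. p i j x * partial_deriv j \<phi> x + \<phi> x * partial_deriv j (p i j) x)"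

lemma partial_deriv_eq: "(f has_derivative f') (at x) \<Longrightarrow> partial_deriv i f x = f' (axis i 1)"
  by (simp add: partial_deriv_def frechet_derivative_at[symmetric])

lemma smooth_on_partial_deriv: "smooth_on S f \<Longrightarrow> smooth_on S (partial_deriv i f)"
  using smooth_on_frechet_derivative[of S f "axis i 1"]
  by (simp add: partial_deriv_def[abs_def])

lemma frechet_eq_partial_deriv:
  fixes f :: "real^'n \<Rightarrow> real"
  assumes "f differentiable (at x)"
  shows "frechet_derivative f (at x) v = (\<Sum>i\<in>UNIV. v $ i * partial_deriv i f x)"
  using linear_axis_expansion[OF linear_frechet_derivative[OF assms], of v]
  by (simp add: partial_deriv_def)

lemma partial_deriv_commute:
  fixes f :: "real^'n \<Rightarrow> real"
  assumes "open S" "x \<in> S" "smooth_on S f"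
  shows "partial_deriv i (partial_deriv j f) x = partial_deriv j (partial_deriv i f) x"
  using second_derivative_symmetric_real[OF assms, of "axis j 1" "axis i 1"]
  by (simp add: partial_deriv_def[abs_def])

text \<open>The terms with second derivatives of \<open>h\<close> contract a symmetric with a skew matrix, so that the
  divergence of a Hamiltonian vector field is a first-order expression in the Hamiltonian.\<close>

lemma weighted_divergence_hamiltonian:
  fixes X :: "real^'n \<Rightarrow> real^'n"
  assumes S: "open S" "x \<in> S" and h: "smooth_on S h"
    and p: "\<And>i j. (p i j) differentiable (at x)"
    and skew: "\<And>i j. p i j x = - p j i x"
    and \<phi>: "\<phi> differentiable (at x)"
    and X: "\<And>y j. y \<in> S \<Longrightarrow> X y $ j = (\<Sum>i\<in>UNIV. partial_deriv i h y * p i j y)"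
  shows "X differentiable (at x)"
    and "weighted_divergence \<phi> X x = (\<Sum>i\<in>UNIV. partial_deriv i h x * modular_coeff \<phi> p x i)"
proof -
  define Dp where "Dp i j = frechet_derivative (p i j) (at x)" for i j
  have Dp: "(p i j has_derivative Dp i j) (at x)" for i j
    using p by (simp add: Dp_def frechet_derivative_works)
  define Dh where "Dh i = frechet_derivative (partial_deriv i h) (at x)" for i
  have Dh: "(partial_deriv i h has_derivative Dh i) (at x)" for i
    unfolding Dh_def by (rule smooth_on_has_derivative[OF smooth_on_partial_deriv[OF h] S(2)])
  have "(X has_derivative (\<lambda>w. \<chi> j. \<Sum>i\<in>UNIV. partial_deriv i h x * Dp i j w + Dh i w * p i j x)) (at x)"
    unfolding has_derivative_vec_iff
  proof
    fix j
    have "((\<lambda>y. \<Sum>i\<in>UNIV. partial_deriv i h y * p i j y) has_derivative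
      (\<lambda>w. \<Sum>i\<in>UNIV. partial_deriv i h x * Dp i j w + Dh i w * p i j x)) (at x)"
      by (intro has_derivative_sum has_derivative_mult Dp Dh)
    then have "((\<lambda>y. X y $ j) has_derivative
      (\<lambda>w. \<Sum>i\<in>UNIV. partial_deriv i h x * Dp i j w + Dh i w * p i j x)) (at x)"
      by (rule has_derivative_transform_within_open[OF _ S]) (simp add: X)
    then show "((\<lambda>y. X y $ j) has_derivative (\<lambda>w. (\<chi> j. \<Sum>i\<in>UNIV. partial_deriv i h x * Dp i j w + Dh i w * p i j x) $ j)) (at x)"
      by simp
  qed
  note DX = this
  then show "X differentiable (at x)" by (rule differentiableI)
  have "trace (matrix (frechet_derivative X (at x))) =
    (\<Sum>j\<in>UNIV. \<Sum>i\<in>UNIV. partial_deriv i h x * partial_deriv j (p i j) x) +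
    (\<Sum>j\<in>UNIV. \<Sum>i\<in>UNIV. partial_deriv j (partial_deriv i h) x * p i j x)"
    unfolding frechet_derivative_at[OF DX, symmetric]
    by (simp add: trace_def matrix_def sum.distrib partial_deriv_eq[OF Dp] partial_deriv_eq[OF Dh])
  moreover have "(\<Sum>j\<in>UNIV. \<Sum>i\<in>UNIV. partial_deriv j (partial_deriv i h) x * p i j x) = 0"
  proof -
    let ?s = "\<Sum>j\<in>UNIV. \<Sum>i\<in>UNIV. partial_deriv j (partial_deriv i h) x * p i j x"
    have "?s = (\<Sum>i\<in>UNIV. \<Sum>j\<in>UNIV. partial_deriv j (partial_deriv i h) x * p i j x)"
      by (rule sum.swap)
    also have "\<dots> = (\<Sum>i\<in>UNIV. \<Sum>j\<in>UNIV. - (partial_deriv i (partial_deriv j h) x * p j i x))"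
      by (intro sum.cong refl)
        (metis partial_deriv_commute[OF S h] skew mult_minus_right)
    also have "\<dots> = - ?s" by (simp add: sum_negf)
    finally show ?thesis by simp
  qed
  moreover have "frechet_derivative \<phi> (at x) (X x) =
    (\<Sum>i\<in>UNIV. partial_deriv i h x * (\<Sum>j\<in>UNIV. p i j x * partial_deriv j \<phi> x))"
    unfolding frechet_eq_partial_deriv[OF \<phi>] X[OF S(2)] sum_distrib_left sum_distrib_right mult.assoc
    by (rule sum.swap)
  moreover have "\<phi> x * (\<Sum>j\<in>UNIV. \<Sum>i\<in>UNIV. partial_deriv i h x * partial_deriv j (p i j) x) =
     (\<Sum>i\<in>UNIV. partial_deriv i h x * (\<Sum>j\<in>UNIV. \<phi> x * partial_deriv j (p i j) x))"
    unfolding sum_distrib_left by (subst sum.swap) (simp add: mult.left_commute)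
  ultimately show "weighted_divergence \<phi> X x = (\<Sum>i\<in>UNIV. partial_deriv i h x * modular_coeff \<phi> p x i)"
    unfolding weighted_divergence_def modular_coeff_def by (simp add: sum.distrib distrib_left)
qed

text \<open>At a critical point of \<open>h\<close> the derivative of the vanishing sum in \<open>inv\<close> is the Hessian of \<open>h\<close>
  paired with the vector of modular coefficients.\<close>

lemma modular_coeff_zero_at_morse_point:
  fixes h \<phi> :: "real^'n \<Rightarrow> real"
  assumes S: "open S" "x \<in> S" and h: "smooth_on S h" and \<phi>: "smooth_on S \<phi>" and p: "\<And>i j. smooth_on S (p i j)"
    and inv: "\<And>y. y \<in> S \<Longrightarrow> (\<Sum>i\<in>UNIV. partial_deriv i h y * modular_coeff \<phi> p y i) = 0"
    and crit: "\<And>i. partial_deriv i h x = 0"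
    and nondeg: "\<And>\<xi>. (\<And>\<eta>. frechet_derivative (\<lambda>y. frechet_derivative h (at y) \<eta>) (at x) \<xi> = 0) \<Longrightarrow> \<xi> = 0"
  shows "modular_coeff \<phi> p x i = 0"
proof -
  define m where "m = (\<chi> i. modular_coeff \<phi> p x i)"
  have Dh: "(partial_deriv i h has_derivative frechet_derivative (partial_deriv i h) (at x)) (at x)" for i
    by (rule smooth_on_has_derivative[OF smooth_on_partial_deriv[OF h] S(2)])
  have "smooth_on S (\<lambda>y. modular_coeff \<phi> p y i)" for i
    unfolding modular_coeff_def
    by (intro smooth_on_sum smooth_on_add smooth_on_mult smooth_on_partial_deriv \<phi> p S(1)) auto
  from smooth_on_has_derivative[OF this S(2)]
  have Dq: "((\<lambda>y. modular_coeff \<phi> p y i) has_derivative frechet_derivative (\<lambda>y. modular_coeff \<phi> p y i) (at x)) (at x)" for i .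
  have "((\<lambda>y. \<Sum>i\<in>UNIV. partial_deriv i h y * modular_coeff \<phi> p y i) has_derivative
     (\<lambda>w. \<Sum>i\<in>UNIV. partial_deriv i h x * frechet_derivative (\<lambda>y. modular_coeff \<phi> p y i) (at x) w +
       frechet_derivative (partial_deriv i h) (at x) w * modular_coeff \<phi> p x i)) (at x)"
    by (intro has_derivative_sum has_derivative_mult Dh Dq)
  moreover have "((\<lambda>y. \<Sum>i\<in>UNIV. partial_deriv i h y * modular_coeff \<phi> p y i) has_derivative (\<lambda>w. 0)) (at x)"
    by (rule has_derivative_transform_within_open[OF _ S, of "\<lambda>y. 0"]) (simp_all add: inv)
  ultimately have "(\<lambda>w. \<Sum>i\<in>UNIV. partial_deriv i h x * frechet_derivative (\<lambda>y. modular_coeff \<phi> p y i) (at x) w +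
       frechet_derivative (partial_deriv i h) (at x) w * modular_coeff \<phi> p x i) = (\<lambda>w. 0)"
    by (rule has_derivative_unique)
  then have 0: "(\<Sum>i\<in>UNIV. frechet_derivative (partial_deriv i h) (at x) w * m $ i) = 0" for w
    by (simp add: fun_eq_iff crit m_def)
  have "frechet_derivative (\<lambda>y. frechet_derivative h (at y) w) (at x) m = 0" for w
  proof -
    have lin: "linear (frechet_derivative (\<lambda>y. frechet_derivative h (at y) w) (at x))"
      by (rule has_derivative_linear[OF smooth_on_has_derivative[OF smooth_on_frechet_derivative[OF h] S(2)]])
    have "frechet_derivative (\<lambda>y. frechet_derivative h (at y) w) (at x) m =
       (\<Sum>i\<in>UNIV. m $ i * frechet_derivative (\<lambda>y. frechet_derivative h (at y) w) (at x) (axis i 1))"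
      using linear_axis_expansion[OF lin, of m] by simp
    also have "\<dots> = (\<Sum>i\<in>UNIV. m $ i * frechet_derivative (partial_deriv i h) (at x) w)"
      unfolding second_derivative_symmetric_real[OF S h, of w] by (simp add: partial_deriv_def[abs_def])
    finally show ?thesis using 0[of w] by (simp add: mult.commute)
  qed
  then have "m = 0" by (rule nondeg)
  then show ?thesis by (simp add: m_def vec_eq_iff)
qed

text \<open>Components \<open>M c M\<^sup>T\<close> of the pushforward under \<open>M\<close> of the bivector with components \<open>c\<close>.\<close>

definition conjugate_coeff :: "('n::finite \<Rightarrow> 'n \<Rightarrow> real) \<Rightarrow> real^'n^'n \<Rightarrow> 'n \<Rightarrow> 'n \<Rightarrow> real" where
  "conjugate_coeff c M i j = (\<Sum>k\<in>UNIV. \<Sum>l\<in>UNIV. c k l * (M $ i $ k * M $ j $ l))"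

lemma conjugate_coeff_mat_1:
  fixes i j :: "'n::finite"
  shows "conjugate_coeff c (mat 1) i j = c i j"
proof -
  have "c k l * ((mat 1 :: real^'n^'n) $ i $ k * (mat 1 :: real^'n^'n) $ j $ l) = (if l = j then if k = i then c i j else 0 else 0)" for k l
    by (auto simp: mat_def)
  then show ?thesis by (simp add: conjugate_coeff_def)
qed

lemma conjugate_coeff_derivative:
  fixes M :: "real^'n \<Rightarrow> real^'n^'n"
  assumes M: "\<And>i j. (\<lambda>y. M y $ i $ j) differentiable (at x)" and M1: "M x = mat 1"
  shows "(\<lambda>y. conjugate_coeff c (M y) i j) differentiable (at x)"
    and "(\<Sum>j\<in>UNIV. partial_deriv j (\<lambda>y. conjugate_coeff c (M y) i j) x) =
      (\<Sum>k\<in>UNIV. \<Sum>j\<in>UNIV. c k j * partial_deriv j (\<lambda>y. M y $ i $ k) x) +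
      (\<Sum>l\<in>UNIV. c i l * (\<Sum>j\<in>UNIV. partial_deriv j (\<lambda>y. M y $ j $ l) x))"
proof -
  define D where "D i j = frechet_derivative (\<lambda>y. M y $ i $ j) (at x)" for i j
  have D: "((\<lambda>y. M y $ i $ j) has_derivative D i j) (at x)" for i j
    using M by (simp add: D_def frechet_derivative_works)
  have d: "((\<lambda>y. conjugate_coeff c (M y) i j) has_derivative
     (\<lambda>w. \<Sum>k\<in>UNIV. \<Sum>l\<in>UNIV. c k l * (M x $ i $ k * D j l w + D i k w * M x $ j $ l))) (at x)" for j
    unfolding conjugate_coeff_def
    by (intro has_derivative_sum has_derivative_mult_right has_derivative_mult D)
  then show "(\<lambda>y. conjugate_coeff c (M y) i j) differentiable (at x)" by (rule differentiableI)
  have pd: "partial_deriv a (\<lambda>y. M y $ i $ j) x = D i j (axis a 1)" for a i j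
    by (rule partial_deriv_eq[OF D])
  have "partial_deriv j (\<lambda>y. conjugate_coeff c (M y) i j) x =
     (\<Sum>k\<in>UNIV. c k j * partial_deriv j (\<lambda>y. M y $ i $ k) x) +
     (\<Sum>l\<in>UNIV. c i l * partial_deriv j (\<lambda>y. M y $ j $ l) x)" for j
  proof -
    have "c k l * (M x $ i $ k * D j l (axis j 1) + D i k (axis j 1) * M x $ j $ l) =
      (if k = i then c i l * D j l (axis j 1) else 0) + (if l = j then c k j * D i k (axis j 1) else 0)" for k l
      by (auto simp: M1 mat_def distrib_left)
    then show ?thesis
      by (simp add: partial_deriv_eq[OF d] pd sum.distrib sum.swap[of "\<lambda>k l. if k = i then _ l else 0"])
  qed
  then show "(\<Sum>j\<in>UNIV. partial_deriv j (\<lambda>y. conjugate_coeff c (M y) i j) x) =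
      (\<Sum>k\<in>UNIV. \<Sum>j\<in>UNIV. c k j * partial_deriv j (\<lambda>y. M y $ i $ k) x) +
      (\<Sum>l\<in>UNIV. c i l * (\<Sum>j\<in>UNIV. partial_deriv j (\<lambda>y. M y $ j $ l) x))"
    by (simp add: sum.distrib sum_distrib_left sum.swap[of "\<lambda>j k. c k j * _ j k"] sum.swap[of "\<lambda>j k. c i k * _ j k"])
qed


text \<open>The bivector field \<open>q\<close> is split in two ways, with a right-invariant part \<open>R c R\<^sup>T\<close> and with a
  left-invariant part \<open>L c L\<^sup>T\<close>; the remainders \<open>p\<close> and \<open>p'\<close> have no divergence at \<open>x\<close>.  Let \<open>g i k l\<close> be
  the common mixed derivative of \<open>mixed\<close>.  The divergence of the first invariant part at \<open>x\<close> is
  \<open>\<Sum>k l. c k l * g i k l\<close> plus a contraction of \<open>c\<close> with the trace \<open>\<Sum>j. g j l j\<close>; for the second part the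
  last two indices of \<open>g\<close> are exchanged.  Adding the two removes the first kind of term as \<open>c\<close> is skew, and by
  \<open>const\<close> the logarithmic derivative of \<open>\<psi>\<close> is minus one half of the sum of both traces.\<close>

lemma modular_coeff_zero_of_two_splittings:
  fixes L R :: "real^'n \<Rightarrow> real^'n^'n" and \<psi> :: "real^'n \<Rightarrow> real"
  assumes W: "open W" "x \<in> W"
    and p: "\<And>i j. p i j differentiable (at x)" "\<And>i j. p i j x = 0"
       "\<And>i. (\<Sum>j\<in>UNIV. partial_deriv j (p i j) x) = 0"
    and p': "\<And>i j. p' i j differentiable (at x)"
       "\<And>i. (\<Sum>j\<in>UNIV. partial_deriv j (p' i j) x) = 0"
    and R: "\<And>i j. (\<lambda>y. R y $ i $ j) differentiable (at x)" "R x = mat 1"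
    and L: "\<And>i j. (\<lambda>y. L y $ i $ j) differentiable (at x)" "L x = mat 1"
    and mixed: "\<And>i k l. partial_deriv l (\<lambda>y. R y $ i $ k) x = partial_deriv k (\<lambda>y. L y $ i $ l) x"
    and c: "\<And>i j. c i j = - c j i"
    and qR: "\<And>i j y. y \<in> W \<Longrightarrow> q i j y = p i j y + conjugate_coeff c (R y) i j"
    and qL: "\<And>i j y. y \<in> W \<Longrightarrow> q i j y = p' i j y + conjugate_coeff c (L y) i j"
    and \<psi>: "\<psi> differentiable (at x)" "\<psi> x \<noteq> 0"
    and const: "\<And>y. y \<in> W \<Longrightarrow> (\<psi> y)\<^sup>2 * (det (L y) * det (R y)) = C"
  shows "q i j differentiable (at x)" and "modular_coeff \<psi> q x i = 0"
proof -
  define g where "g i k l = partial_deriv l (\<lambda>y. R y $ i $ k) x" for i k l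
  have gL: "partial_deriv k (\<lambda>y. L y $ i $ l) x = g i k l" for i k l
    by (simp add: g_def mixed)
  have sumd: "(f has_derivative frechet_derivative f (at x)) (at x)" if "f differentiable (at x)"
    for f :: "real^'n \<Rightarrow> real"
    using that by (simp add: frechet_derivative_works)
  have split: "(q i j has_derivative (\<lambda>w. frechet_derivative (u i j) (at x) w +
       frechet_derivative (\<lambda>y. conjugate_coeff c (M y) i j) (at x) w)) (at x)"
    if u: "u i j differentiable (at x)" and M: "\<And>i j. (\<lambda>y. M y $ i $ j) differentiable (at x)" "M x = mat 1"
      and q: "\<And>y. y \<in> W \<Longrightarrow> q i j y = u i j y + conjugate_coeff c (M y) i j"
    for u :: "'n \<Rightarrow> 'n \<Rightarrow> real^'n \<Rightarrow> real" and M :: "real^'n \<Rightarrow> real^'n^'n" and i j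
    by (rule has_derivative_transform_within_open[OF has_derivative_add[OF sumd[OF u]
          sumd[OF conjugate_coeff_derivative(1)[OF M]]] W]) (simp add: q)
  have sR: "(q i j has_derivative (\<lambda>w. frechet_derivative (p i j) (at x) w +
       frechet_derivative (\<lambda>y. conjugate_coeff c (R y) i j) (at x) w)) (at x)" for i j
    by (rule split[of p, OF p(1) R qR])
  have sL: "(q i j has_derivative (\<lambda>w. frechet_derivative (p' i j) (at x) w +
       frechet_derivative (\<lambda>y. conjugate_coeff c (L y) i j) (at x) w)) (at x)" for i j
    by (rule split[of p', OF p'(1) L qL])
  show "q i j differentiable (at x)" using sR by (rule differentiableI)
  have "partial_deriv j (q i j) x = partial_deriv j (p i j) x + partial_deriv j (\<lambda>y. conjugate_coeff c (R y) i j) x" for i j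
    unfolding partial_deriv_eq[OF sR] by (simp add: partial_deriv_def)
  then have divR: "(\<Sum>j\<in>UNIV. partial_deriv j (q i j) x) =
      (\<Sum>k\<in>UNIV. \<Sum>j\<in>UNIV. c k j * g i k j) + (\<Sum>l\<in>UNIV. c i l * (\<Sum>j\<in>UNIV. g j l j))"
    by (simp add: sum.distrib p(3) conjugate_coeff_derivative(2)[OF R] g_def)
  have "partial_deriv j (q i j) x = partial_deriv j (p' i j) x + partial_deriv j (\<lambda>y. conjugate_coeff c (L y) i j) x" for i j
    unfolding partial_deriv_eq[OF sL] by (simp add: partial_deriv_def)
  then have divL: "(\<Sum>j\<in>UNIV. partial_deriv j (q i j) x) =
      (\<Sum>k\<in>UNIV. \<Sum>j\<in>UNIV. c k j * g i j k) + (\<Sum>l\<in>UNIV. c i l * (\<Sum>j\<in>UNIV. g j j l))"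
    by (simp add: sum.distrib p'(2) conjugate_coeff_derivative(2)[OF L] gL)
  \<comment> \<open>the terms without a trace have opposite values in \<open>divR\<close> and \<open>divL\<close>\<close>
  have "(\<Sum>k\<in>UNIV. \<Sum>j\<in>UNIV. c k j * g i j k) = (\<Sum>j\<in>UNIV. \<Sum>k\<in>UNIV. c k j * g i j k)"
    by (rule sum.swap)
  also have "\<dots> = (\<Sum>j\<in>UNIV. \<Sum>k\<in>UNIV. - (c j k * g i j k))"
    by (intro sum.cong refl) (metis c mult_minus_left)
  also have "\<dots> = - (\<Sum>k\<in>UNIV. \<Sum>j\<in>UNIV. c k j * g i k j)" by (simp add: sum_negf)
  finally have div: "2 * (\<Sum>j\<in>UNIV. partial_deriv j (q i j) x) =
      (\<Sum>l\<in>UNIV. c i l * ((\<Sum>j\<in>UNIV. g j l j) + (\<Sum>j\<in>UNIV. g j j l)))"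
    using divL divR by (simp add: distrib_left sum.distrib)
  have detd: "((\<lambda>y. det (M y)) has_derivative (\<lambda>w. \<Sum>i\<in>UNIV. frechet_derivative (\<lambda>y. M y $ i $ i) (at x) w)) (at x)"
    if M: "\<And>i j. (\<lambda>y. M y $ i $ j) differentiable (at x)" "M x = mat 1" for M :: "real^'n \<Rightarrow> real^'n^'n"
    using has_derivative_det_at_mat_1[of M "\<lambda>w. \<chi> i j. frechet_derivative (\<lambda>y. M y $ i $ j) (at x) w" x]
      sumd[OF M(1)] M(2) by (simp add: trace_def)
  let ?tL = "\<lambda>w. \<Sum>i\<in>UNIV. frechet_derivative (\<lambda>y. L y $ i $ i) (at x) w"
  let ?tR = "\<lambda>w. \<Sum>i\<in>UNIV. frechet_derivative (\<lambda>y. R y $ i $ i) (at x) w"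
  have "((\<lambda>y. (\<psi> y * \<psi> y) * (det (L y) * det (R y))) has_derivative
     (\<lambda>w. (\<psi> x * \<psi> x) * (det (L x) * ?tR w + ?tL w * det (R x)) +
       (\<psi> x * frechet_derivative \<psi> (at x) w + frechet_derivative \<psi> (at x) w * \<psi> x) * (det (L x) * det (R x)))) (at x)"
    by (intro has_derivative_mult detd L R sumd \<psi>)
  moreover have "((\<lambda>y. (\<psi> y * \<psi> y) * (det (L y) * det (R y))) has_derivative (\<lambda>w. 0)) (at x)"
    by (rule has_derivative_transform_within_open[OF _ W, of "\<lambda>y. C"])
      (use const in \<open>simp_all add: power2_eq_square\<close>)
  ultimately have "(\<lambda>w. (\<psi> x * \<psi> x) * (det (L x) * ?tR w + ?tL w * det (R x)) +
       (\<psi> x * frechet_derivative \<psi> (at x) w + frechet_derivative \<psi> (at x) w * \<psi> x) * (det (L x) * det (R x))) = (\<lambda>w. 0)"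
    by (rule has_derivative_unique)
  then have "\<psi> x * (\<psi> x * (?tR w + ?tL w) + 2 * frechet_derivative \<psi> (at x) w) = 0" for w
    by (simp add: fun_eq_iff L(2) R(2) algebra_simps)
  then have D\<psi>: "\<psi> x * (?tR w + ?tL w) + 2 * frechet_derivative \<psi> (at x) w = 0" for w
    using \<psi>(2) by simp
  have d\<psi>: "2 * partial_deriv l \<psi> x = - \<psi> x * ((\<Sum>j\<in>UNIV. g j l j) + (\<Sum>j\<in>UNIV. g j j l))" for l
  proof -
    have "?tR (axis l 1) = (\<Sum>j\<in>UNIV. g j j l)" by (simp add: g_def partial_deriv_def)
    moreover have "?tL (axis l 1) = (\<Sum>j\<in>UNIV. g j l j)" by (simp add: partial_deriv_def flip: gL)
    ultimately show ?thesis using D\<psi>[of "axis l 1"] by (simp add: partial_deriv_def algebra_simps)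
  qed
  have qx: "q i j x = c i j" for j
    using qR[OF W(2), of i j] by (simp add: p(2) R(2) conjugate_coeff_mat_1)
  have "2 * modular_coeff \<psi> q x i =
    (\<Sum>j\<in>UNIV. c i j * (2 * partial_deriv j \<psi> x)) + \<psi> x * (2 * (\<Sum>j\<in>UNIV. partial_deriv j (q i j) x))"
    unfolding modular_coeff_def qx by (simp add: sum.distrib sum_distrib_left algebra_simps)
  also have "\<dots> = 0"
  proof -
    have "(\<Sum>j\<in>UNIV. c i j * (- \<psi> x * S j)) = - \<psi> x * (\<Sum>j\<in>UNIV. c i j * S j)" for S :: "'n \<Rightarrow> real"
      by (simp add: sum_distrib_left mult.left_commute sum_negf)
    then show ?thesis unfolding d\<psi> div by simp
  qed
  finally show "modular_coeff \<psi> q x i = 0" by simp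
qed

section \<open>Tangent maps in arbitrary charts\<close>

lemma atlas_chart:
  assumes "smooth_atlas A" "c \<in> A"
  shows "open (fst c)" "open (snd c ` fst c)"
    and "homeomorphism (fst c) (snd c ` fst c) (snd c) (chart_inv c)"
  using assms by (auto simp: smooth_atlas_def)

lemma chart_inv_left [simp]:
  "smooth_atlas A \<Longrightarrow> c \<in> A \<Longrightarrow> p \<in> fst c \<Longrightarrow> chart_inv c (snd c p) = p"
  using atlas_chart(3)[of A c] by (simp add: homeomorphism_def)

lemma chart_inv_right [simp]:
  "smooth_atlas A \<Longrightarrow> c \<in> A \<Longrightarrow> x \<in> snd c ` fst c \<Longrightarrow> snd c (chart_inv c x) = x"
  using atlas_chart(3)[of A c] by (meson homeomorphism_apply2)

lemma chart_inv_in [simp]: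
  "smooth_atlas A \<Longrightarrow> c \<in> A \<Longrightarrow> x \<in> snd c ` fst c \<Longrightarrow> chart_inv c x \<in> fst c"
  using atlas_chart(3)[of A c] by (auto simp: homeomorphism_def)

lemma isCont_chart:
  assumes "smooth_atlas A" "c \<in> A" "p \<in> fst c"
  shows "isCont (snd c) p"
  using atlas_chart[OF assms(1,2)] assms(3)
  by (auto simp: homeomorphism_def continuous_on_eq_continuous_at)

lemma isCont_chart_inv:
  assumes "smooth_atlas A" "c \<in> A" "x \<in> snd c ` fst c"
  shows "isCont (chart_inv c) x"
  using atlas_chart[OF assms(1,2)] assms(3)
  by (metis homeomorphism_def continuous_on_eq_continuous_at)

lemma open_chart_image:
  assumes "smooth_atlas A" "c \<in> A" "open V"
  shows "open (snd c ` (fst c \<inter> V))"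
proof -
  have "snd c ` (fst c \<inter> V) = snd c ` fst c \<inter> chart_inv c -` V"
    using assms by (auto simp: image_iff)
  moreover have "open (snd c ` fst c \<inter> chart_inv c -` V)"
    using atlas_chart[OF assms(1,2)] assms(3)
    by (intro continuous_open_preimage) (auto simp: homeomorphism_def)
  ultimately show ?thesis by simp
qed

lemma chart_at_in:
  assumes "p \<in> atlas_carrier A"
  shows "chart_at A p \<in> A" "p \<in> fst (chart_at A p)"
proof -
  have "chart_at A p \<in> A \<and> p \<in> fst (chart_at A p)"
    unfolding chart_at_def by (rule someI_ex) (use assms in \<open>auto simp: atlas_carrier_def\<close>)
  then show "chart_at A p \<in> A" "p \<in> fst (chart_at A p)" by auto
qed

lemma open_atlas_carrier: "smooth_atlas A \<Longrightarrow> open (atlas_carrier A)"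
  unfolding atlas_carrier_def by (auto dest: atlas_chart(1))

lemma in_atlas_carrier: "c \<in> A \<Longrightarrow> p \<in> fst c \<Longrightarrow> p \<in> atlas_carrier A"
  by (auto simp: atlas_carrier_def)

lemma chart_transition_smooth:
  "smooth_atlas A \<Longrightarrow> c \<in> A \<Longrightarrow> d \<in> A \<Longrightarrow> smooth_on (snd c ` (fst c \<inter> fst d)) (snd d \<circ> chart_inv c)"
  by (auto simp: smooth_atlas_def)

lemma chart_inv_euclidean [simp]: "chart_inv (UNIV, id) = id"
  by (simp add: chart_inv_def fun_eq_iff)

lemma smooth_atlas_euclidean [simp]: "smooth_atlas (euclidean_atlas :: ('e::euclidean_space, 'e) chart set)"
  using smooth_on_id[OF open_UNIV, where 'a = 'e]
  by (simp add: smooth_atlas_def euclidean_atlas_def homeomorphism_def o_def)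

lemma chart_at_euclidean [simp]: "chart_at euclidean_atlas x = (UNIV, id)"
  unfolding chart_at_def euclidean_atlas_def by (rule some_equality) auto

lemma atlas_carrier_euclidean [simp]: "atlas_carrier euclidean_atlas = UNIV"
  by (simp add: atlas_carrier_def euclidean_atlas_def)

lemma blinfun_compose_id_left: "id_blinfun o\<^sub>L T = T"
  by (rule blinfun_eqI) simp

lemma blinfun_compose_id_right: "T o\<^sub>L id_blinfun = T"
  by (rule blinfun_eqI) simp

lemma blinfun_compose_assoc: "(S o\<^sub>L T) o\<^sub>L U = S o\<^sub>L (T o\<^sub>L U)"
  by (rule blinfun_eqI) simp

text \<open>The function \<open>tangent_map\<close> returns a value even where no derivative exists.  This relation also
  records differentiability and continuity, which is what a chain rule needs.\<close>

definition has_tangent_map ::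
    "('a::t2_space, 'e::euclidean_space) chart set \<Rightarrow>
     ('b::topological_space, 'f::euclidean_space) chart set \<Rightarrow>
     ('a \<Rightarrow> 'b) \<Rightarrow> 'a \<Rightarrow> ('e \<Rightarrow>\<^sub>L 'f) \<Rightarrow> bool" where
  "has_tangent_map A B F p T \<longleftrightarrow> p \<in> atlas_carrier A \<and> F p \<in> atlas_carrier B \<and> isCont F p \<and>
     (snd (chart_at B (F p)) \<circ> F \<circ> chart_inv (chart_at A p) has_derivative blinfun_apply T)
       (at (snd (chart_at A p) p))"

lemma has_tangent_map_imp_eq: "has_tangent_map A B F p T \<Longrightarrow> tangent_map A B F p = T"
  unfolding has_tangent_map_def tangent_map_def
  by (auto dest!: frechet_derivative_at[symmetric] simp: blinfun_apply_inverse)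

text \<open>By continuity \<open>F\<close> maps a neighbourhood of \<open>p\<close> into the chart singled out at \<open>F p\<close>, so near \<open>p\<close> the
  coordinate expression of the composition factors through that chart.\<close>

lemma has_tangent_map_compose:
  fixes A :: "('a::{t2_space,second_countable_topology}, 'e::euclidean_space) chart set"
    and B :: "('b::{t2_space,second_countable_topology}, 'f::euclidean_space) chart set"
    and C :: "('c::{t2_space,second_countable_topology}, 'g::euclidean_space) chart set"
  assumes A: "smooth_atlas A" and B: "smooth_atlas B"
    and F: "has_tangent_map A B F p T" and G: "has_tangent_map B C G (F p) S"
  shows "has_tangent_map A C (\<lambda>x. G (F x)) p (S o\<^sub>L T)"
proof -
  let ?c = "chart_at A p" and ?d = "chart_at B (F p)" and ?k = "chart_at C (G (F p))"
  have p: "?c \<in> A" "p \<in> fst ?c" "?d \<in> B" "F p \<in> fst ?d"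
    using F by (auto simp: has_tangent_map_def intro: chart_at_in)
  have cont: "isCont (\<lambda>x. G (F x)) p"
    using F G unfolding has_tangent_map_def by (intro isCont_o2[of p F G]) auto
  have x: "snd ?c p \<in> snd ?c ` fst ?c" using p by auto
  have "isCont F (chart_inv ?c (snd ?c p))"
    using F p A by (simp add: has_tangent_map_def)
  then have "isCont (\<lambda>y. F (chart_inv ?c y)) (snd ?c p)"
    by (rule isCont_o2[OF isCont_chart_inv[OF A p(1) x]])
  then have "((\<lambda>y. F (chart_inv ?c y)) \<longlongrightarrow> F p) (at (snd ?c p))"
    using p A by (simp add: isCont_def)
  then have ev: "\<forall>\<^sub>F y in at (snd ?c p). F (chart_inv ?c y) \<in> fst ?d"
    using topological_tendstoD atlas_chart(1)[OF B p(3)] p(4) by blast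
  have "(snd ?k \<circ> G \<circ> chart_inv ?d \<circ> (snd ?d \<circ> F \<circ> chart_inv ?c) has_derivative
      blinfun_apply S \<circ> blinfun_apply T) (at (snd ?c p))"
  proof (rule diff_chain_at)
    show "(snd ?d \<circ> F \<circ> chart_inv ?c has_derivative blinfun_apply T) (at (snd ?c p))"
      using F by (simp add: has_tangent_map_def)
    show "(snd ?k \<circ> G \<circ> chart_inv ?d has_derivative blinfun_apply S) (at ((snd ?d \<circ> F \<circ> chart_inv ?c) (snd ?c p)))"
      using G A p by (simp add: has_tangent_map_def)
  qed
  then have "(snd ?k \<circ> (\<lambda>x. G (F x)) \<circ> chart_inv ?c has_derivative blinfun_apply S \<circ> blinfun_apply T) (at (snd ?c p))"
  proof (rule has_derivative_transform_eventually)
    show "\<forall>\<^sub>F y in at (snd ?c p). (snd ?k \<circ> G \<circ> chart_inv ?d \<circ> (snd ?d \<circ> F \<circ> chart_inv ?c)) y =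
      (snd ?k \<circ> (\<lambda>x. G (F x)) \<circ> chart_inv ?c) y"
      using ev by eventually_elim (simp add: chart_inv_left[OF B p(3)])
    show "(snd ?k \<circ> G \<circ> chart_inv ?d \<circ> (snd ?d \<circ> F \<circ> chart_inv ?c)) (snd ?c p) =
      (snd ?k \<circ> (\<lambda>x. G (F x)) \<circ> chart_inv ?c) (snd ?c p)"
      using chart_inv_left[OF A p(1,2)] chart_inv_left[OF B p(3,4)] by simp
  qed simp
  moreover have "blinfun_apply S \<circ> blinfun_apply T = blinfun_apply (S o\<^sub>L T)" by (simp add: fun_eq_iff)
  ultimately show ?thesis
    using F G cont by (simp add: has_tangent_map_def)
qed

lemma has_tangent_map_cong:
  fixes A :: "('a::{t2_space,second_countable_topology}, 'e::euclidean_space) chart set"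
  assumes A: "smooth_atlas A" and F: "has_tangent_map A B F p T"
    and V: "open V" "p \<in> V" "\<And>x. x \<in> V \<Longrightarrow> F x = G x"
  shows "has_tangent_map A B G p T"
proof -
  let ?c = "chart_at A p"
  have p: "?c \<in> A" "p \<in> fst ?c" using F by (auto simp: has_tangent_map_def intro: chart_at_in)
  have ev: "\<forall>\<^sub>F x in nhds p. F x = G x" using V eventually_nhds by blast
  have cont: "isCont G p" using F isCont_cong[OF ev] by (simp add: has_tangent_map_def)
  have FG: "F p = G p" using V by auto
  have "(snd (chart_at B (G p)) \<circ> G \<circ> chart_inv ?c has_derivative blinfun_apply T) (at (snd ?c p))"
  proof (rule has_derivative_transform_within_open)
    show "(snd (chart_at B (G p)) \<circ> F \<circ> chart_inv ?c has_derivative blinfun_apply T) (at (snd ?c p))"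
      using F FG by (simp add: has_tangent_map_def)
    show "open (snd ?c ` (fst ?c \<inter> V))" by (rule open_chart_image[OF A p(1) V(1)])
    show "snd ?c p \<in> snd ?c ` (fst ?c \<inter> V)" using p V by auto
    show "(snd (chart_at B (G p)) \<circ> F \<circ> chart_inv ?c) y = (snd (chart_at B (G p)) \<circ> G \<circ> chart_inv ?c) y"
      if "y \<in> snd ?c ` (fst ?c \<inter> V)" for y
      using that V A p by auto
  qed
  then show ?thesis using F cont FG by (simp add: has_tangent_map_def)
qed

lemma has_tangent_map_euclidean:
  assumes "(f has_derivative D) (at x)"
  shows "has_tangent_map euclidean_atlas euclidean_atlas f x (Blinfun D)"
  using assms has_derivative_continuous[OF assms] has_derivative_bounded_linear[OF assms]
  by (simp add: has_tangent_map_def bounded_linear_Blinfun_apply)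

lemma has_tangent_map_chart:
  assumes A: "smooth_atlas A" and c: "c \<in> A" "p \<in> fst c"
  shows "has_tangent_map A euclidean_atlas (snd c) p (to_coords A c p)"
proof -
  let ?d = "chart_at A p"
  have d: "?d \<in> A" "p \<in> fst ?d" using chart_at_in[OF in_atlas_carrier[OF c]] by simp_all
  have "(snd c \<circ> chart_inv ?d has_derivative frechet_derivative (snd c \<circ> chart_inv ?d) (at (snd ?d p))) (at (snd ?d p))"
    by (rule smooth_on_has_derivative[OF chart_transition_smooth[OF A d(1) c(1)]]) (use c d in auto)
  moreover from has_derivative_bounded_linear[OF this]
  have "blinfun_apply (to_coords A c p) = frechet_derivative (snd c \<circ> chart_inv ?d) (at (snd ?d p))"
    by (simp add: to_coords_def tangent_map_def bounded_linear_Blinfun_apply)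
  ultimately show ?thesis
    using isCont_chart[OF A c] in_atlas_carrier[OF c] by (simp add: has_tangent_map_def)
qed

lemma has_tangent_map_chart_inv:
  assumes A: "smooth_atlas A" and c: "c \<in> A" "p \<in> fst c"
  shows "has_tangent_map euclidean_atlas A (chart_inv c) (snd c p) (from_coords A c p)"
proof -
  let ?d = "chart_at A p"
  have d: "?d \<in> A" "p \<in> fst ?d" using chart_at_in[OF in_atlas_carrier[OF c]] by simp_all
  have "(snd ?d \<circ> chart_inv c has_derivative frechet_derivative (snd ?d \<circ> chart_inv c) (at (snd c p))) (at (snd c p))"
    by (rule smooth_on_has_derivative[OF chart_transition_smooth[OF A c(1) d(1)]]) (use c d in auto)
  moreover from has_derivative_bounded_linear[OF this]
  have "blinfun_apply (from_coords A c p) = frechet_derivative (snd ?d \<circ> chart_inv c) (at (snd c p))"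
    using A c by (simp add: from_coords_def tangent_map_def bounded_linear_Blinfun_apply)
  ultimately show ?thesis
    using isCont_chart_inv[OF A c(1)] in_atlas_carrier[OF c] A c by (simp add: has_tangent_map_def)
qed

lemma has_tangent_map_ident:
  assumes A: "smooth_atlas A" and p: "p \<in> atlas_carrier A"
  shows "has_tangent_map A A (\<lambda>x. x) p id_blinfun"
proof -
  let ?c = "chart_at A p"
  have c: "?c \<in> A" "p \<in> fst ?c" using chart_at_in[OF p] by simp_all
  have "(snd ?c \<circ> (\<lambda>x. x) \<circ> chart_inv ?c has_derivative blinfun_apply id_blinfun) (at (snd ?c p))"
    by (rule has_derivative_transform_within_open[of "\<lambda>x. x" _ _ _ "snd ?c ` fst ?c"])
      (use A c atlas_chart(2)[OF A c(1)] in \<open>auto simp: id_def[symmetric] id_blinfun.rep_eq\<close>)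
  then show ?thesis using p by (simp add: has_tangent_map_def)
qed

lemma to_coords_from_coords:
  assumes A: "smooth_atlas A" and c: "c \<in> A" "p \<in> fst c"
  shows "to_coords A c p o\<^sub>L from_coords A c p = id_blinfun"
    and "from_coords A c p o\<^sub>L to_coords A c p = id_blinfun"
proof -
  have "has_tangent_map euclidean_atlas euclidean_atlas (\<lambda>x. snd c (chart_inv c x)) (snd c p)
     (to_coords A c p o\<^sub>L from_coords A c p)"
    by (rule has_tangent_map_compose[OF smooth_atlas_euclidean A has_tangent_map_chart_inv[OF A c]])
      (simp add: chart_inv_left[OF A c] has_tangent_map_chart[OF A c])
  then have 1: "has_tangent_map euclidean_atlas euclidean_atlas (\<lambda>x. x) (snd c p)
     (to_coords A c p o\<^sub>L from_coords A c p)"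
    by (rule has_tangent_map_cong[OF smooth_atlas_euclidean _ atlas_chart(2)[OF A c(1)]])
       (use A c in auto)
  have 2: "has_tangent_map euclidean_atlas euclidean_atlas (\<lambda>x. x) (snd c p) id_blinfun"
    by (rule has_tangent_map_ident) auto
  show "to_coords A c p o\<^sub>L from_coords A c p = id_blinfun"
    using has_tangent_map_imp_eq[OF 1] has_tangent_map_imp_eq[OF 2] by simp
  have "has_tangent_map A A (\<lambda>x. chart_inv c (snd c x)) p (from_coords A c p o\<^sub>L to_coords A c p)"
    by (rule has_tangent_map_compose[OF A smooth_atlas_euclidean has_tangent_map_chart[OF A c]
        has_tangent_map_chart_inv[OF A c]])
  then have 3: "has_tangent_map A A (\<lambda>x. x) p (from_coords A c p o\<^sub>L to_coords A c p)"
    by (rule has_tangent_map_cong[OF A _ atlas_chart(1)[OF A c(1)]]) (use A c in auto)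
  show "from_coords A c p o\<^sub>L to_coords A c p = id_blinfun"
    using has_tangent_map_imp_eq[OF 3] has_tangent_map_imp_eq[OF has_tangent_map_ident[OF A in_atlas_carrier[OF c]]]
    by simp
qed

lemma to_coords_chart_at:
  assumes A: "smooth_atlas A" and p: "p \<in> atlas_carrier A"
  shows "to_coords A (chart_at A p) p = id_blinfun" "from_coords A (chart_at A p) p = id_blinfun"
proof -
  have c: "chart_at A p \<in> A" "p \<in> fst (chart_at A p)" using chart_at_in[OF p] by simp_all
  have "has_tangent_map A A (\<lambda>x. x) p id_blinfun" by (rule has_tangent_map_ident[OF A p])
  moreover have "blinfun_apply (to_coords A (chart_at A p) p) =
     frechet_derivative (snd (chart_at A p) \<circ> (\<lambda>x. x) \<circ> chart_inv (chart_at A p)) (at (snd (chart_at A p) p))"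
    using has_tangent_map_chart[OF A c] unfolding has_tangent_map_def
    by (auto dest!: frechet_derivative_at simp: o_def)
  ultimately show 1: "to_coords A (chart_at A p) p = id_blinfun"
    unfolding has_tangent_map_def by (auto dest!: frechet_derivative_at intro: blinfun_eqI)
  show "from_coords A (chart_at A p) p = id_blinfun"
    using to_coords_from_coords(1)[OF A c] by (simp add: 1 blinfun_compose_id_left)
qed

text \<open>Near \<open>p\<close> the map is the composition of \<open>c\<close>, its expression in the charts \<open>c\<close> and \<open>d\<close>, and the inverse
  of \<open>d\<close>, so differentiability may be tested in any charts.\<close>

lemma has_tangent_map_coords:
  fixes A :: "('a::{t2_space,second_countable_topology}, 'e::euclidean_space) chart set"
    and B :: "('b::{t2_space,second_countable_topology}, 'f::euclidean_space) chart set"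
  assumes A: "smooth_atlas A" and B: "smooth_atlas B"
    and c: "c \<in> A" "p \<in> fst c" and d: "d \<in> B" "F p \<in> fst d"
    and cont: "isCont F p"
    and D: "((\<lambda>x. snd d (F (chart_inv c x))) has_derivative D) (at (snd c p))"
  shows "has_tangent_map A B F p (from_coords B d (F p) o\<^sub>L (Blinfun D o\<^sub>L to_coords A c p))"
proof -
  have "has_tangent_map euclidean_atlas euclidean_atlas (\<lambda>x. snd d (F (chart_inv c x))) (snd c p) (Blinfun D)"
    by (rule has_tangent_map_euclidean[OF D])
  from has_tangent_map_compose[OF A smooth_atlas_euclidean has_tangent_map_chart[OF A c] this]
  have "has_tangent_map A euclidean_atlas (\<lambda>x. snd d (F (chart_inv c (snd c x)))) p (Blinfun D o\<^sub>L to_coords A c p)" .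
  from has_tangent_map_compose[OF A smooth_atlas_euclidean this, of B "chart_inv d" "from_coords B d (F p)"]
  have *: "has_tangent_map A B (\<lambda>x. chart_inv d (snd d (F (chart_inv c (snd c x))))) p
     (from_coords B d (F p) o\<^sub>L (Blinfun D o\<^sub>L to_coords A c p))"
    using has_tangent_map_chart_inv[OF B d] A c by simp
  have "\<exists>V. open V \<and> p \<in> V \<and> (\<forall>x\<in>V. F x \<in> fst d)"
    using cont[unfolded continuous_at_open] atlas_chart(1)[OF B d(1)] d(2) by blast
  then obtain V where V: "open V" "p \<in> V" "\<And>x. x \<in> V \<Longrightarrow> F x \<in> fst d"
    by blast
  show ?thesis
    by (rule has_tangent_map_cong[OF A *, of "V \<inter> fst c"])
      (use V c d A B atlas_chart(1)[OF A c(1)] in auto)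
qed

lemma coord_map_open:
  fixes A :: "('a::{t2_space,second_countable_topology}, 'e::euclidean_space) chart set"
  assumes A: "smooth_atlas A" and B: "smooth_atlas B" and F: "smooth_map A B F" and c: "c \<in> A" and d: "d \<in> B"
  shows "open (fst c \<inter> F -` fst d)" "open (snd c ` (fst c \<inter> F -` fst d))"
proof -
  have "continuous_on (fst c) F"
    using F c by (auto simp: smooth_map_def atlas_carrier_def intro: continuous_on_subset)
  then show "open (fst c \<inter> F -` fst d)"
    using atlas_chart(1)[OF A c] atlas_chart(1)[OF B d] by (intro continuous_open_preimage)
  from open_chart_image[OF A c this] show "open (snd c ` (fst c \<inter> F -` fst d))" by simp
qed

lemma smooth_map_coords:
  "smooth_map A B F \<Longrightarrow> c \<in> A \<Longrightarrow> d \<in> B \<Longrightarrow>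
    smooth_on (snd c ` (fst c \<inter> F -` fst d)) (\<lambda>x. snd d (F (chart_inv c x)))"
  unfolding smooth_map_def by (auto simp: o_def)

lemma smooth_map_has_tangent_map:
  fixes A :: "('a::{t2_space,second_countable_topology}, 'e::euclidean_space) chart set"
    and B :: "('b::{t2_space,second_countable_topology}, 'f::euclidean_space) chart set"
  assumes A: "smooth_atlas A" and B: "smooth_atlas B" and F: "smooth_map A B F" and p: "p \<in> atlas_carrier A"
  shows "has_tangent_map A B F p (tangent_map A B F p)"
proof -
  have "F p \<in> atlas_carrier B" using F p by (auto simp: smooth_map_def)
  then have d: "chart_at B (F p) \<in> B" "F p \<in> fst (chart_at B (F p))" by (rule chart_at_in)+
  have c: "chart_at A p \<in> A" "p \<in> fst (chart_at A p)" using chart_at_in[OF p] by simp_all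
  have "isCont F p"
    using F p open_atlas_carrier[OF A] by (auto simp: smooth_map_def continuous_on_eq_continuous_at)
  from has_tangent_map_coords[OF A B c d this smooth_on_has_derivative[OF smooth_map_coords[OF F c(1) d(1)]]]
  show ?thesis using c d has_tangent_map_imp_eq by (metis (no_types, lifting) IntI imageI vimageI)
qed

lemma tangent_map_coords:
  fixes A :: "('a::{t2_space,second_countable_topology}, 'e::euclidean_space) chart set"
    and B :: "('b::{t2_space,second_countable_topology}, 'f::euclidean_space) chart set"
  assumes A: "smooth_atlas A" and B: "smooth_atlas B" and F: "has_tangent_map A B F p T"
    and c: "c \<in> A" "p \<in> fst c" and d: "d \<in> B" "F p \<in> fst d"
  shows "((\<lambda>x. snd d (F (chart_inv c x))) has_derivative
     blinfun_apply (to_coords B d (F p) o\<^sub>L (T o\<^sub>L from_coords A c p))) (at (snd c p))"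
proof -
  have "has_tangent_map euclidean_atlas B (\<lambda>x. F (chart_inv c x)) (snd c p) (T o\<^sub>L from_coords A c p)"
    by (rule has_tangent_map_compose[OF smooth_atlas_euclidean A has_tangent_map_chart_inv[OF A c]])
      (use F A c in simp)
  from has_tangent_map_compose[OF smooth_atlas_euclidean B this, of euclidean_atlas "snd d" "to_coords B d (F p)"]
  have "has_tangent_map euclidean_atlas euclidean_atlas (\<lambda>x. snd d (F (chart_inv c x))) (snd c p)
    (to_coords B d (F p) o\<^sub>L (T o\<^sub>L from_coords A c p))"
    using has_tangent_map_chart[OF B d] A c by simp
  then show ?thesis by (simp add: has_tangent_map_def o_def)
qed

section \<open>Vector fields, bivectors and top forms in a chart\<close>

lemma dual_basis_apply [simp]: "blinfun_apply (dual_basis j) v = v $ j"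
  by (simp add: dual_basis_def bounded_linear_Blinfun_apply bounded_linear_vec_nth)

lemma covector_expansion:
  fixes \<alpha> :: "(real^'n) \<Rightarrow>\<^sub>L real"
  shows "\<alpha> = (\<Sum>j\<in>UNIV. blinfun_apply \<alpha> (axis j 1) *\<^sub>R dual_basis j)"
proof (rule blinfun_eqI)
  fix v
  have lin: "linear (blinfun_apply \<alpha>)" by (rule bounded_linear.linear[OF blinfun.bounded_linear_right])
  show "blinfun_apply \<alpha> v = blinfun_apply (\<Sum>j\<in>UNIV. blinfun_apply \<alpha> (axis j 1) *\<^sub>R dual_basis j) v"
    using linear_axis_expansion[OF lin, of v]
    by (simp add: blinfun.sum_left blinfun.scaleR_left mult.commute)
qed

lemma bivector_linear:
  assumes "bilinear (P :: (real^'n) bivector)"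
  shows "P \<alpha> \<beta> = (\<Sum>j\<in>UNIV. blinfun_apply \<beta> (axis j 1) * P \<alpha> (dual_basis j))"
    and "P \<alpha> \<beta> = (\<Sum>j\<in>UNIV. blinfun_apply \<alpha> (axis j 1) * P (dual_basis j) \<beta>)"
proof -
  have r: "linear (P \<alpha>)" and l: "linear (\<lambda>\<alpha>. P \<alpha> \<beta>)" using assms by (auto simp: bilinear_def)
  show "P \<alpha> \<beta> = (\<Sum>j\<in>UNIV. blinfun_apply \<beta> (axis j 1) * P \<alpha> (dual_basis j))"
    using arg_cong[OF covector_expansion[of \<beta>], of "P \<alpha>"]
    by (simp add: linear_sum[OF r] linear_scale[OF r])
  show "P \<alpha> \<beta> = (\<Sum>j\<in>UNIV. blinfun_apply \<alpha> (axis j 1) * P (dual_basis j) \<beta>)"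
    using arg_cong[OF covector_expansion[of \<alpha>], of "\<lambda>\<alpha>. P \<alpha> \<beta>"]
    by (simp add: linear_sum[OF l] linear_scale[OF l])
qed

lemma bivector_skew:
  assumes "bilinear P" "\<And>\<alpha>. P \<alpha> \<alpha> = (0::real)"
  shows "P \<alpha> \<beta> = - P \<beta> \<alpha>"
  using assms(2)[of "\<alpha> + \<beta>"] assms(2)[of \<alpha>] assms(2)[of \<beta>]
  by (simp add: bilinear_ladd[OF assms(1)] bilinear_radd[OF assms(1)])

text \<open>Finite dimension makes every linear functional on covectors the evaluation at a unique vector.\<close>

lemma sharp_apply:
  fixes P :: "(real^'n) bivector"
  assumes "bilinear P"
  shows "blinfun_apply \<beta> (sharp P \<alpha>) = P \<alpha> \<beta>"
proof -
  have "\<exists>!v. \<forall>\<beta>. blinfun_apply \<beta> v = P \<alpha> \<beta>"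
  proof (rule ex1I)
    let ?v = "\<chi> j. P \<alpha> (dual_basis j)"
    have "blinfun_apply \<beta> ?v = P \<alpha> \<beta>" for \<beta>
      using linear_axis_expansion[OF bounded_linear.linear[OF blinfun.bounded_linear_right], of \<beta> ?v]
      by (simp add: bivector_linear(1)[OF assms, of \<alpha> \<beta>] mult.commute)
    then show "\<forall>\<beta>. blinfun_apply \<beta> ?v = P \<alpha> \<beta>" by blast
    show "v = ?v" if "\<forall>\<beta>. blinfun_apply \<beta> v = P \<alpha> \<beta>" for v
    proof -
      have "v $ j = P \<alpha> (dual_basis j)" for j using that[rule_format, of "dual_basis j"] by simp
      then show ?thesis by (simp add: vec_eq_iff)
    qed
  qed
  from theI'[OF this] show ?thesis unfolding sharp_def by blast
qed

lemma bilinear_push_bivector: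
  fixes T :: "'f::euclidean_space \<Rightarrow>\<^sub>L 'g::euclidean_space"
  assumes "bilinear P" shows "bilinear (push_bivector T P)"
proof -
  have "(\<alpha> + \<beta>) o\<^sub>L T = (\<alpha> o\<^sub>L T) + (\<beta> o\<^sub>L T)" "(r *\<^sub>R \<alpha>) o\<^sub>L T = r *\<^sub>R (\<alpha> o\<^sub>L T)" for \<alpha> \<beta> :: "'g \<Rightarrow>\<^sub>L real" and r
    by (rule blinfun_eqI; simp add: blinfun.add_left blinfun.scaleR_left)+
  then show ?thesis
    unfolding bilinear_def push_bivector_def
    by (auto intro!: linearI simp: bilinear_ladd[OF assms] bilinear_radd[OF assms]
        bilinear_lmul[OF assms] bilinear_rmul[OF assms])
qed

lemma bivector_field_at:
  assumes "bivector_field A \<pi>" "p \<in> atlas_carrier A"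
  shows "bilinear (\<pi> p)" "\<pi> p \<alpha> \<alpha> = 0"
  using assms by (auto simp: bivector_field_def)

definition bivector_coeff ::
    "('a, real^'n) chart set \<Rightarrow> ('a \<Rightarrow> (real^'n) bivector) \<Rightarrow> ('a, real^'n) chart \<Rightarrow>
     'n \<Rightarrow> 'n \<Rightarrow> real^'n \<Rightarrow> real" where
  "bivector_coeff A \<pi> c i j y = local_bivector A \<pi> c y (dual_basis i) (dual_basis j)"

lemma smooth_on_bivector_coeff:
  "bivector_field A \<pi> \<Longrightarrow> c \<in> A \<Longrightarrow> smooth_on (snd c ` fst c) (bivector_coeff A \<pi> c i j)"
  unfolding bivector_field_def bivector_coeff_def[abs_def] by blast

lemma local_bivector_at:
  assumes A: "smooth_atlas A" and \<pi>: "bivector_field A \<pi>" and c: "c \<in> A" and y: "y \<in> snd c ` fst c"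
  shows "bilinear (local_bivector A \<pi> c y)" "local_bivector A \<pi> c y \<alpha> \<alpha> = 0"
proof -
  have "chart_inv c y \<in> atlas_carrier A"
    using chart_inv_in[OF A c y] in_atlas_carrier[OF c] by blast
  from bivector_field_at[OF \<pi> this]
  show "bilinear (local_bivector A \<pi> c y)" "local_bivector A \<pi> c y \<alpha> \<alpha> = 0"
    by (simp_all add: local_bivector_def bilinear_push_bivector) (simp add: push_bivector_def)
qed

lemma smooth_function_coords:
  assumes F: "smooth_function A F" and c: "c \<in> A"
  shows "smooth_on (snd c ` fst c) (\<lambda>y. F (chart_inv c y))"
  using smooth_map_coords[OF F c, of "(UNIV, id)"] by (simp add: euclidean_atlas_def)

lemma differential_coords:
  fixes A :: "('a::{t2_space,second_countable_topology}, real^'n) chart set"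
  assumes A: "smooth_atlas A" and F: "(\<lambda>y. F (chart_inv c y)) differentiable (at (snd c q))"
    and c: "c \<in> A" "q \<in> fst c"
  shows "differential A F q =
    (\<Sum>i\<in>UNIV. partial_deriv i (\<lambda>y. F (chart_inv c y)) (snd c q) *\<^sub>R (dual_basis i o\<^sub>L to_coords A c q))"
proof -
  define D where "D = frechet_derivative (\<lambda>y. F (chart_inv c y)) (at (snd c q))"
  have D: "((\<lambda>y. F (chart_inv c y)) has_derivative D) (at (snd c q))"
    unfolding D_def using F by (simp add: frechet_derivative_works)
  have F1: "has_tangent_map euclidean_atlas euclidean_atlas (\<lambda>y. F (chart_inv c y)) (snd c q) (Blinfun D)"
    by (rule has_tangent_map_euclidean[OF D])
  have "has_tangent_map A euclidean_atlas (\<lambda>x. F (chart_inv c (snd c x))) q (Blinfun D o\<^sub>L to_coords A c q)"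
    by (rule has_tangent_map_compose[OF A smooth_atlas_euclidean has_tangent_map_chart[OF A c] F1])
  then have "has_tangent_map A euclidean_atlas F q (Blinfun D o\<^sub>L to_coords A c q)"
    by (rule has_tangent_map_cong[OF A _ atlas_chart(1)[OF A c(1)] c(2)]) (simp add: chart_inv_left[OF A c(1)])
  then have "differential A F q = Blinfun D o\<^sub>L to_coords A c q" by (rule has_tangent_map_imp_eq)
  moreover have "Blinfun D = (\<Sum>i\<in>UNIV. partial_deriv i (\<lambda>y. F (chart_inv c y)) (snd c q) *\<^sub>R dual_basis i)"
    using covector_expansion[of "Blinfun D"]
    by (simp add: bounded_linear_Blinfun_apply[OF has_derivative_bounded_linear[OF D]] partial_deriv_eq[OF D])
  ultimately show ?thesis
    by (intro blinfun_eqI) (simp add: blinfun.sum_left blinfun.scaleR_left)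
qed

text \<open>The hypotheses concern a single point, since the formula is also used for the translate of a
  bivector field.\<close>

lemma local_hamiltonian_vector_field:
  fixes A :: "('a::{t2_space,second_countable_topology}, real^'n) chart set"
  assumes A: "smooth_atlas A" and P: "bilinear (\<pi> (chart_inv c y))"
    and F: "(\<lambda>y. F (chart_inv c y)) differentiable (at y)"
    and c: "c \<in> A" and y: "y \<in> snd c ` fst c"
  shows "local_vector A (hamiltonian_vector_field A \<pi> F) c y $ j =
    (\<Sum>i\<in>UNIV. partial_deriv i (\<lambda>y. F (chart_inv c y)) y * bivector_coeff A \<pi> c i j y)"
proof -
  let ?q = "chart_inv c y" and ?C = "to_coords A c (chart_inv c y)"
  have q: "?q \<in> fst c" "snd c ?q = y" using chart_inv_in[OF A c y] chart_inv_right[OF A c y] .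
  have l: "linear (\<lambda>\<alpha>. \<pi> ?q \<alpha> \<beta>)" for \<beta> using P by (simp add: bilinear_def)
  have Fq: "(\<lambda>y. F (chart_inv c y)) differentiable (at (snd c ?q))" using F by (simp add: q(2))
  have "local_vector A (hamiltonian_vector_field A \<pi> F) c y $ j =
    blinfun_apply (dual_basis j o\<^sub>L ?C) (sharp (\<pi> ?q) (differential A F ?q))"
    by (simp add: local_vector_def hamiltonian_vector_field_def)
  also have "\<dots> = \<pi> ?q (differential A F ?q) (dual_basis j o\<^sub>L ?C)"
    by (rule sharp_apply[OF P])
  also have "\<dots> = (\<Sum>i\<in>UNIV. partial_deriv i (\<lambda>y. F (chart_inv c y)) y *
      \<pi> ?q (dual_basis i o\<^sub>L ?C) (dual_basis j o\<^sub>L ?C))"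
    unfolding differential_coords[where F = F, OF A Fq c q(1)] q(2)
    by (simp add: linear_sum[OF l] linear_scale[OF l])
  finally show ?thesis by (simp add: bivector_coeff_def local_bivector_def push_bivector_def)
qed

text \<open>The coefficient of a top form with respect to the coordinate volume form of the chart.\<close>

definition form_density ::
    "('a, real^'n) chart set \<Rightarrow> ('a \<Rightarrow> ('n \<Rightarrow> real^'n) \<Rightarrow> real) \<Rightarrow> ('a, real^'n) chart \<Rightarrow> real^'n \<Rightarrow> real" where
  "form_density A \<Phi> c y = local_form A \<Phi> c y (\<lambda>i. axis i 1)"

lemma alternating_form_compose_linear:
  assumes \<omega>: "alternating_form \<omega>" and T: "linear T"
  shows "alternating_form (\<lambda>v. \<omega> (\<lambda>i. T (v i)))"
proof -
  have eq: "(\<lambda>k. T ((v(i := x)) k)) = (\<lambda>k. T (v k))(i := T x)" for v i x by auto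
  have "linear (\<lambda>x. \<omega> (\<lambda>k. T ((v(i := x)) k)))" for v i
    unfolding eq using linear_compose[OF T alternating_form_linear[OF \<omega>, of "\<lambda>k. T (v k)" i]]
    by (simp add: o_def)
  moreover have "\<omega> (\<lambda>k. T (v k)) = 0" if "i \<noteq> j" "v i = v j" for v i j
    by (rule alternating_form_repeat[OF \<omega> that(1)]) (simp add: that)
  ultimately show ?thesis unfolding alternating_form_def by blast
qed

lemma local_form_eq_density:
  fixes A :: "('a::{t2_space,second_countable_topology}, real^'n) chart set"
  assumes A: "smooth_atlas A" and \<Phi>: "\<And>p. p \<in> atlas_carrier A \<Longrightarrow> alternating_form (\<Phi> p)"
    and c: "c \<in> A" and y: "y \<in> snd c ` fst c"
  shows "local_form A \<Phi> c y v = form_density A \<Phi> c y * det (\<chi> i. v i)"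
proof -
  have "alternating_form (local_form A \<Phi> c y)"
    unfolding local_form_def[abs_def]
    by (rule alternating_form_compose_linear[OF \<Phi>[OF in_atlas_carrier[OF c chart_inv_in[OF A c y]]]
          bounded_linear.linear[OF blinfun.bounded_linear_right]])
  from alternating_form_eq_det[OF this] show ?thesis unfolding form_density_def .
qed

text \<open>The sum over the slots in the Lie derivative is a trace by \<open>alternating_form_trace\<close>.\<close>

lemma lie_derivative_eq_weighted_divergence:
  fixes A :: "('a::{t2_space,second_countable_topology}, real^'n) chart set"
  assumes A: "smooth_atlas A" and \<Phi>: "\<And>p. p \<in> atlas_carrier A \<Longrightarrow> alternating_form (\<Phi> p)"
    and p: "p \<in> atlas_carrier A"
    and d: "form_density A \<Phi> (chart_at A p) differentiable (at (snd (chart_at A p) p))"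
    and X: "local_vector A X (chart_at A p) differentiable (at (snd (chart_at A p) p))"
  shows "lie_derivative A X \<Phi> p v =
    weighted_divergence (form_density A \<Phi> (chart_at A p)) (local_vector A X (chart_at A p))
      (snd (chart_at A p) p) * det (\<chi> i. v i)"
proof -
  let ?c = "chart_at A p"
  let ?x = "snd ?c p"
  have c: "?c \<in> A" "p \<in> fst ?c" using chart_at_in[OF p] by simp_all
  have x: "?x \<in> snd ?c ` fst ?c" using c by simp
  note id = to_coords_chart_at[OF A p] and inv = chart_inv_left[OF A c]
  have Xp: "X p = local_vector A X ?c ?x" by (simp add: local_vector_def inv id)
  have \<Phi>p: "\<Phi> p v = form_density A \<Phi> ?c ?x * det (\<chi> i. v i)" for v
    using local_form_eq_density[OF A \<Phi> c(1) x, where v = v]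
    by (simp add: local_form_def inv id)
  have "((\<lambda>y. local_form A \<Phi> ?c y v) has_derivative
    (\<lambda>w. frechet_derivative (form_density A \<Phi> ?c) (at ?x) w * det (\<chi> i. v i))) (at ?x)"
    by (rule has_derivative_transform_within_open[OF _ atlas_chart(2)[OF A c(1)] x,
          of "\<lambda>y. form_density A \<Phi> ?c y * det (\<chi> i. v i)"])
      (use d in \<open>auto simp: local_form_eq_density[OF A \<Phi> c(1)] frechet_derivative_works
          intro!: has_derivative_mult_left\<close>)
  note 1 = frechet_derivative_at[OF this, symmetric]
  have lin: "linear (frechet_derivative (local_vector A X ?c) (at ?x))"
    by (rule linear_frechet_derivative[OF X])
  have 2: "(\<Sum>i\<in>UNIV. \<Phi> p (v(i := frechet_derivative (local_vector A X ?c) (at ?x) (v i)))) =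
      trace (matrix (frechet_derivative (local_vector A X ?c) (at ?x))) *
      (form_density A \<Phi> ?c ?x * det (\<chi> i. v i))"
    using alternating_form_trace[OF \<Phi>[OF p] lin, of v] unfolding \<Phi>p[of v] .
  show ?thesis
    unfolding lie_derivative_def Let_def 1 2 Xp weighted_divergence_def
    by (simp add: algebra_simps)
qed

lemma matrix_mult_id_blinfun:
  fixes S T :: "(real^'n) \<Rightarrow>\<^sub>L (real^'n)"
  assumes "S o\<^sub>L T = id_blinfun"
  shows "matrix (blinfun_apply S) ** matrix (blinfun_apply T) = mat 1"
proof -
  have "matrix (blinfun_apply S) ** matrix (blinfun_apply T) = matrix (blinfun_apply S \<circ> blinfun_apply T)"
    by (rule matrix_compose[symmetric]) (rule bounded_linear.linear[OF blinfun.bounded_linear_right])+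
  also have "blinfun_apply S \<circ> blinfun_apply T = (\<lambda>v. v)"
    using arg_cong[OF assms, of blinfun_apply] by (auto simp: fun_eq_iff)
  finally show ?thesis by (auto simp: matrix_def mat_def axis_def vec_eq_iff)
qed

lemma form_density_transform:
  fixes A :: "('a::{t2_space,second_countable_topology}, real^'n) chart set"
  assumes A: "smooth_atlas A" and \<Phi>: "\<And>p. p \<in> atlas_carrier A \<Longrightarrow> alternating_form (\<Phi> p)"
    and F: "has_tangent_map A A F q T" and c: "c \<in> A" "q \<in> fst c" and d: "d \<in> A" "F q \<in> fst d"
  shows "form_density A \<Phi> d (snd d (F q)) *
      det (matrix (frechet_derivative (\<lambda>y. snd d (F (chart_inv c y))) (at (snd c q)))) =
    \<Phi> (F q) (\<lambda>i. T (from_coords A c q (axis i 1)))"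
proof -
  let ?D = "frechet_derivative (\<lambda>y. snd d (F (chart_inv c y))) (at (snd c q))"
  have D: "?D = blinfun_apply (to_coords A d (F q) o\<^sub>L (T o\<^sub>L from_coords A c q))"
    using frechet_derivative_at[OF tangent_map_coords[OF A A F c d]] by simp
  have "form_density A \<Phi> d (snd d (F q)) * det (matrix ?D) =
    form_density A \<Phi> d (snd d (F q)) * det (\<chi> i. ?D (axis i 1))"
    using det_transpose[of "matrix ?D"] by (simp add: matrix_def transpose_def)
  also have "\<dots> = local_form A \<Phi> d (snd d (F q)) (\<lambda>i. ?D (axis i 1))"
    by (rule local_form_eq_density[OF A \<Phi> d(1), symmetric]) (use d in auto)
  also have "\<dots> = \<Phi> (F q) (\<lambda>i. from_coords A d (F q) (?D (axis i 1)))"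
    by (simp add: local_form_def chart_inv_left[OF A d])
  also have "\<dots> = \<Phi> (F q) (\<lambda>i. T (from_coords A c q (axis i 1)))"
  proof -
    have "from_coords A d (F q) (?D v) = T (from_coords A c q v)" for v
    using arg_cong[OF to_coords_from_coords(2)[OF A d], of "\<lambda>S. blinfun_apply S (T (from_coords A c q v))"]
    by (simp add: D)
    then show ?thesis by simp
  qed
  finally show ?thesis .
qed

lemma coord_jacobian_nonzero:
  fixes A :: "('a::{t2_space,second_countable_topology}, real^'n) chart set"
  assumes A: "smooth_atlas A" and F: "has_tangent_map A A F q T" and S: "S o\<^sub>L T = id_blinfun"
    and c: "c \<in> A" "q \<in> fst c" and d: "d \<in> A" "F q \<in> fst d"
  shows "det (matrix (frechet_derivative (\<lambda>y. snd d (F (chart_inv c y))) (at (snd c q)))) \<noteq> 0"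
proof -
  let ?D = "to_coords A d (F q) o\<^sub>L (T o\<^sub>L from_coords A c q)"
  let ?E = "to_coords A c q o\<^sub>L (S o\<^sub>L from_coords A d (F q))"
  have D: "frechet_derivative (\<lambda>y. snd d (F (chart_inv c y))) (at (snd c q)) = blinfun_apply ?D"
    using frechet_derivative_at[OF tangent_map_coords[OF A A F c d]] by simp
  have "?E o\<^sub>L ?D = to_coords A c q o\<^sub>L ((S o\<^sub>L ((from_coords A d (F q) o\<^sub>L to_coords A d (F q)) o\<^sub>L T)) o\<^sub>L from_coords A c q)"
    by (simp only: blinfun_compose_assoc)
  also have "\<dots> = id_blinfun"
    by (simp only: to_coords_from_coords[OF A c] to_coords_from_coords[OF A d] S blinfun_compose_id_left)
  finally have "matrix (blinfun_apply ?E) ** matrix (blinfun_apply ?D) = mat 1"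
    by (rule matrix_mult_id_blinfun)
  from arg_cong[OF this, of det] show ?thesis unfolding D by (auto simp: det_mul)
qed

text \<open>Vanishing of the divergence at \<open>x\<close> is transported by a local diffeomorphism \<open>F\<close> of the manifold:
  \<open>Y\<close> and \<open>\<phi>\<close> are the coordinate expressions in the chart \<open>c\<close> of the pullbacks of \<open>X\<close> and \<open>\<Phi>\<close> under \<open>F\<close>,
  and \<open>r\<close> is its Jacobian determinant.  With \<open>F\<close> the identity this is a change of charts, and below
  it is also applied to a left translation.\<close>

lemma weighted_divergence_tangent:
  fixes A :: "('a::{t2_space,second_countable_topology}, real^'n) chart set" and F :: "'a \<Rightarrow> 'a"
  assumes A: "smooth_atlas A" and \<Phi>: "\<And>p. p \<in> atlas_carrier A \<Longrightarrow> alternating_form (\<Phi> p)"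
    and c: "c \<in> A" and d: "d \<in> A"
    and W: "open W" "W \<subseteq> snd c ` fst c" "x \<in> W"
    and \<tau>: "smooth_on W (\<lambda>y. snd d (F (chart_inv c y)))"
    and F: "\<And>y. y \<in> W \<Longrightarrow> F (chart_inv c y) \<in> fst d \<and> has_tangent_map A A F (chart_inv c y) (T y)"
    and S: "S o\<^sub>L T x = id_blinfun"
    and X': "local_vector A X d differentiable (at (snd d (F (chart_inv c x))))"
    and \<phi>': "form_density A \<Phi> d differentiable (at (snd d (F (chart_inv c x))))"
    and Y: "Y differentiable (at x)"
    and push: "\<And>y. y \<in> W \<Longrightarrow> X (F (chart_inv c y)) = T y (from_coords A c (chart_inv c y) (Y y))"
    and pull: "\<And>y. y \<in> W \<Longrightarrow> \<phi> y = \<Phi> (F (chart_inv c y)) (\<lambda>i. T y (from_coords A c (chart_inv c y) (axis i 1)))"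
  shows "\<exists>r. r \<noteq> 0 \<and> weighted_divergence \<phi> Y x =
     r * weighted_divergence (form_density A \<Phi> d) (local_vector A X d) (snd d (F (chart_inv c x)))"
proof -
  let ?\<tau> = "\<lambda>y. snd d (F (chart_inv c y))"
  have q: "chart_inv c y \<in> fst c" "snd c (chart_inv c y) = y" if "y \<in> W" for y
    using chart_inv_in[OF A c] chart_inv_right[OF A c] W(2) that by (blast, blast)
  have D: "frechet_derivative ?\<tau> (at y) v =
      to_coords A d (F (chart_inv c y)) (T y (from_coords A c (chart_inv c y) v))" if "y \<in> W" for y v
    using frechet_derivative_at[OF tangent_map_coords[OF A A conjunct2[OF F[OF that]] c q(1)[OF that]
          d conjunct1[OF F[OF that]]], symmetric] q(2)[OF that] by simp
  have nz: "det (matrix (frechet_derivative ?\<tau> (at x))) \<noteq> 0"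
    using coord_jacobian_nonzero[OF A conjunct2[OF F[OF W(3)]] S c q(1)[OF W(3)] d conjunct1[OF F[OF W(3)]]]
    by (simp add: q(2)[OF W(3)])
  have "weighted_divergence \<phi> Y x = det (matrix (frechet_derivative ?\<tau> (at x))) *
     weighted_divergence (form_density A \<Phi> d) (local_vector A X d) (?\<tau> x)"
  proof (rule weighted_divergence_natural[OF W(1,3) \<tau> nz Y X' \<phi>'])
    fix y assume y: "y \<in> W"
    show "local_vector A X d (?\<tau> y) = frechet_derivative ?\<tau> (at y) (Y y)"
      using F[OF y] by (simp add: D[OF y] local_vector_def chart_inv_left[OF A d] push[OF y])
    show "\<phi> y = form_density A \<Phi> d (?\<tau> y) * det (matrix (frechet_derivative ?\<tau> (at y)))"
      using form_density_transform[OF A \<Phi> conjunct2[OF F[OF y]] c q(1)[OF y] d conjunct1[OF F[OF y]]]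
      by (simp add: pull[OF y] q(2)[OF y])
  qed
  with nz show ?thesis by blast
qed

section \<open>Translations on a Lie group\<close>

lemma has_derivative_Pair_const:
  "((\<lambda>y. (y, b)) has_derivative (\<lambda>v. (v, 0))) (at x)"
  "((\<lambda>y. (a, y)) has_derivative (\<lambda>v. (0, v))) (at x)"
  by (auto intro!: derivative_eq_intros)

locale lie_group_atlas =
  fixes G :: "('a::{t2_space,second_countable_topology}, 'm) monoid_scheme" (structure)
    and A :: "('a, real^'n) chart set"
  assumes lie: "lie_group G A"
begin

sublocale group G
  using lie by (simp add: lie_group_def)

lemma atlas: "smooth_atlas A"
  using lie by (simp add: lie_group_def)

lemma carrier_eq: "atlas_carrier A = carrier G"
  using lie by (simp add: lie_group_def)

lemma chart_carrier: "c \<in> A \<Longrightarrow> q \<in> fst c \<Longrightarrow> q \<in> carrier G"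
  using in_atlas_carrier[of c A q] by (simp add: carrier_eq)

lemma open_carrier: "open (carrier G)"
  using open_atlas_carrier[OF atlas] carrier_eq by simp

lemma chart_at_group:
  assumes "g \<in> carrier G" shows "chart_at A g \<in> A" "g \<in> fst (chart_at A g)"
  using chart_at_in[of g A] assms carrier_eq by simp_all

lemma continuous_on_mult: "continuous_on (carrier G \<times> carrier G) (\<lambda>(g, h). g \<otimes> h)"
proof -
  have "atlas_carrier (product_atlas A A) = carrier G \<times> carrier G"
    unfolding carrier_eq[symmetric] atlas_carrier_def product_atlas_def by force
  then show ?thesis using lie by (simp add: lie_group_def smooth_map_def)
qed

text \<open>The set on which the product of two points, given by coordinates in the charts \<open>c1\<close> and \<open>c2\<close>, has
  coordinates in \<open>d\<close>.\<close>

definition mult_domain where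
  "mult_domain c1 c2 d = {z. fst z \<in> snd c1 ` fst c1 \<and> snd z \<in> snd c2 ` fst c2 \<and>
     chart_inv c1 (fst z) \<otimes> chart_inv c2 (snd z) \<in> fst d}"

definition mult_coords where
  "mult_coords c1 c2 d z = snd d (chart_inv c1 (fst z) \<otimes> chart_inv c2 (snd z))"

lemma open_mult_domain:
  assumes c: "c1 \<in> A" "c2 \<in> A" "d \<in> A"
  shows "open (mult_domain c1 c2 d)"
proof -
  let ?U = "(snd c1 ` fst c1) \<times> (snd c2 ` fst c2)"
  have cont: "continuous_on (snd c ` fst c) (chart_inv c)" "chart_inv c ` snd c ` fst c \<subseteq> carrier G" if "c \<in> A" for c
    using atlas_chart(3)[OF atlas that] chart_carrier[OF that] by (auto simp: homeomorphism_def)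
  have "continuous_on ?U (\<lambda>z. (chart_inv c1 (fst z), chart_inv c2 (snd z)))"
    by (intro continuous_on_Pair continuous_on_compose2[OF cont(1)[OF c(1)]]
        continuous_on_compose2[OF cont(1)[OF c(2)]] continuous_on_fst continuous_on_snd continuous_on_id) auto
  then have "continuous_on ?U (\<lambda>z. (\<lambda>(g, h). g \<otimes> h) (chart_inv c1 (fst z), chart_inv c2 (snd z)))"
    by (rule continuous_on_compose2[OF continuous_on_mult]) (use cont(2) c in fastforce)
  moreover have "open ?U" using atlas_chart(2)[OF atlas] c by (simp add: open_Times)
  ultimately have "open (?U \<inter> (\<lambda>z. (\<lambda>(g, h). g \<otimes> h) (chart_inv c1 (fst z), chart_inv c2 (snd z))) -` fst d)"
    using atlas_chart(1)[OF atlas c(3)] by (rule continuous_open_preimage)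
  also have "(?U \<inter> (\<lambda>z. (\<lambda>(g, h). g \<otimes> h) (chart_inv c1 (fst z), chart_inv c2 (snd z))) -` fst d) = mult_domain c1 c2 d"
    unfolding mult_domain_def by auto
  finally show ?thesis .
qed

lemma smooth_on_mult_coords:
  assumes c: "c1 \<in> A" "c2 \<in> A" "d \<in> A"
  shows "smooth_on (mult_domain c1 c2 d) (mult_coords c1 c2 d)"
proof -
  let ?c = "(fst c1 \<times> fst c2, map_prod (snd c1) (snd c2))"
  have inj: "inj_on (map_prod (snd c1) (snd c2)) (fst c1 \<times> fst c2)"
    using chart_inv_left[OF atlas c(1)] chart_inv_left[OF atlas c(2)]
    by (auto simp: inj_on_def) metis+
  have inv: "chart_inv ?c z = (chart_inv c1 (fst z), chart_inv c2 (snd z))"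
    if "fst z \<in> snd c1 ` fst c1" "snd z \<in> snd c2 ` fst c2" for z
    unfolding chart_inv_def[of ?c]
    by (simp, rule inv_into_f_eq[OF inj])
      (use that chart_inv_in[OF atlas c(1)] chart_inv_right[OF atlas c(1)]
        chart_inv_in[OF atlas c(2)] chart_inv_right[OF atlas c(2)] in \<open>auto simp: prod_eq_iff\<close>)
  have dom: "snd ?c ` (fst ?c \<inter> (\<lambda>(g, h). g \<otimes> h) -` fst d) = mult_domain c1 c2 d"
  proof
    show "snd ?c ` (fst ?c \<inter> (\<lambda>(g, h). g \<otimes> h) -` fst d) \<subseteq> mult_domain c1 c2 d"
      using chart_inv_left[OF atlas c(1)] chart_inv_left[OF atlas c(2)]
      by (auto simp: mult_domain_def)
    show "mult_domain c1 c2 d \<subseteq> snd ?c ` (fst ?c \<inter> (\<lambda>(g, h). g \<otimes> h) -` fst d)"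
    proof
      fix z assume z: "z \<in> mult_domain c1 c2 d"
      then have "z = snd ?c (chart_inv c1 (fst z), chart_inv c2 (snd z))"
        using chart_inv_right[OF atlas c(1)] chart_inv_right[OF atlas c(2)]
        by (simp add: mult_domain_def prod_eq_iff)
      moreover have "(chart_inv c1 (fst z), chart_inv c2 (snd z)) \<in> fst ?c \<inter> (\<lambda>(g, h). g \<otimes> h) -` fst d"
        using z chart_inv_in[OF atlas c(1)] chart_inv_in[OF atlas c(2)] by (auto simp: mult_domain_def)
      ultimately show "z \<in> snd ?c ` (fst ?c \<inter> (\<lambda>(g, h). g \<otimes> h) -` fst d)" by (rule image_eqI)
    qed
  qed
  have "?c \<in> product_atlas A A" using c unfolding product_atlas_def by blast
  then have "smooth_on (mult_domain c1 c2 d) (snd d \<circ> (\<lambda>(g, h). g \<otimes> h) \<circ> chart_inv ?c)"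
    using lie c(3) unfolding dom[symmetric] by (auto simp: lie_group_def smooth_map_def)
  then show ?thesis
    by (rule smooth_on_cong[OF open_mult_domain[OF c], rotated])
      (auto simp: mult_domain_def mult_coords_def inv)
qed

lemma left_translation_coords:
  assumes c: "c \<in> A" "d \<in> A" and g: "g \<in> carrier G"
  shows "open {y \<in> snd c ` fst c. g \<otimes> chart_inv c y \<in> fst d}"
    and "smooth_on {y \<in> snd c ` fst c. g \<otimes> chart_inv c y \<in> fst d} (\<lambda>y. snd d (g \<otimes> chart_inv c y))"
proof -
  let ?k = "chart_at A g"
  let ?W = "{y \<in> snd c ` fst c. g \<otimes> chart_inv c y \<in> fst d}"
  note k = chart_at_group[OF g]
  have W: "?W = (\<lambda>y. (snd ?k g, y)) -` mult_domain ?k c d"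
    using k chart_inv_left[OF atlas k] by (auto simp: mult_domain_def)
  show op: "open ?W"
    unfolding W by (rule open_vimage[OF open_mult_domain[OF k(1) c]]) (auto intro!: continuous_intros)
  have "smooth_on ?W (\<lambda>y. mult_coords ?k c d (snd ?k g, y))"
    by (rule smooth_on_compose[OF op _ smooth_on_mult_coords[OF k(1) c]])
      (auto simp: W intro!: smooth_on_Pair smooth_on_const smooth_on_id op[unfolded W])
  then show "smooth_on ?W (\<lambda>y. snd d (g \<otimes> chart_inv c y))"
    by (simp add: mult_coords_def chart_inv_left[OF atlas k])
qed

lemma right_translation_coords:
  assumes c: "c \<in> A" "d \<in> A" and g: "g \<in> carrier G"
  shows "open {y \<in> snd c ` fst c. chart_inv c y \<otimes> g \<in> fst d}"
    and "smooth_on {y \<in> snd c ` fst c. chart_inv c y \<otimes> g \<in> fst d} (\<lambda>y. snd d (chart_inv c y \<otimes> g))"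
proof -
  let ?k = "chart_at A g"
  let ?W = "{y \<in> snd c ` fst c. chart_inv c y \<otimes> g \<in> fst d}"
  note k = chart_at_group[OF g]
  have W: "?W = (\<lambda>y. (y, snd ?k g)) -` mult_domain c ?k d"
    using k chart_inv_left[OF atlas k] by (auto simp: mult_domain_def)
  show op: "open ?W"
    unfolding W by (rule open_vimage[OF open_mult_domain[OF c(1) k(1) c(2)]]) (auto intro!: continuous_intros)
  have "smooth_on ?W (\<lambda>y. mult_coords c ?k d (y, snd ?k g))"
    by (rule smooth_on_compose[OF op _ smooth_on_mult_coords[OF c(1) k(1) c(2)]])
      (auto simp: W intro!: smooth_on_Pair smooth_on_const smooth_on_id op[unfolded W])
  then show "smooth_on ?W (\<lambda>y. snd d (chart_inv c y \<otimes> g))"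
    by (simp add: mult_coords_def chart_inv_left[OF atlas k])
qed

abbreviation "left_tangent g q \<equiv> tangent_map A A (\<lambda>x. g \<otimes> x) q"
abbreviation "right_tangent g q \<equiv> tangent_map A A (\<lambda>x. x \<otimes> g) q"

lemma isCont_translation:
  assumes "g \<in> carrier G" "q \<in> carrier G"
  shows "isCont (\<lambda>x. g \<otimes> x) q" "isCont (\<lambda>x. x \<otimes> g) q"
proof -
  have "continuous_on (carrier G) (\<lambda>x. (\<lambda>(g, h). g \<otimes> h) (g, x))"
    by (rule continuous_on_compose2[OF continuous_on_mult]) (auto intro!: continuous_intros assms)
  then show "isCont (\<lambda>x. g \<otimes> x) q"
    using assms by (simp add: continuous_on_eq_continuous_at[OF open_carrier])
  have "continuous_on (carrier G) (\<lambda>x. (\<lambda>(g, h). g \<otimes> h) (x, g))"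
    by (rule continuous_on_compose2[OF continuous_on_mult]) (auto intro!: continuous_intros assms)
  then show "isCont (\<lambda>x. x \<otimes> g) q"
    using assms by (simp add: continuous_on_eq_continuous_at[OF open_carrier])
qed

lemma smooth_left_translation:
  assumes g: "g \<in> carrier G" shows "smooth_map A A (\<lambda>x. g \<otimes> x)"
  unfolding smooth_map_def
proof (intro conjI ballI)
  show "(\<lambda>x. g \<otimes> x) ` atlas_carrier A \<subseteq> atlas_carrier A" using g by (auto simp: carrier_eq)
  show "continuous_on (atlas_carrier A) (\<lambda>x. g \<otimes> x)"
    using isCont_translation(1)[OF g] by (simp add: carrier_eq continuous_at_imp_continuous_on)
  fix c d assume c: "c \<in> A" "d \<in> A"
  show "smooth_on (snd c ` (fst c \<inter> (\<lambda>x. g \<otimes> x) -` fst d)) (snd d \<circ> (\<lambda>x. g \<otimes> x) \<circ> chart_inv c)"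
    unfolding o_def
    by (rule smooth_on_subset[OF left_translation_coords(2)[OF c g]]) (auto simp: chart_inv_left[OF atlas c(1)])
qed

lemma smooth_right_translation:
  assumes g: "g \<in> carrier G" shows "smooth_map A A (\<lambda>x. x \<otimes> g)"
  unfolding smooth_map_def
proof (intro conjI ballI)
  show "(\<lambda>x. x \<otimes> g) ` atlas_carrier A \<subseteq> atlas_carrier A" using g by (auto simp: carrier_eq)
  show "continuous_on (atlas_carrier A) (\<lambda>x. x \<otimes> g)"
    using isCont_translation(2)[OF g] by (simp add: carrier_eq continuous_at_imp_continuous_on)
  fix c d assume c: "c \<in> A" "d \<in> A"
  show "smooth_on (snd c ` (fst c \<inter> (\<lambda>x. x \<otimes> g) -` fst d)) (snd d \<circ> (\<lambda>x. x \<otimes> g) \<circ> chart_inv c)"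
    unfolding o_def
    by (rule smooth_on_subset[OF right_translation_coords(2)[OF c g]]) (auto simp: chart_inv_left[OF atlas c(1)])
qed

lemma has_tangent_translation:
  assumes "g \<in> carrier G" "q \<in> carrier G"
  shows "has_tangent_map A A (\<lambda>x. g \<otimes> x) q (left_tangent g q)"
    and "has_tangent_map A A (\<lambda>x. x \<otimes> g) q (right_tangent g q)"
  using smooth_map_has_tangent_map[OF atlas atlas smooth_left_translation[OF assms(1)]]
    smooth_map_has_tangent_map[OF atlas atlas smooth_right_translation[OF assms(1)]] assms(2)
  by (simp_all add: carrier_eq)

text \<open>Group identities hold only on the carrier; as it is open, this suffices for tangent maps.\<close>

lemma tangent_eqI:
  assumes "has_tangent_map A A F q T" "has_tangent_map A A K q S" "\<And>x. x \<in> carrier G \<Longrightarrow> F x = K x"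
  shows "T = S"
proof -
  have q: "q \<in> carrier G" using assms(1) carrier_eq by (simp add: has_tangent_map_def)
  have "has_tangent_map A A K q T"
    by (rule has_tangent_map_cong[OF atlas assms(1) open_carrier q assms(3)])
  then show ?thesis using assms(2) has_tangent_map_imp_eq by metis
qed

lemma left_tangent_mult:
  assumes "g \<in> carrier G" "h \<in> carrier G" "q \<in> carrier G"
  shows "left_tangent g (h \<otimes> q) o\<^sub>L left_tangent h q = left_tangent (g \<otimes> h) q"
  by (rule tangent_eqI[OF has_tangent_map_compose[OF atlas atlas has_tangent_translation(1)
        has_tangent_translation(1)] has_tangent_translation(1)])
    (use assms m_assoc in auto)

lemma right_tangent_mult:
  assumes "g \<in> carrier G" "h \<in> carrier G" "q \<in> carrier G"
  shows "right_tangent g (q \<otimes> h) o\<^sub>L right_tangent h q = right_tangent (h \<otimes> g) q"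
  by (rule tangent_eqI[OF has_tangent_map_compose[OF atlas atlas has_tangent_translation(2)
        has_tangent_translation(2)] has_tangent_translation(2)])
    (use assms m_assoc in auto)

lemma left_right_tangent_commute:
  assumes "g \<in> carrier G" "h \<in> carrier G" "q \<in> carrier G"
  shows "left_tangent g (q \<otimes> h) o\<^sub>L right_tangent h q = right_tangent h (g \<otimes> q) o\<^sub>L left_tangent g q"
  by (rule tangent_eqI[OF has_tangent_map_compose[OF atlas atlas has_tangent_translation(2)
        has_tangent_translation(1)] has_tangent_map_compose[OF atlas atlas has_tangent_translation(1)
        has_tangent_translation(2)]])
    (use assms m_assoc in auto)

lemma translation_tangent_one:
  assumes "q \<in> carrier G"
  shows "left_tangent \<one> q = id_blinfun" "right_tangent \<one> q = id_blinfun"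
  using assms carrier_eq
  by (auto intro: tangent_eqI[OF has_tangent_translation(1) has_tangent_map_ident[OF atlas]]
      tangent_eqI[OF has_tangent_translation(2) has_tangent_map_ident[OF atlas]])

lemma left_tangent_inverse:
  assumes "g \<in> carrier G" "q \<in> carrier G"
  shows "left_tangent (inv g) (g \<otimes> q) o\<^sub>L left_tangent g q = id_blinfun"
  using left_tangent_mult[of "inv g" g q] assms by (simp add: translation_tangent_one)

lemma right_tangent_inverse:
  assumes "g \<in> carrier G" "q \<in> carrier G"
  shows "right_tangent (inv g) (q \<otimes> g) o\<^sub>L right_tangent g q = id_blinfun"
  using right_tangent_mult[of "inv g" g q] assms by (simp add: translation_tangent_one)

lemma has_tangent_Ad:
  assumes g: "g \<in> carrier G"
  shows "has_tangent_map A A (\<lambda>x. g \<otimes> x \<otimes> inv g) \<one> (Ad G A g)"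
    and "Ad G A g = right_tangent (inv g) g o\<^sub>L left_tangent g \<one>"
proof -
  have "has_tangent_map A A (\<lambda>x. (g \<otimes> x) \<otimes> inv g) \<one> (right_tangent (inv g) (g \<otimes> \<one>) o\<^sub>L left_tangent g \<one>)"
    by (rule has_tangent_map_compose[OF atlas atlas has_tangent_translation(1) has_tangent_translation(2)])
      (use g in auto)
  then have *: "has_tangent_map A A (\<lambda>x. g \<otimes> x \<otimes> inv g) \<one> (right_tangent (inv g) g o\<^sub>L left_tangent g \<one>)"
    using g by simp
  then show "Ad G A g = right_tangent (inv g) g o\<^sub>L left_tangent g \<one>"
    unfolding Ad_def by (rule has_tangent_map_imp_eq)
  with * show "has_tangent_map A A (\<lambda>x. g \<otimes> x \<otimes> inv g) \<one> (Ad G A g)" by simp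
qed

lemma Ad_mult:
  assumes g: "g \<in> carrier G" "h \<in> carrier G"
  shows "Ad G A (g \<otimes> h) = Ad G A g o\<^sub>L Ad G A h"
proof (rule tangent_eqI)
  show "has_tangent_map A A (\<lambda>x. g \<otimes> h \<otimes> x \<otimes> inv (g \<otimes> h)) \<one> (Ad G A (g \<otimes> h))"
    using has_tangent_Ad(1) g by simp
  show "has_tangent_map A A (\<lambda>x. g \<otimes> (h \<otimes> x \<otimes> inv h) \<otimes> inv g) \<one> (Ad G A g o\<^sub>L Ad G A h)"
    by (rule has_tangent_map_compose[OF atlas atlas has_tangent_Ad(1)[OF g(2)]])
      (use has_tangent_Ad(1)[OF g(1)] g in simp)
  show "g \<otimes> h \<otimes> x \<otimes> inv (g \<otimes> h) = g \<otimes> (h \<otimes> x \<otimes> inv h) \<otimes> inv g" if "x \<in> carrier G" for x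
    using g that by (simp add: inv_mult_group m_assoc)
qed

lemma right_tangent_Ad:
  assumes g: "g \<in> carrier G"
  shows "right_tangent g \<one> o\<^sub>L Ad G A g = left_tangent g \<one>"
proof -
  have "right_tangent g (g \<otimes> inv g) o\<^sub>L right_tangent (inv g) g = right_tangent (inv g \<otimes> g) g"
    by (rule right_tangent_mult) (use g in auto)
  then have "right_tangent g \<one> o\<^sub>L right_tangent (inv g) g = id_blinfun"
    using g by (simp add: translation_tangent_one)
  then show ?thesis
    by (simp add: has_tangent_Ad(2)[OF g] blinfun_compose_id_left flip: blinfun_compose_assoc)
qed

end

section \<open>Invariant frames and the mean of the invariant volume forms\<close>

lemma det_matrix_rows:
  fixes \<nu> :: "('n::finite \<Rightarrow> real^'n) \<Rightarrow> real"
  assumes "alternating_form \<nu>"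
  shows "\<nu> (\<lambda>i. f (axis i 1)) = \<nu> (\<lambda>i. axis i 1) * det (matrix f)"
  using alternating_form_eq_det[OF assms, of "\<lambda>i. f (axis i 1)"] det_transpose[of "matrix f"]
  by (simp add: matrix_def transpose_def)

definition covector_coords :: "((real^'n) \<Rightarrow>\<^sub>L real) \<Rightarrow> real^'n" where
  "covector_coords \<alpha> = (\<chi> j. blinfun_apply \<alpha> (axis j 1))"

text \<open>An endomorphism acts on multivectors of top degree by its determinant; that the scalar is unique
  is witnessed by the determinant of the components of covectors.\<close>

lemma det_Ad_top_eq:
  fixes A :: "('a, real^'n) chart set"
  shows "det_Ad_top G A g = det (matrix (blinfun_apply (Ad G A g)))"
proof -
  define T where "T = Ad G A g"
  have scale: "Ad_top G A g w \<alpha> = det (matrix (blinfun_apply T)) * w \<alpha>"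
    if w: "alternating_form w" for w :: "('n \<Rightarrow> (real^'n) \<Rightarrow>\<^sub>L real) \<Rightarrow> real" and \<alpha>
  proof -
    define cov where "cov v = (\<Sum>j\<in>UNIV. v $ j *\<^sub>R dual_basis j)" for v :: "real^'n"
    have lin: "linear cov"
      unfolding cov_def by (rule linearI) (simp_all add: scaleR_left_distrib sum.distrib scaleR_sum_right)
    have cov: "cov (covector_coords \<beta>) = \<beta>" for \<beta>
      using covector_expansion[of \<beta>] by (simp add: cov_def covector_coords_def)
    define \<omega> where "\<omega> v = w (\<lambda>i. cov (v i))" for v
    have \<omega>: "alternating_form \<omega>"
      unfolding \<omega>_def by (rule alternating_form_compose_linear[OF w lin])
    have w\<omega>: "w \<beta> = \<omega> (\<lambda>i. axis i 1) * det (\<chi> i. covector_coords (\<beta> i))" for \<beta>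
      using alternating_form_eq_det[OF \<omega>, of "\<lambda>i. covector_coords (\<beta> i)"] by (simp add: \<omega>_def cov)
    have "(\<chi> i. covector_coords (\<alpha> i o\<^sub>L T)) = (\<chi> i. covector_coords (\<alpha> i)) ** matrix (blinfun_apply T)"
    proof -
      have "blinfun_apply \<beta> (T (axis j 1)) = (\<Sum>k\<in>UNIV. blinfun_apply \<beta> (axis k 1) * (T (axis j 1) $ k))" for \<beta> :: "(real^'n) \<Rightarrow>\<^sub>L real" and j
        using linear_axis_expansion[OF bounded_linear.linear[OF blinfun.bounded_linear_right], of \<beta> "T (axis j 1)"]
        by (simp add: mult.commute)
      then show ?thesis
        by (simp add: vec_eq_iff matrix_matrix_mult_def matrix_def covector_coords_def)
    qed
    then show ?thesis
      unfolding Ad_top_def T_def[symmetric] by (simp add: w\<omega>[of \<alpha>] w\<omega>[of "\<lambda>i. \<alpha> i o\<^sub>L T"] det_mul)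
  qed
  define w where "w \<alpha> = det (\<chi> i. covector_coords (\<alpha> i))" for \<alpha> :: "'n \<Rightarrow> (real^'n) \<Rightarrow>\<^sub>L real"
  have "linear (covector_coords :: ((real^'n) \<Rightarrow>\<^sub>L real) \<Rightarrow> _)"
    by (rule linearI) (simp_all add: covector_coords_def vec_eq_iff blinfun.add_left blinfun.scaleR_left)
  then have w: "alternating_form w"
    unfolding w_def by (rule alternating_form_compose_linear[OF alternating_form_det])
  have "(\<chi> i. covector_coords (dual_basis i)) = (mat 1 :: real^'n^'n)"
    by (auto simp: vec_eq_iff covector_coords_def mat_def axis_def)
  then have w1: "w dual_basis = 1" by (simp add: w_def)
  show ?thesis
    unfolding det_Ad_top_def T_def[symmetric]
  proof (rule the_equality)
    show "\<forall>w. alternating_form w \<longrightarrow> Ad_top G A g w = (\<lambda>\<alpha>. det (matrix (blinfun_apply T)) * w \<alpha>)"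
      using scale by (auto simp: fun_eq_iff)
    show "r = det (matrix (blinfun_apply T))"
      if "\<forall>w. alternating_form w \<longrightarrow> Ad_top G A g w = (\<lambda>\<alpha>. r * w \<alpha>)" for r
    proof -
      have "Ad_top G A g w = (\<lambda>\<alpha>. r * w \<alpha>)" using that w by blast
      from fun_cong[OF this, of dual_basis] scale[OF w, of dual_basis] show ?thesis by (simp add: w1)
    qed
  qed
qed

lemma matrix_blinfun_compose:
  fixes S T :: "(real^'n) \<Rightarrow>\<^sub>L (real^'n)"
  shows "matrix (blinfun_apply (S o\<^sub>L T)) = matrix (blinfun_apply S) ** matrix (blinfun_apply T)"
proof -
  have "blinfun_apply (S o\<^sub>L T) = blinfun_apply S \<circ> blinfun_apply T" by (simp add: fun_eq_iff)
  then show ?thesis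
    using matrix_compose[of "blinfun_apply T" "blinfun_apply S"]
    by (simp add: bounded_linear.linear[OF blinfun.bounded_linear_right])
qed

context lie_group_atlas
begin

abbreviation "chart_one \<equiv> chart_at A \<one>"
abbreviation "origin \<equiv> snd (chart_at A \<one>) \<one>"

lemma chart_one: "chart_one \<in> A" "\<one> \<in> fst chart_one" "chart_inv chart_one origin = \<one>"
    "origin \<in> snd chart_one ` fst chart_one"
  using chart_at_group[OF one_closed] chart_inv_left[OF atlas chart_at_group[OF one_closed]] by auto

lemma coords_one: "to_coords A chart_one \<one> = id_blinfun" "from_coords A chart_one \<one> = id_blinfun"
  using to_coords_chart_at[OF atlas, of \<one>] carrier_eq by simp_all

text \<open>The columns are the values at \<open>x\<close> of the left-invariant vector fields extending the standard basis
  of the Lie algebra, in the chart \<open>c\<close>.\<close>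

definition left_frame where
  "left_frame c x = matrix (blinfun_apply (to_coords A c (chart_inv c x) o\<^sub>L left_tangent (chart_inv c x) \<one>))"

definition right_frame where
  "right_frame c x = matrix (blinfun_apply (to_coords A c (chart_inv c x) o\<^sub>L right_tangent (chart_inv c x) \<one>))"

lemma frame_points:
  assumes c: "c \<in> A" and x: "x \<in> snd c ` fst c"
  shows "chart_inv c x \<in> fst c" "chart_inv c x \<in> carrier G" "snd c (chart_inv c x) = x"
    "(x, origin) \<in> mult_domain c chart_one c" "(origin, x) \<in> mult_domain chart_one c c"
  using chart_inv_in[OF atlas c x] chart_inv_right[OF atlas c x] chart_carrier[OF c chart_inv_in[OF atlas c x]]
    chart_one x by (auto simp: mult_domain_def)

text \<open>The frames consist of first partial derivatives of the multiplication with one factor at the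
  identity, hence they are smooth.\<close>

lemma left_frame_entry:
  assumes c: "c \<in> A" and x: "x \<in> snd c ` fst c"
  shows "left_frame c x $ i $ j = frechet_derivative (mult_coords c chart_one c) (at (x, origin)) (0, axis j 1) $ i"
proof -
  let ?g = "chart_inv c x" and ?D = "frechet_derivative (mult_coords c chart_one c) (at (x, origin))"
  note p = frame_points[OF c x]
  have "((\<lambda>y. snd c (?g \<otimes> chart_inv chart_one y)) has_derivative
      blinfun_apply (to_coords A c (?g \<otimes> \<one>) o\<^sub>L (left_tangent ?g \<one> o\<^sub>L from_coords A chart_one \<one>))) (at origin)"
    by (rule tangent_map_coords[OF atlas atlas has_tangent_translation(1)[OF p(2) one_closed] chart_one(1,2) c])
      (use p in simp)
  moreover have "((\<lambda>y. mult_coords c chart_one c (x, y)) has_derivative (\<lambda>v. ?D (0, v))) (at origin)"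
    by (rule has_derivative_compose[OF has_derivative_Pair_const(2) smooth_on_has_derivative[OF
        smooth_on_mult_coords[OF c chart_one(1) c] p(4)]])
  then have "((\<lambda>y. snd c (?g \<otimes> chart_inv chart_one y)) has_derivative (\<lambda>v. ?D (0, v))) (at origin)"
    by (simp add: mult_coords_def)
  ultimately have "blinfun_apply (to_coords A c (?g \<otimes> \<one>) o\<^sub>L (left_tangent ?g \<one> o\<^sub>L from_coords A chart_one \<one>)) = (\<lambda>v. ?D (0, v))"
    by (rule has_derivative_unique)
  then show ?thesis
    using p(2) by (simp add: left_frame_def matrix_def coords_one blinfun_compose_id_right)
qed

lemma right_frame_entry:
  assumes c: "c \<in> A" and x: "x \<in> snd c ` fst c"
  shows "right_frame c x $ i $ j = frechet_derivative (mult_coords chart_one c c) (at (origin, x)) (axis j 1, 0) $ i"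
proof -
  let ?g = "chart_inv c x" and ?D = "frechet_derivative (mult_coords chart_one c c) (at (origin, x))"
  note p = frame_points[OF c x]
  have "((\<lambda>y. snd c (chart_inv chart_one y \<otimes> ?g)) has_derivative
      blinfun_apply (to_coords A c (\<one> \<otimes> ?g) o\<^sub>L (right_tangent ?g \<one> o\<^sub>L from_coords A chart_one \<one>))) (at origin)"
    by (rule tangent_map_coords[OF atlas atlas has_tangent_translation(2)[OF p(2) one_closed] chart_one(1,2) c])
      (use p in simp)
  moreover have "((\<lambda>y. mult_coords chart_one c c (y, x)) has_derivative (\<lambda>v. ?D (v, 0))) (at origin)"
    by (rule has_derivative_compose[OF has_derivative_Pair_const(1) smooth_on_has_derivative[OF
        smooth_on_mult_coords[OF chart_one(1) c c] p(5)]])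
  then have "((\<lambda>y. snd c (chart_inv chart_one y \<otimes> ?g)) has_derivative (\<lambda>v. ?D (v, 0))) (at origin)"
    by (simp add: mult_coords_def)
  ultimately have "blinfun_apply (to_coords A c (\<one> \<otimes> ?g) o\<^sub>L (right_tangent ?g \<one> o\<^sub>L from_coords A chart_one \<one>)) = (\<lambda>v. ?D (v, 0))"
    by (rule has_derivative_unique)
  then show ?thesis
    using p(2) by (simp add: right_frame_def matrix_def coords_one blinfun_compose_id_right)
qed

lemma smooth_on_frames:
  assumes c: "c \<in> A"
  shows "smooth_on (snd c ` fst c) (\<lambda>x. left_frame c x $ i $ j)"
    and "smooth_on (snd c ` fst c) (\<lambda>x. right_frame c x $ i $ j)"
proof -
  note op = atlas_chart(2)[OF atlas c]
  have "smooth_on (snd c ` fst c) (\<lambda>x. frechet_derivative (mult_coords c chart_one c) (at (x, origin)) (0, axis j 1))"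
    by (rule smooth_on_compose[OF op _ smooth_on_frechet_derivative[OF smooth_on_mult_coords[OF c chart_one(1) c]]
          smooth_on_Pair[OF op smooth_on_id[OF op] smooth_on_const[OF op]]])
      (use frame_points(4)[OF c] in auto)
  from smooth_on_vec_nth[OF op this] show "smooth_on (snd c ` fst c) (\<lambda>x. left_frame c x $ i $ j)"
    by (rule smooth_on_cong[OF op, rotated]) (simp add: left_frame_entry[OF c])
  have "smooth_on (snd c ` fst c) (\<lambda>x. frechet_derivative (mult_coords chart_one c c) (at (origin, x)) (axis j 1, 0))"
    by (rule smooth_on_compose[OF op _ smooth_on_frechet_derivative[OF smooth_on_mult_coords[OF chart_one(1) c c]]
          smooth_on_Pair[OF op smooth_on_const[OF op] smooth_on_id[OF op]]])
      (use frame_points(5)[OF c] in auto)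
  from smooth_on_vec_nth[OF op this] show "smooth_on (snd c ` fst c) (\<lambda>x. right_frame c x $ i $ j)"
    by (rule smooth_on_cong[OF op, rotated]) (simp add: right_frame_entry[OF c])
qed

lemma matrix_ident: "matrix (\<lambda>v::real^'k. v) = mat 1"
  by (auto simp: matrix_def mat_def axis_def vec_eq_iff)

lemma frames_at_origin:
  "left_frame chart_one origin = mat 1" "right_frame chart_one origin = mat 1"
  by (simp_all add: left_frame_def right_frame_def chart_one coords_one translation_tangent_one
      blinfun_compose_id_left matrix_ident)

text \<open>Both sides are the mixed second derivative of the multiplication at the identity, taken in the
  two possible orders.\<close>

lemma frames_mixed_derivative:
  "partial_deriv l (\<lambda>y. right_frame chart_one y $ i $ k) origin =
   partial_deriv k (\<lambda>y. left_frame chart_one y $ i $ l) origin"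
proof -
  let ?M = "mult_coords chart_one chart_one chart_one" and ?U = "mult_domain chart_one chart_one chart_one"
  let ?z = "(origin, origin)"
  note M = smooth_on_mult_coords[OF chart_one(1) chart_one(1) chart_one(1)]
  have op: "open ?U" by (rule open_mult_domain) (simp_all add: chart_one)
  have z: "?z \<in> ?U" by (rule frame_points(4)[OF chart_one(1,4)])
  note c = atlas_chart(2)[OF atlas chart_one(1)]
  have DM: "((\<lambda>u. frechet_derivative ?M (at u) v) has_derivative
     frechet_derivative (\<lambda>u. frechet_derivative ?M (at u) v) (at ?z)) (at ?z)" for v
    by (rule smooth_on_has_derivative[OF smooth_on_frechet_derivative[OF M] z])
  have "((\<lambda>y. frechet_derivative ?M (at (origin, y)) (axis k 1, 0) $ i) has_derivative
      (\<lambda>w. frechet_derivative (\<lambda>u. frechet_derivative ?M (at u) (axis k 1, 0)) (at ?z) (0, w) $ i)) (at origin)"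
    by (rule bounded_linear.has_derivative[OF bounded_linear_vec_nth
          has_derivative_compose[OF has_derivative_Pair_const(2) DM]])
  then have "((\<lambda>y. right_frame chart_one y $ i $ k) has_derivative
      (\<lambda>w. frechet_derivative (\<lambda>u. frechet_derivative ?M (at u) (axis k 1, 0)) (at ?z) (0, w) $ i)) (at origin)"
    by (rule has_derivative_transform_within_open[OF _ c chart_one(4)])
      (simp add: right_frame_entry[OF chart_one(1)])
  note 1 = partial_deriv_eq[OF this, of l]
  have "((\<lambda>y. frechet_derivative ?M (at (y, origin)) (0, axis l 1) $ i) has_derivative
      (\<lambda>w. frechet_derivative (\<lambda>u. frechet_derivative ?M (at u) (0, axis l 1)) (at ?z) (w, 0) $ i)) (at origin)"
    by (rule bounded_linear.has_derivative[OF bounded_linear_vec_nth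
          has_derivative_compose[OF has_derivative_Pair_const(1) DM]])
  then have "((\<lambda>y. left_frame chart_one y $ i $ l) has_derivative
      (\<lambda>w. frechet_derivative (\<lambda>u. frechet_derivative ?M (at u) (0, axis l 1)) (at ?z) (w, 0) $ i)) (at origin)"
    by (rule has_derivative_transform_within_open[OF _ c chart_one(4)])
      (simp add: left_frame_entry[OF chart_one(1)])
  note 2 = partial_deriv_eq[OF this, of k]
  show ?thesis
    unfolding 1 2 using second_derivative_symmetric[OF op z M, of "(axis k 1, 0)" "(0, axis l 1)"] by simp
qed

lemma left_frame_inverse:
  assumes c: "c \<in> A" and x: "x \<in> snd c ` fst c"
  shows "matrix (blinfun_apply (left_tangent (inv (chart_inv c x)) (chart_inv c x) o\<^sub>L from_coords A c (chart_inv c x)))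
     ** left_frame c x = mat 1"
proof -
  let ?g = "chart_inv c x"
  note p = frame_points[OF c x]
  have "(left_tangent (inv ?g) ?g o\<^sub>L from_coords A c ?g) o\<^sub>L (to_coords A c ?g o\<^sub>L left_tangent ?g \<one>) =
     left_tangent (inv ?g) ?g o\<^sub>L ((from_coords A c ?g o\<^sub>L to_coords A c ?g) o\<^sub>L left_tangent ?g \<one>)"
    by (simp only: blinfun_compose_assoc)
  also have "\<dots> = id_blinfun"
    using left_tangent_inverse[OF p(2) one_closed] p(2)
    by (simp add: to_coords_from_coords(2)[OF atlas c p(1)] blinfun_compose_id_left)
  finally show ?thesis unfolding left_frame_def by (rule matrix_mult_id_blinfun)
qed

lemma right_frame_inverse:
  assumes c: "c \<in> A" and x: "x \<in> snd c ` fst c"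
  shows "matrix (blinfun_apply (right_tangent (inv (chart_inv c x)) (chart_inv c x) o\<^sub>L from_coords A c (chart_inv c x)))
     ** right_frame c x = mat 1"
proof -
  let ?g = "chart_inv c x"
  note p = frame_points[OF c x]
  have "(right_tangent (inv ?g) ?g o\<^sub>L from_coords A c ?g) o\<^sub>L (to_coords A c ?g o\<^sub>L right_tangent ?g \<one>) =
     right_tangent (inv ?g) ?g o\<^sub>L ((from_coords A c ?g o\<^sub>L to_coords A c ?g) o\<^sub>L right_tangent ?g \<one>)"
    by (simp only: blinfun_compose_assoc)
  also have "\<dots> = id_blinfun"
    using right_tangent_inverse[OF p(2) one_closed] p(2)
    by (simp add: to_coords_from_coords(2)[OF atlas c p(1)] blinfun_compose_id_left)
  finally show ?thesis unfolding right_frame_def by (rule matrix_mult_id_blinfun)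
qed

lemma det_frames_nonzero:
  assumes c: "c \<in> A" and x: "x \<in> snd c ` fst c"
  shows "det (left_frame c x) \<noteq> 0" "det (right_frame c x) \<noteq> 0"
  using arg_cong[OF left_frame_inverse[OF assms], of det] arg_cong[OF right_frame_inverse[OF assms], of det]
  by (auto simp: det_mul)

text \<open>Since \<open>L\<^sub>g = R\<^sub>g \<circ> Ad\<^sub>g\<close> on tangent vectors at the identity.\<close>

lemma det_frames_Ad:
  assumes c: "c \<in> A" and x: "x \<in> snd c ` fst c"
  shows "det (right_frame c x) * det_Ad_top G A (chart_inv c x) = det (left_frame c x)"
proof -
  let ?g = "chart_inv c x"
  note p = frame_points[OF c x]
  have "left_frame c x = matrix (blinfun_apply ((to_coords A c ?g o\<^sub>L right_tangent ?g \<one>) o\<^sub>L Ad G A ?g))"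
    unfolding left_frame_def blinfun_compose_assoc right_tangent_Ad[OF p(2)] ..
  then have "left_frame c x = right_frame c x ** matrix (blinfun_apply (Ad G A ?g))"
    unfolding right_frame_def by (simp only: matrix_blinfun_compose)
  then show ?thesis by (simp add: det_mul det_Ad_top_eq)
qed

lemma det_Ad_top_mult:
  "g \<in> carrier G \<Longrightarrow> h \<in> carrier G \<Longrightarrow> det_Ad_top G A (g \<otimes> h) = det_Ad_top G A g * det_Ad_top G A h"
  by (simp add: det_Ad_top_eq Ad_mult matrix_blinfun_compose det_mul)

lemma det_Ad_top_quotient:
  assumes c: "c \<in> A" and x: "x \<in> snd c ` fst c"
  shows "det_Ad_top G A (chart_inv c x) = det (left_frame c x) * inverse (det (right_frame c x))"
  using det_frames_Ad[OF assms] det_frames_nonzero[OF assms] by (simp add: field_simps)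

lemma smooth_on_det_Ad_top:
  assumes c: "c \<in> A"
  shows "smooth_on (snd c ` fst c) (\<lambda>x. det_Ad_top G A (chart_inv c x))"
proof -
  note op = atlas_chart(2)[OF atlas c]
  have "smooth_on (snd c ` fst c) (\<lambda>x. det (left_frame c x) * inverse (det (right_frame c x)))"
    by (rule smooth_on_mult[OF op smooth_on_det[OF op smooth_on_frames(1)[OF c]]
        smooth_on_inverse[OF op det_frames_nonzero(2)[OF c] smooth_on_det[OF op smooth_on_frames(2)[OF c]]]])
  then show ?thesis
    by (rule smooth_on_cong[OF op, rotated]) (simp add: det_Ad_top_quotient[OF c])
qed

lemma det_Ad_top_one: "det_Ad_top G A \<one> = 1"
  using det_frames_Ad[OF chart_one(1,4)] by (simp add: chart_one frames_at_origin)

text \<open>A continuous homomorphism into the nonzero reals is positive on a connected group.\<close>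

lemma det_Ad_top_pos:
  assumes conn: "connected (carrier G)" and g: "g \<in> carrier G"
  shows "det_Ad_top G A g > 0"
proof (rule ccontr)
  assume neg: "\<not> det_Ad_top G A g > 0"
  have "isCont (det_Ad_top G A) q" if q: "q \<in> carrier G" for q
  proof -
    let ?c = "chart_at A q"
    note c = chart_at_group[OF q]
    have "continuous_on (fst ?c) (\<lambda>q. det_Ad_top G A (chart_inv ?c (snd ?c q)))"
      by (rule continuous_on_compose2[OF smooth_on_continuous_on[OF smooth_on_det_Ad_top[OF c(1)]]])
        (use atlas_chart(3)[OF atlas c(1)] in \<open>auto simp: homeomorphism_def\<close>)
    then have "continuous_on (fst ?c) (det_Ad_top G A)"
      by (rule continuous_on_eq) (simp add: chart_inv_left[OF atlas c(1)])
    then show ?thesis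
      using c by (simp add: continuous_on_eq_continuous_at[OF atlas_chart(1)[OF atlas c(1)]])
  qed
  then have "continuous_on (carrier G) (det_Ad_top G A)"
    by (simp add: continuous_on_eq_continuous_at[OF open_carrier])
  then have "connected (det_Ad_top G A ` carrier G)"
    using conn by (rule connected_continuous_image)
  moreover have "det_Ad_top G A g \<in> det_Ad_top G A ` carrier G" "1 \<in> det_Ad_top G A ` carrier G"
    using g det_Ad_top_one by (auto intro: image_eqI[of _ _ \<one>])
  ultimately have "0 \<in> det_Ad_top G A ` carrier G"
    using neg unfolding connected_iff_interval by (meson not_less zero_le_one)
  \<comment> \<open>but the character takes invertible values\<close>
  then obtain h where h: "h \<in> carrier G" "det_Ad_top G A h = 0" by auto
  then have "det_Ad_top G A (h \<otimes> inv h) = 0" using det_Ad_top_mult[of h "inv h"] by simp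
  with h det_Ad_top_one show False by simp
qed

text \<open>The right-invariant volume form with value \<open>\<nu>\<close> at the identity is \<open>f\<^sub>0\<close> times the left-invariant
  one, so this form is the geometric mean of the two.\<close>

definition geometric_mean_form where
  "geometric_mean_form \<nu> = (\<lambda>g v. sqrt (det_Ad_top G A g) * left_invariant_form G A \<nu> g v)"

lemma alternating_form_scale: "alternating_form \<omega> \<Longrightarrow> alternating_form (\<lambda>v. r * \<omega> v)"
  unfolding alternating_form_def using linear_compose_scale_right[of "\<lambda>x. \<omega> (_(_ := x))" r]
  by (auto intro: linear_compose_scale_right[where 'b = real, unfolded real_scaleR_def])

lemma alternating_geometric_mean:
  assumes "alternating_form \<nu>"
  shows "alternating_form (geometric_mean_form \<nu> p)"
  unfolding geometric_mean_form_def left_invariant_form_def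
  by (intro alternating_form_scale)
    (rule alternating_form_compose_linear[OF assms bounded_linear.linear[OF blinfun.bounded_linear_right]])

lemma geometric_mean_density:
  assumes \<nu>: "alternating_form \<nu>" and c: "c \<in> A" and x: "x \<in> snd c ` fst c"
  shows "form_density A (geometric_mean_form \<nu>) c x =
    sqrt (det_Ad_top G A (chart_inv c x)) * (\<nu> (\<lambda>i. axis i 1) * inverse (det (left_frame c x)))"
proof -
  let ?g = "chart_inv c x"
  let ?S = "left_tangent (inv ?g) ?g o\<^sub>L from_coords A c ?g"
  have "det (matrix (blinfun_apply ?S)) * det (left_frame c x) = 1"
    using arg_cong[OF left_frame_inverse[OF c x], of det] by (simp add: det_mul)
  then have "det (matrix (blinfun_apply ?S)) = inverse (det (left_frame c x))"
    using det_frames_nonzero(1)[OF c x] by (simp add: field_simps)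
  moreover have "\<nu> (\<lambda>i. ?S (axis i 1)) = \<nu> (\<lambda>i. axis i 1) * det (matrix (blinfun_apply ?S))"
    by (rule det_matrix_rows[OF \<nu>])
  ultimately show ?thesis
    by (simp add: form_density_def local_form_def geometric_mean_form_def left_invariant_form_def)
qed

lemma smooth_on_geometric_mean_density:
  assumes conn: "connected (carrier G)" and \<nu>: "alternating_form \<nu>" and c: "c \<in> A"
  shows "smooth_on (snd c ` fst c) (form_density A (geometric_mean_form \<nu>) c)"
proof -
  note op = atlas_chart(2)[OF atlas c]
  have "smooth_on (snd c ` fst c) (\<lambda>x. sqrt (det_Ad_top G A (chart_inv c x)) *
      (\<nu> (\<lambda>i. axis i 1) * inverse (det (left_frame c x))))"
    by (intro smooth_on_mult smooth_on_sqrt smooth_on_const smooth_on_inverse op smooth_on_det_Ad_top c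
        smooth_on_det smooth_on_frames det_Ad_top_pos conn frame_points(2) det_frames_nonzero(1))
  then show ?thesis
    by (rule smooth_on_cong[OF op, rotated]) (simp add: geometric_mean_density[OF \<nu> c])
qed

lemma geometric_mean_volume_form:
  assumes conn: "connected (carrier G)" and \<nu>: "alternating_form \<nu>" and nz: "\<nu> \<noteq> (\<lambda>v. 0)"
  shows "volume_form A (geometric_mean_form \<nu>)"
  unfolding volume_form_def
proof (intro conjI ballI allI)
  fix p assume "p \<in> atlas_carrier A"
  then have p: "p \<in> carrier G" by (simp add: carrier_eq)
  show "alternating_form (geometric_mean_form \<nu> p)" by (rule alternating_geometric_mean[OF \<nu>])
  let ?S = "left_tangent (inv p) p" and ?T = "left_tangent p \<one>"
  obtain v where v: "\<nu> v \<noteq> 0" using nz by auto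
  have "?S o\<^sub>L ?T = id_blinfun" using left_tangent_inverse[OF p one_closed] p by simp
  from arg_cong[OF this, of blinfun_apply] have "blinfun_apply ?S (blinfun_apply ?T u) = u" for u
    by (auto simp: fun_eq_iff)
  then have "geometric_mean_form \<nu> p (\<lambda>i. ?T (v i)) = sqrt (det_Ad_top G A p) * \<nu> v"
    by (simp add: geometric_mean_form_def left_invariant_form_def)
  then show "geometric_mean_form \<nu> p \<noteq> (\<lambda>v. 0)"
    using v det_Ad_top_pos[OF conn p] by (metis less_irrefl mult_eq_0_iff real_sqrt_eq_zero_cancel_iff)
next
  fix c :: "('a, real^'n) chart" and v :: "'n \<Rightarrow> real^'n" assume c: "c \<in> A"
  note op = atlas_chart(2)[OF atlas c]
  have "smooth_on (snd c ` fst c) (\<lambda>x. form_density A (geometric_mean_form \<nu>) c x * det (\<chi> i. v i))"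
    by (intro smooth_on_mult smooth_on_const op smooth_on_geometric_mean_density conn \<nu> c)
  then show "smooth_on (snd c ` fst c) (\<lambda>x. local_form A (geometric_mean_form \<nu>) c x v)"
    by (rule smooth_on_cong[OF op, rotated])
      (simp add: local_form_eq_density[OF atlas alternating_geometric_mean[OF \<nu>] c])
qed

text \<open>The densities of the two invariant forms are constant multiples of the inverse determinants of the
  frames; their product is the square of the density of the mean.\<close>

lemma geometric_mean_density_squared:
  assumes conn: "connected (carrier G)" and \<nu>: "alternating_form \<nu>" and c: "c \<in> A" and x: "x \<in> snd c ` fst c"
  shows "(form_density A (geometric_mean_form \<nu>) c x)\<^sup>2 * (det (left_frame c x) * det (right_frame c x)) =
    (\<nu> (\<lambda>i. axis i 1))\<^sup>2"
proof -
  have "(sqrt (det_Ad_top G A (chart_inv c x)))\<^sup>2 = det (left_frame c x) * inverse (det (right_frame c x))"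
    using det_Ad_top_pos[OF conn frame_points(2)[OF c x]] det_Ad_top_quotient[OF c x] by simp
  then show ?thesis
    unfolding geometric_mean_density[OF \<nu> c x] power_mult_distrib
    using det_frames_nonzero[OF c x] by (simp add: field_simps power2_eq_square)
qed

text \<open>The left-invariant factor is unchanged and \<open>f\<^sub>0\<close> is a homomorphism.\<close>

lemma geometric_mean_left_translate:
  assumes g: "g \<in> carrier G" and q: "q \<in> carrier G"
  shows "geometric_mean_form \<nu> (g \<otimes> q) (\<lambda>i. left_tangent g q (v i)) =
    sqrt (det_Ad_top G A g) * geometric_mean_form \<nu> q v"
proof -
  have "left_tangent (inv (g \<otimes> q)) (g \<otimes> q) o\<^sub>L left_tangent g q = left_tangent (inv q) q"
    using left_tangent_mult[of "inv (g \<otimes> q)" g q] g q by (simp add: inv_mult_group m_assoc)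
  from arg_cong[OF this, of blinfun_apply]
  have "blinfun_apply (left_tangent (inv (g \<otimes> q)) (g \<otimes> q)) (left_tangent g q u) = left_tangent (inv q) q u" for u
    by (auto simp: fun_eq_iff)
  then show ?thesis
    by (simp add: geometric_mean_form_def left_invariant_form_def det_Ad_top_mult[OF g q] real_sqrt_mult)
qed

end

section \<open>The Morse point forces unimodularity\<close>

lemma higher_differentiable_on_local:
  assumes "\<And>x. x \<in> S \<Longrightarrow> \<exists>V. open V \<and> x \<in> V \<and> higher_differentiable_on V f k"
  shows "higher_differentiable_on S f k"
  using assms
proof (induction k arbitrary: f)
  case 0
  have "isCont f x" if x: "x \<in> S" for x
    using 0[OF x] by (auto simp: continuous_on_eq_continuous_at)
  then show ?case by (simp add: continuous_at_imp_continuous_on)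
next
  case (Suc k)
  have "f differentiable (at x)" if x: "x \<in> S" for x using Suc.prems[OF x] by auto
  moreover have "higher_differentiable_on S (\<lambda>x. frechet_derivative f (at x) v) k" for v
    by (rule Suc.IH) (use Suc.prems in fastforce)
  ultimately show ?case by simp
qed

lemma smooth_on_local:
  assumes "\<And>x. x \<in> S \<Longrightarrow> \<exists>V. open V \<and> x \<in> V \<and> smooth_on V f"
  shows "smooth_on S f"
  unfolding smooth_on_def
proof
  fix k show "higher_differentiable_on S f k"
    by (rule higher_differentiable_on_local) (use assms in \<open>auto simp: smooth_on_def\<close>)
qed

lemma smooth_on_vecI:
  fixes f :: "'e::real_normed_vector \<Rightarrow> real^'n"
  assumes "open S" "\<And>i. smooth_on S (\<lambda>x. f x $ i)"
  shows "smooth_on S f"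
proof -
  have "smooth_on S (\<lambda>x. \<Sum>i\<in>UNIV. f x $ i *\<^sub>R axis i (1::real))"
    by (intro smooth_on_sum assms(1) finite smooth_on_bounded_bilinear[OF assms(1) bounded_bilinear_scaleR]
        assms(2) smooth_on_const)
  moreover have "(\<lambda>x. \<Sum>i\<in>UNIV. f x $ i *\<^sub>R axis i 1) = f"
  proof
    show "(\<Sum>i\<in>UNIV. f x $ i *\<^sub>R axis i 1) = f x" for x
      using basis_expansion[of "f x"] by (simp add: scalar_mult_eq_scaleR)
  qed
  ultimately show ?thesis by simp
qed

text \<open>There need not be one intermediate chart for the whole domain, so smoothness is proved locally.\<close>

lemma smooth_map_compose:
  fixes A :: "('a::{t2_space,second_countable_topology}, 'e::euclidean_space) chart set"
    and B :: "('b::{t2_space,second_countable_topology}, 'f::euclidean_space) chart set"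
    and C :: "('c::{t2_space,second_countable_topology}, 'g::euclidean_space) chart set"
  assumes A: "smooth_atlas A" and B: "smooth_atlas B" and C: "smooth_atlas C"
    and F: "smooth_map A B F" and K: "smooth_map B C K"
  shows "smooth_map A C (\<lambda>x. K (F x))"
  unfolding smooth_map_def
proof (intro conjI ballI)
  show "(\<lambda>x. K (F x)) ` atlas_carrier A \<subseteq> atlas_carrier C"
    using F K by (auto simp: smooth_map_def)
  show cont: "continuous_on (atlas_carrier A) (\<lambda>x. K (F x))"
    using F K by (auto simp: smooth_map_def intro: continuous_on_compose2)
  fix c e assume c: "c \<in> A" and e: "e \<in> C"
  have cA: "fst c \<subseteq> atlas_carrier A" using c by (auto simp: atlas_carrier_def)
  show "smooth_on (snd c ` (fst c \<inter> (\<lambda>x. K (F x)) -` fst e)) (snd e \<circ> (\<lambda>x. K (F x)) \<circ> chart_inv c)"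
  proof (rule smooth_on_local)
    fix x assume "x \<in> snd c ` (fst c \<inter> (\<lambda>x. K (F x)) -` fst e)"
    then obtain q where q: "q \<in> fst c" "K (F q) \<in> fst e" "x = snd c q" by auto
    have "F q \<in> atlas_carrier B" using F q(1) cA by (auto simp: smooth_map_def)
    then obtain d where d: "d \<in> B" "F q \<in> fst d" by (auto simp: atlas_carrier_def)
    have "open (fst c \<inter> F -` fst d)" by (rule coord_map_open(1)[OF A B F c d(1)])
    moreover have "open (fst c \<inter> (\<lambda>x. K (F x)) -` fst e)"
      by (rule continuous_open_preimage[OF continuous_on_subset[OF cont cA] atlas_chart(1)[OF A c] atlas_chart(1)[OF C e]])
    ultimately have "open ((fst c \<inter> F -` fst d) \<inter> (fst c \<inter> (\<lambda>x. K (F x)) -` fst e))" by (rule open_Int)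
    from open_chart_image[OF A c this]
    have op: "open (snd c ` (fst c \<inter> ((fst c \<inter> F -` fst d) \<inter> (fst c \<inter> (\<lambda>x. K (F x)) -` fst e))))" (is "open ?V") .
    have V: "chart_inv c y \<in> fst c \<and> F (chart_inv c y) \<in> fst d \<and> K (F (chart_inv c y)) \<in> fst e" if "y \<in> ?V" for y
      using that by (auto simp: chart_inv_left[OF A c])
    have "smooth_on ?V (\<lambda>y. (\<lambda>z. snd e (K (chart_inv d z))) (snd d (F (chart_inv c y))))"
    proof (rule smooth_on_compose[OF op _ smooth_map_coords[OF K d(1) e]])
      show "(\<lambda>y. snd d (F (chart_inv c y))) ` ?V \<subseteq> snd d ` (fst d \<inter> K -` fst e)"
        using V by fastforce
      show "smooth_on ?V (\<lambda>y. snd d (F (chart_inv c y)))"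
        by (rule smooth_on_subset[OF smooth_map_coords[OF F c d(1)]]) auto
    qed
    then have "smooth_on ?V (snd e \<circ> (\<lambda>x. K (F x)) \<circ> chart_inv c)"
      by (rule smooth_on_cong[OF op, rotated]) (simp add: chart_inv_left[OF B d(1)] V)
    moreover have "x \<in> ?V" using q d by auto
    ultimately show "\<exists>V. open V \<and> x \<in> V \<and> smooth_on V (snd e \<circ> (\<lambda>x. K (F x)) \<circ> chart_inv c)"
      using op by blast
  qed
qed

lemma bivector_coeff_skew:
  assumes "smooth_atlas A" "bivector_field A \<pi>" "c \<in> A" "y \<in> snd c ` fst c"
  shows "bivector_coeff A \<pi> c i j y = - bivector_coeff A \<pi> c j i y"
  unfolding bivector_coeff_def by (rule bivector_skew) (use local_bivector_at[OF assms] in auto)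

lemma hamiltonian_divergence:
  fixes A :: "('a::{t2_space,second_countable_topology}, real^'n) chart set"
  assumes A: "smooth_atlas A" and \<pi>: "bivector_field A \<pi>" and F: "smooth_function A F"
    and c: "c \<in> A" and y: "y \<in> snd c ` fst c" and \<phi>: "\<phi> differentiable (at y)"
  shows "local_vector A (hamiltonian_vector_field A \<pi> F) c differentiable (at y)"
    and "weighted_divergence \<phi> (local_vector A (hamiltonian_vector_field A \<pi> F) c) y =
      (\<Sum>i\<in>UNIV. partial_deriv i (\<lambda>y. F (chart_inv c y)) y * modular_coeff \<phi> (bivector_coeff A \<pi> c) y i)"
proof -
  note h = smooth_function_coords[OF F c]
  have X: "local_vector A (hamiltonian_vector_field A \<pi> F) c z $ j =
    (\<Sum>i\<in>UNIV. partial_deriv i (\<lambda>y. F (chart_inv c y)) z * bivector_coeff A \<pi> c i j z)"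
    if z: "z \<in> snd c ` fst c" for z j
    by (rule local_hamiltonian_vector_field[where \<pi> = \<pi> and F = F and c = c and y = z, OF A bivector_field_at(1)[OF \<pi> in_atlas_carrier[OF c chart_inv_in[OF A c z]]]
          smooth_on_differentiable[OF h z] c z])
  have p: "bivector_coeff A \<pi> c i j differentiable (at y)" for i j
    by (rule smooth_on_differentiable[OF smooth_on_bivector_coeff[OF \<pi> c] y])
  show "local_vector A (hamiltonian_vector_field A \<pi> F) c differentiable (at y)"
    by (rule weighted_divergence_hamiltonian(1)[OF atlas_chart(2)[OF A c] y h p bivector_coeff_skew[OF A \<pi> c y] \<phi> X])
  show "weighted_divergence \<phi> (local_vector A (hamiltonian_vector_field A \<pi> F) c) y =
      (\<Sum>i\<in>UNIV. partial_deriv i (\<lambda>y. F (chart_inv c y)) y * modular_coeff \<phi> (bivector_coeff A \<pi> c) y i)"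
    by (rule weighted_divergence_hamiltonian(2)[OF atlas_chart(2)[OF A c] y h p bivector_coeff_skew[OF A \<pi> c y] \<phi> X])
qed

lemma volume_form_density_smooth:
  "volume_form A \<Phi> \<Longrightarrow> c \<in> A \<Longrightarrow> smooth_on (snd c ` fst c) (form_density A \<Phi> c)"
  unfolding volume_form_def form_density_def[abs_def] by blast

text \<open>The hypothesis speaks at each point about the chart singled out there; the conclusion concerns one
  fixed chart, in which it can be differentiated.\<close>

lemma preserved_hamiltonian_divergence_zero:
  fixes A :: "('a::{t2_space,second_countable_topology}, real^'n) chart set"
  assumes A: "smooth_atlas A" and \<pi>: "bivector_field A \<pi>" and F: "smooth_function A F"
    and \<Phi>: "volume_form A \<Phi>" and pres: "preserves A (hamiltonian_vector_field A \<pi> F) \<Phi>"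
    and c: "c \<in> A" and y: "y \<in> snd c ` fst c"
  shows "weighted_divergence (form_density A \<Phi> c) (local_vector A (hamiltonian_vector_field A \<pi> F) c) y = 0"
proof -
  let ?X = "hamiltonian_vector_field A \<pi> F"
  let ?q = "chart_inv c y"
  let ?d = "chart_at A ?q"
  have q: "?q \<in> fst c" "snd c ?q = y" using chart_inv_in[OF A c y] chart_inv_right[OF A c y] .
  have qA: "?q \<in> atlas_carrier A" by (rule in_atlas_carrier[OF c q(1)])
  have d: "?d \<in> A" "?q \<in> fst ?d" using chart_at_in[OF qA] by simp_all
  have alt: "alternating_form (\<Phi> p)" if "p \<in> atlas_carrier A" for p
    using \<Phi> that by (simp add: volume_form_def)
  have dd: "form_density A \<Phi> e differentiable (at (snd e ?q))" if "e \<in> A" "?q \<in> fst e" for e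
    by (rule smooth_on_differentiable[OF volume_form_density_smooth[OF \<Phi> that(1)]])
      (use that in auto)
  have dX: "local_vector A ?X e differentiable (at (snd e ?q))" if "e \<in> A" "?q \<in> fst e" for e
    by (rule hamiltonian_divergence(1)[OF A \<pi> F that(1) _ dd[OF that]]) (use that in auto)
  have "lie_derivative A ?X \<Phi> ?q (\<lambda>i. axis i 1) = 0"
    using pres qA by (simp add: preserves_def)
  moreover have "(\<chi> i. axis i 1) = (mat 1 :: real^'n^'n)"
    by (auto simp: vec_eq_iff mat_def axis_def)
  ultimately have 0: "weighted_divergence (form_density A \<Phi> ?d) (local_vector A ?X ?d) (snd ?d ?q) = 0"
    using lie_derivative_eq_weighted_divergence[OF A alt qA dd[OF d] dX[OF d], of "\<lambda>i. axis i 1"] by simp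
  let ?W = "snd c ` (fst c \<inter> fst ?d)"
  have W: "open ?W" "?W \<subseteq> snd c ` fst c" "y \<in> ?W"
    using open_chart_image[OF A c atlas_chart(1)[OF A d(1)]] q d by (auto intro: image_eqI[of _ _ ?q])
  have inW: "chart_inv c z \<in> fst c \<inter> fst ?d" "snd c (chart_inv c z) = z" if "z \<in> ?W" for z
    using that by (auto simp: chart_inv_left[OF A c])
  have "\<exists>r. r \<noteq> 0 \<and> weighted_divergence (form_density A \<Phi> c) (local_vector A ?X c) y =
     r * weighted_divergence (form_density A \<Phi> ?d) (local_vector A ?X ?d) (snd ?d ?q)"
  proof (rule weighted_divergence_tangent[where F = "\<lambda>x. x" and T = "\<lambda>y. id_blinfun" and S = id_blinfun, OF A alt c d(1) W])
    show "smooth_on ?W (\<lambda>y. snd ?d (chart_inv c y))"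
      using chart_transition_smooth[OF A c d(1)] by (simp add: o_def)
    show "chart_inv c z \<in> fst ?d \<and> has_tangent_map A A (\<lambda>x. x) (chart_inv c z) id_blinfun" if "z \<in> ?W" for z
      using inW[OF that] has_tangent_map_ident[OF A in_atlas_carrier[OF c]] by auto
    show "id_blinfun o\<^sub>L id_blinfun = id_blinfun" by (rule blinfun_compose_id_left)
    show "local_vector A ?X ?d differentiable (at (snd ?d ?q))" by (rule dX[OF d])
    show "form_density A \<Phi> ?d differentiable (at (snd ?d ?q))" by (rule dd[OF d])
    show "local_vector A ?X c differentiable (at y)" using dX[OF c q(1)] q(2) by simp
    show "?X (chart_inv c z) = id_blinfun (from_coords A c (chart_inv c z) (local_vector A ?X c z))" if "z \<in> ?W" for z
      using arg_cong[OF to_coords_from_coords(2)[OF A c, of "chart_inv c z"], of "\<lambda>T. blinfun_apply T (?X (chart_inv c z))"] inW[OF that]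
      by (simp add: local_vector_def)
    show "form_density A \<Phi> c z = \<Phi> (chart_inv c z) (\<lambda>i. id_blinfun (from_coords A c (chart_inv c z) (axis i 1)))" if "z \<in> ?W" for z
      by (simp add: form_density_def local_form_def)
  qed
  with 0 show ?thesis by auto
qed

context lie_group_atlas
begin

lemma smooth_conjugation:
  assumes g: "g \<in> carrier G" shows "smooth_map A A (\<lambda>x. g \<otimes> x \<otimes> inv g)"
  by (rule smooth_map_compose[OF atlas atlas atlas smooth_left_translation smooth_right_translation])
    (use g in auto)

text \<open>The definition of the Hessian chooses some field extending a tangent vector; left-invariant fields
  show that there is one.\<close>

lemma left_invariant_vector_field:
  "smooth_vector_field A (\<lambda>g. left_tangent g \<one> \<eta>) \<and> left_tangent \<one> \<one> \<eta> = \<eta>"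
proof
  show "left_tangent \<one> \<one> \<eta> = \<eta>" by (simp add: translation_tangent_one)
  show "smooth_vector_field A (\<lambda>g. left_tangent g \<one> \<eta>)"
    unfolding smooth_vector_field_def
  proof (intro ballI smooth_on_vecI)
    fix c i assume c: "c \<in> A"
    show op: "open (snd c ` fst c)" by (rule atlas_chart(2)[OF atlas c])
    have "smooth_on (snd c ` fst c) (\<lambda>x. \<Sum>j\<in>UNIV. left_frame c x $ i $ j * \<eta> $ j)"
      by (intro smooth_on_sum smooth_on_mult smooth_on_const op smooth_on_frames c finite)
    moreover have "local_vector A (\<lambda>g. left_tangent g \<one> \<eta>) c x $ i = (\<Sum>j\<in>UNIV. left_frame c x $ i $ j * \<eta> $ j)" for x
      using linear_axis_expansion[OF bounded_linear.linear[OF blinfun.bounded_linear_right],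
          of "to_coords A c (chart_inv c x) o\<^sub>L left_tangent (chart_inv c x) \<one>" \<eta>]
      by (simp add: local_vector_def left_frame_def matrix_def mult.commute)
    ultimately show "smooth_on (snd c ` fst c) (\<lambda>x. local_vector A (\<lambda>g. left_tangent g \<one> \<eta>) c x $ i)"
      by simp
  qed
qed

lemma differential_zero_imp_partial_deriv_zero:
  assumes H: "smooth_function A H" and crit: "differential A H \<one> = 0"
  shows "partial_deriv i (\<lambda>y. H (chart_inv chart_one y)) origin = 0"
proof -
  have "differential A H \<one> = (\<Sum>i\<in>UNIV. partial_deriv i (\<lambda>y. H (chart_inv chart_one y)) origin *\<^sub>R
     (dual_basis i o\<^sub>L to_coords A chart_one \<one>))"
    by (rule differential_coords[OF atlas differentiableI[OF smooth_on_has_derivative[OF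
        smooth_function_coords[OF H chart_one(1)] chart_one(4)]] chart_one(1,2)])
  from arg_cong[OF this, of "\<lambda>\<alpha>. blinfun_apply \<alpha> (axis i 1)"] show ?thesis
    by (simp add: crit coords_one blinfun_compose_id_right blinfun.sum_left blinfun.scaleR_left axis_def
        if_distrib[of "\<lambda>a. _ * a"] cong: if_cong)
qed

text \<open>At a critical point the derivative of the extending vector field is multiplied by the vanishing
  differential, so only its value matters.\<close>

lemma hessian_coords:
  assumes H: "smooth_function A H" and crit: "differential A H \<one> = 0"
  shows "hessian A H \<one> \<xi> \<eta> = frechet_derivative
    (\<lambda>y. frechet_derivative (\<lambda>y. H (chart_inv chart_one y)) (at y) \<eta>) (at origin) \<xi>"
proof -
  let ?h = "\<lambda>y. H (chart_inv chart_one y)" and ?U = "snd chart_one ` fst chart_one"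
  define X where "X = (SOME X. smooth_vector_field A X \<and> X \<one> = \<eta>)"
  have X: "smooth_vector_field A X" "X \<one> = \<eta>"
    using someI[of "\<lambda>X. smooth_vector_field A X \<and> X \<one> = \<eta>", OF left_invariant_vector_field[of \<eta>]]
    unfolding X_def by blast+
  note h = smooth_function_coords[OF H chart_one(1)] and op = atlas_chart(2)[OF atlas chart_one(1)]
  let ?Y = "local_vector A X chart_one"
  have Y: "smooth_on ?U ?Y" using X(1) chart_one(1) by (simp add: smooth_vector_field_def)
  have Y0: "?Y origin = \<eta>" by (simp add: local_vector_def chart_one coords_one X)
  have app: "apply_vector_field A X H (chart_inv chart_one y) = (\<Sum>i\<in>UNIV. partial_deriv i ?h y * ?Y y $ i)"
    if y: "y \<in> ?U" for y
  proof -
    have q: "chart_inv chart_one y \<in> fst chart_one" "snd chart_one (chart_inv chart_one y) = y"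
      using frame_points[OF chart_one(1) y] by simp_all
    have "?h differentiable (at y)" by (rule smooth_on_differentiable[OF h y])
    then have "?h differentiable (at (snd chart_one (chart_inv chart_one y)))" by (simp add: q)
    from differential_coords[where F = H, OF atlas this chart_one(1) q(1)]
    show ?thesis
      by (simp add: apply_vector_field_def local_vector_def q(2) blinfun.sum_left blinfun.scaleR_left)
  qed
  have D1: "(partial_deriv i ?h has_derivative frechet_derivative (partial_deriv i ?h) (at origin)) (at origin)" for i
    by (rule smooth_on_has_derivative[OF smooth_on_partial_deriv[OF h] chart_one(4)])
  have D2: "((\<lambda>y. ?Y y $ i) has_derivative (\<lambda>w. frechet_derivative ?Y (at origin) w $ i)) (at origin)" for i
    using smooth_on_has_derivative[OF Y chart_one(4)] unfolding has_derivative_vec_iff by blast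
  have "((\<lambda>y. \<Sum>i\<in>UNIV. partial_deriv i ?h y * ?Y y $ i) has_derivative
     (\<lambda>w. \<Sum>i\<in>UNIV. partial_deriv i ?h origin * (frechet_derivative ?Y (at origin) w $ i) +
       frechet_derivative (partial_deriv i ?h) (at origin) w * ?Y origin $ i)) (at origin)"
    by (intro has_derivative_sum has_derivative_mult D1 D2)
  then have "((\<lambda>y. \<Sum>i\<in>UNIV. partial_deriv i ?h y * ?Y y $ i) has_derivative
     (\<lambda>w. \<Sum>i\<in>UNIV. frechet_derivative (partial_deriv i ?h) (at origin) w * \<eta> $ i)) (at origin)"
    by (simp add: differential_zero_imp_partial_deriv_zero[OF H crit] Y0)
  then have K: "((\<lambda>y. apply_vector_field A X H (chart_inv chart_one y)) has_derivative
     (\<lambda>w. \<Sum>i\<in>UNIV. frechet_derivative (partial_deriv i ?h) (at origin) w * \<eta> $ i)) (at origin)"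
    by (rule has_derivative_transform_within_open[OF _ op chart_one(4)]) (simp add: app)
  have "hessian A H \<one> \<xi> \<eta> = blinfun_apply (differential A (apply_vector_field A X H) \<one>) \<xi>"
    by (simp add: hessian_def Let_def X_def)
  also have "\<dots> = (\<Sum>i\<in>UNIV. \<xi> $ i * partial_deriv i (\<lambda>y. apply_vector_field A X H (chart_inv chart_one y)) origin)"
    using differential_coords[where F = "apply_vector_field A X H", OF atlas differentiableI[OF K] chart_one(1,2)]
    by (simp add: coords_one blinfun.sum_left blinfun.scaleR_left mult.commute)
  also have "\<dots> = (\<Sum>i\<in>UNIV. frechet_derivative (partial_deriv i ?h) (at origin) \<xi> * \<eta> $ i)"
    using frechet_eq_partial_deriv[OF differentiableI[OF K], of \<xi>] frechet_derivative_at[OF K, symmetric] by simp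
  also have "\<dots> = frechet_derivative (\<lambda>y. frechet_derivative ?h (at y) \<eta>) (at origin) \<xi>"
  proof -
    have "((\<lambda>y. \<Sum>i\<in>UNIV. \<eta> $ i * partial_deriv i ?h y) has_derivative
      (\<lambda>w. \<Sum>i\<in>UNIV. \<eta> $ i * frechet_derivative (partial_deriv i ?h) (at origin) w)) (at origin)"
      by (intro has_derivative_sum has_derivative_mult_right D1)
    then have "((\<lambda>y. frechet_derivative ?h (at y) \<eta>) has_derivative
      (\<lambda>w. \<Sum>i\<in>UNIV. \<eta> $ i * frechet_derivative (partial_deriv i ?h) (at origin) w)) (at origin)"
      by (rule has_derivative_transform_within_open[OF _ op chart_one(4)])
        (simp add: frechet_eq_partial_deriv[OF smooth_on_differentiable[OF h]])
    from frechet_derivative_at[OF this, symmetric] show ?thesis by (simp add: mult.commute)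
  qed
  finally show ?thesis .
qed

text \<open>Multiplicativity at the identity reads \<open>\<pi>(e) = \<pi>(e) + \<pi>(e)\<close>.\<close>

lemma multiplicative_zero_at_one:
  assumes "multiplicative G A \<pi>" shows "\<pi> \<one> \<alpha> \<beta> = 0"
proof -
  have "\<pi> (\<one> \<otimes> \<one>) \<alpha> \<beta> = push_bivector (left_tangent \<one> \<one>) (\<pi> \<one>) \<alpha> \<beta> + push_bivector (right_tangent \<one> \<one>) (\<pi> \<one>) \<alpha> \<beta>"
    using assms unfolding multiplicative_def by blast
  then show ?thesis
    by (simp add: translation_tangent_one push_bivector_def blinfun_compose_id_right)
qed

lemma bivector_coeff_origin:
  assumes "multiplicative G A \<pi>" shows "bivector_coeff A \<pi> chart_one i j origin = 0"
  by (simp add: bivector_coeff_def local_bivector_def push_bivector_def chart_one multiplicative_zero_at_one[OF assms])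

lemma linearization_divergence_free_if_morse:
  assumes P: "poisson_lie_group G A \<pi>" and H: "smooth_function A H" and morse: "morse_at A H \<one>"
    and \<Phi>: "volume_form A \<Phi>" and pres: "preserves A (hamiltonian_vector_field A \<pi> H) \<Phi>"
  shows "(\<Sum>j\<in>UNIV. partial_deriv j (bivector_coeff A \<pi> chart_one i j) origin) = 0"
proof -
  have \<pi>: "bivector_field A \<pi>" and mult: "multiplicative G A \<pi>"
    using P by (auto simp: poisson_lie_group_def poisson_structure_def)
  let ?U = "snd chart_one ` fst chart_one" and ?\<phi> = "form_density A \<Phi> chart_one"
  note \<phi> = volume_form_density_smooth[OF \<Phi> chart_one(1)] and h = smooth_function_coords[OF H chart_one(1)]
  have crit: "differential A H \<one> = 0" using morse by (simp add: morse_at_def)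
  have "modular_coeff ?\<phi> (bivector_coeff A \<pi> chart_one) origin i = 0"
  proof (rule modular_coeff_zero_at_morse_point[OF atlas_chart(2)[OF atlas chart_one(1)] chart_one(4) h \<phi>
        smooth_on_bivector_coeff[OF \<pi> chart_one(1)]])
    show "(\<Sum>i\<in>UNIV. partial_deriv i (\<lambda>y. H (chart_inv chart_one y)) y *
       modular_coeff ?\<phi> (bivector_coeff A \<pi> chart_one) y i) = 0" if y: "y \<in> ?U" for y
      using preserved_hamiltonian_divergence_zero[OF atlas \<pi> H \<Phi> pres chart_one(1) y]
        hamiltonian_divergence(2)[OF atlas \<pi> H chart_one(1) y smooth_on_differentiable[OF \<phi> y]]
      by simp
    show "partial_deriv i (\<lambda>y. H (chart_inv chart_one y)) origin = 0" for i
      by (rule differential_zero_imp_partial_deriv_zero[OF H crit])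
    show "\<xi> = 0" if "\<And>\<eta>. frechet_derivative
      (\<lambda>y. frechet_derivative (\<lambda>y. H (chart_inv chart_one y)) (at y) \<eta>) (at origin) \<xi> = 0" for \<xi>
      using morse that unfolding morse_at_def hessian_coords[OF H crit, symmetric] by blast
  qed
  moreover have "?\<phi> origin \<noteq> 0"
  proof
    assume 0: "?\<phi> origin = 0"
    have one: "\<one> \<in> atlas_carrier A" by (simp add: carrier_eq)
    have alt: "alternating_form (\<Phi> p)" if "p \<in> atlas_carrier A" for p
      using \<Phi> that by (simp add: volume_form_def)
    have "\<Phi> \<one> v = 0" for v
      using local_form_eq_density[where \<Phi> = \<Phi>, OF atlas alt chart_one(1,4), where v = v] 0
      by (simp add: local_form_def chart_one coords_one)
    then show False using \<Phi> one by (auto simp: volume_form_def fun_eq_iff)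
  qed
  ultimately show ?thesis
    by (simp add: modular_coeff_def bivector_coeff_origin[OF mult] flip: sum_distrib_left)
qed

text \<open>In the dual basis the structure constants of the dual bracket are the derivatives \<open>\<partial>\<^sub>k \<pi>\<^sup>i\<^sup>j\<close> at the
  identity, so the sums in \<open>m\<close> are the traces of \<open>ad\<close> on the basis covectors.\<close>

lemma unimodular_if_divergence_free:
  assumes \<pi>: "bivector_field A \<pi>"
    and m: "\<And>i. (\<Sum>j\<in>UNIV. partial_deriv j (bivector_coeff A \<pi> chart_one i j) origin) = 0"
  shows "unimodular (dual_bracket G A \<pi>)"
  unfolding unimodular_def
proof
  fix \<alpha> :: "(real^'n) \<Rightarrow>\<^sub>L real"
  let ?D = "\<lambda>i j. frechet_derivative (bivector_coeff A \<pi> chart_one i j) (at origin)"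
  have D: "(bivector_coeff A \<pi> chart_one i j has_derivative ?D i j) (at origin)" for i j
    by (rule smooth_on_has_derivative[OF smooth_on_bivector_coeff[OF \<pi> chart_one(1)] chart_one(4)])
  have "((\<lambda>x. local_bivector A \<pi> chart_one x \<alpha> (dual_basis j)) has_derivative
      (\<lambda>w. \<Sum>k\<in>UNIV. blinfun_apply \<alpha> (axis k 1) * ?D k j w)) (at origin)" for j
  proof (rule has_derivative_transform_within_open[OF _ atlas_chart(2)[OF atlas chart_one(1)] chart_one(4)])
    show "((\<lambda>x. \<Sum>k\<in>UNIV. blinfun_apply \<alpha> (axis k 1) * bivector_coeff A \<pi> chart_one k j x) has_derivative
      (\<lambda>w. \<Sum>k\<in>UNIV. blinfun_apply \<alpha> (axis k 1) * ?D k j w)) (at origin)"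
      by (intro has_derivative_sum has_derivative_mult_right D)
    show "(\<Sum>k\<in>UNIV. blinfun_apply \<alpha> (axis k 1) * bivector_coeff A \<pi> chart_one k j x) =
        local_bivector A \<pi> chart_one x \<alpha> (dual_basis j)" if "x \<in> snd chart_one ` fst chart_one" for x
      unfolding bivector_coeff_def
      by (rule bivector_linear(2)[OF local_bivector_at(1)[OF atlas \<pi> chart_one(1) that], symmetric])
  qed
  note B = this
  have br: "blinfun_apply (dual_bracket G A \<pi> \<alpha> (dual_basis j)) \<xi> =
      (\<Sum>k\<in>UNIV. blinfun_apply \<alpha> (axis k 1) * ?D k j \<xi>)" for j \<xi>
    using bounded_linear_Blinfun_apply[OF has_derivative_bounded_linear[OF B]]
    by (simp add: dual_bracket_def intrinsic_derivative_def Let_def frechet_derivative_at[OF B, symmetric])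
  have "modular_character (dual_bracket G A \<pi>) \<alpha> =
     (\<Sum>j\<in>UNIV. \<Sum>k\<in>UNIV. blinfun_apply \<alpha> (axis k 1) * partial_deriv j (bivector_coeff A \<pi> chart_one k j) origin)"
    by (simp add: modular_character_def trace_def br partial_deriv_def)
  also have "\<dots> = (\<Sum>k\<in>UNIV. blinfun_apply \<alpha> (axis k 1) *
      (\<Sum>j\<in>UNIV. partial_deriv j (bivector_coeff A \<pi> chart_one k j) origin))"
    unfolding sum_distrib_left by (rule sum.swap)
  finally show "modular_character (dual_bracket G A \<pi>) \<alpha> = 0" by (simp add: m)
qed

end

section \<open>Unimodularity makes the mean volume form invariant\<close>

text \<open>A bivector field \<open>b\<close> that vanishes at the fixed point \<open>x\<close> is pulled back along \<open>\<kappa>\<close>, with \<open>E\<close> in the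
  role of the inverse of the Jacobian of \<open>\<kappa>\<close>.  As \<open>b x = 0\<close>, no derivative of \<open>E\<close> survives and the linear part
  transforms like a tensor, under which the vanishing of a trace is preserved.\<close>

lemma conjugate_linearization:
  fixes E :: "real^'n \<Rightarrow> real^'n^'n" and \<kappa> :: "real^'n \<Rightarrow> real^'n"
  assumes b: "\<And>k l. b k l differentiable (at x)" "\<And>k l. b k l x = 0"
      "\<And>k. (\<Sum>l\<in>UNIV. partial_deriv l (b k l) x) = 0"
    and \<kappa>: "(\<kappa> has_derivative K) (at x)" "\<kappa> x = x"
    and E: "\<And>i j. (\<lambda>y. E y $ i $ j) differentiable (at x)"
    and inv: "E x ** matrix K = mat 1"
  shows "(\<lambda>y. conjugate_coeff (\<lambda>k l. b k l (\<kappa> y)) (E y) i j) differentiable (at x)"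
    and "(\<Sum>j\<in>UNIV. partial_deriv j (\<lambda>y. conjugate_coeff (\<lambda>k l. b k l (\<kappa> y)) (E y) i j) x) = 0"
proof -
  define Db where "Db k l = frechet_derivative (b k l) (at x)" for k l
  define DE where "DE i k = frechet_derivative (\<lambda>y. E y $ i $ k) (at x)" for i k
  have Db: "(b k l has_derivative Db k l) (at (\<kappa> x))" for k l
    using b(1) by (simp add: Db_def \<kappa>(2) frechet_derivative_works)
  have DE: "((\<lambda>y. E y $ i $ k) has_derivative DE i k) (at x)" for i k
    using E by (simp add: DE_def frechet_derivative_works)
  have "((\<lambda>y. conjugate_coeff (\<lambda>k l. b k l (\<kappa> y)) (E y) i j) has_derivative
     (\<lambda>w. \<Sum>k\<in>UNIV. \<Sum>l\<in>UNIV. b k l (\<kappa> x) * (E x $ i $ k * DE j l w + DE i k w * E x $ j $ l) +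
        Db k l (K w) * (E x $ i $ k * E x $ j $ l))) (at x)" for j
    unfolding conjugate_coeff_def
    by (intro has_derivative_sum has_derivative_mult DE has_derivative_compose[OF \<kappa>(1) Db])
  then have D: "((\<lambda>y. conjugate_coeff (\<lambda>k l. b k l (\<kappa> y)) (E y) i j) has_derivative
     (\<lambda>w. \<Sum>k\<in>UNIV. \<Sum>l\<in>UNIV. Db k l (K w) * (E x $ i $ k * E x $ j $ l))) (at x)" for j
    by (simp add: \<kappa>(2) b(2))
  then show "(\<lambda>y. conjugate_coeff (\<lambda>k l. b k l (\<kappa> y)) (E y) i j) differentiable (at x)"
    by (rule differentiableI)
  have DbK: "Db k l (K (axis j 1)) = (\<Sum>m\<in>UNIV. matrix K $ m $ j * partial_deriv m (b k l) x)" for k l j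
    using frechet_eq_partial_deriv[OF b(1), of k l "K (axis j 1)"] by (simp add: Db_def matrix_def)
  have inv': "matrix K ** E x = mat 1" using inv matrix_left_right_inverse by blast
  have delta: "(\<Sum>j\<in>UNIV. matrix K $ m $ j * E x $ j $ l) = (if m = l then 1 else 0)" for m l
    using arg_cong[OF inv', of "\<lambda>M. M $ m $ l"] by (simp add: matrix_matrix_mult_def mat_def)
  have "(\<Sum>j\<in>UNIV. partial_deriv j (\<lambda>y. conjugate_coeff (\<lambda>k l. b k l (\<kappa> y)) (E y) i j) x) =
     (\<Sum>j\<in>UNIV. \<Sum>k\<in>UNIV. \<Sum>l\<in>UNIV. \<Sum>m\<in>UNIV.
        E x $ i $ k * (partial_deriv m (b k l) x * (matrix K $ m $ j * E x $ j $ l)))"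
    by (simp add: partial_deriv_eq[OF D] DbK sum_distrib_left sum_distrib_right mult_ac)
  also have "\<dots> = (\<Sum>k\<in>UNIV. \<Sum>j\<in>UNIV. \<Sum>l\<in>UNIV. \<Sum>m\<in>UNIV.
        E x $ i $ k * (partial_deriv m (b k l) x * (matrix K $ m $ j * E x $ j $ l)))"
    by (rule sum.swap)
  also have "\<dots> = (\<Sum>k\<in>UNIV. \<Sum>l\<in>UNIV. \<Sum>j\<in>UNIV. \<Sum>m\<in>UNIV.
        E x $ i $ k * (partial_deriv m (b k l) x * (matrix K $ m $ j * E x $ j $ l)))"
    by (intro sum.cong refl sum.swap)
  also have "\<dots> = (\<Sum>k\<in>UNIV. \<Sum>l\<in>UNIV. \<Sum>m\<in>UNIV. \<Sum>j\<in>UNIV.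
        E x $ i $ k * (partial_deriv m (b k l) x * (matrix K $ m $ j * E x $ j $ l)))"
    by (intro sum.cong refl sum.swap)
  also have "\<dots> = (\<Sum>k\<in>UNIV. \<Sum>l\<in>UNIV. \<Sum>m\<in>UNIV.
        E x $ i $ k * (partial_deriv m (b k l) x * (if m = l then 1 else 0)))"
    by (simp add: delta flip: sum_distrib_left)
  also have "\<dots> = (\<Sum>k\<in>UNIV. \<Sum>l\<in>UNIV. E x $ i $ k * partial_deriv l (b k l) x)"
    by (simp add: if_distrib[of "\<lambda>a. _ * a"] cong: if_cong)
  also have "\<dots> = 0"
    by (simp add: b(3) flip: sum_distrib_left)
  finally show "(\<Sum>j\<in>UNIV. partial_deriv j (\<lambda>y. conjugate_coeff (\<lambda>k l. b k l (\<kappa> y)) (E y) i j) x) = 0" .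
qed

lemma bivector_pull_coeff:
  fixes P :: "(real^'n) bivector" and M :: "(real^'n) \<Rightarrow>\<^sub>L (real^'n)"
  assumes P: "bilinear P"
  shows "P (dual_basis i o\<^sub>L M) (dual_basis j o\<^sub>L M) =
    conjugate_coeff (\<lambda>k l. P (dual_basis k) (dual_basis l)) (matrix (blinfun_apply M)) i j"
proof -
  have "P (dual_basis i o\<^sub>L M) (dual_basis j o\<^sub>L M) =
    (\<Sum>k\<in>UNIV. (M (axis k 1) $ i) * (\<Sum>l\<in>UNIV. (M (axis l 1) $ j) * P (dual_basis k) (dual_basis l)))"
  proof -
    have 1: "P (dual_basis k) (dual_basis j o\<^sub>L M) =
        (\<Sum>l\<in>UNIV. (M (axis l 1) $ j) * P (dual_basis k) (dual_basis l))" for k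
      using bivector_linear(1)[OF P, of "dual_basis k" "dual_basis j o\<^sub>L M"]
      unfolding blinfun_apply_blinfun_compose dual_basis_apply .
    show ?thesis
      using bivector_linear(2)[OF P, of "dual_basis i o\<^sub>L M" "dual_basis j o\<^sub>L M"]
      unfolding blinfun_apply_blinfun_compose dual_basis_apply 1 .
  qed
  also have "\<dots> = conjugate_coeff (\<lambda>k l. P (dual_basis k) (dual_basis l)) (matrix (blinfun_apply M)) i j"
    unfolding conjugate_coeff_def sum_distrib_left
    by (intro sum.cong refl) (simp add: matrix_def)
  finally show ?thesis .
qed

context lie_group_atlas
begin

text \<open>The pullback of \<open>\<pi>\<close> under left translation by \<open>g\<close>.\<close>

definition translated_bivector where
  "translated_bivector \<pi> g q = push_bivector (left_tangent (inv g) (g \<otimes> q)) (\<pi> (g \<otimes> q))"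

definition bivector_at_one where
  "bivector_at_one \<pi> g = push_bivector (left_tangent (inv g) g) (\<pi> g)"

lemma multiplicative_eq:
  assumes "multiplicative G A \<pi>" "g \<in> carrier G" "h \<in> carrier G"
  shows "\<pi> (g \<otimes> h) \<alpha> \<beta> = \<pi> h (\<alpha> o\<^sub>L left_tangent g h) (\<beta> o\<^sub>L left_tangent g h) +
     \<pi> g (\<alpha> o\<^sub>L right_tangent h g) (\<beta> o\<^sub>L right_tangent h g)"
  using assms unfolding multiplicative_def push_bivector_def by blast

text \<open>Multiplicativity at the product of \<open>g\<close> and \<open>q\<close>, translated back by \<open>g\<close>.\<close>

lemma translated_bivector_right:
  assumes mult: "multiplicative G A \<pi>" and g: "g \<in> carrier G" and q: "q \<in> carrier G"
  shows "translated_bivector \<pi> g q \<alpha> \<beta> = \<pi> q \<alpha> \<beta> +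
    bivector_at_one \<pi> g (\<alpha> o\<^sub>L right_tangent q \<one>) (\<beta> o\<^sub>L right_tangent q \<one>)"
proof -
  have 1: "(\<alpha> o\<^sub>L left_tangent (inv g) (g \<otimes> q)) o\<^sub>L left_tangent g q = \<alpha>" for \<alpha> :: "(real^'n) \<Rightarrow>\<^sub>L real"
    by (simp add: blinfun_compose_assoc left_tangent_inverse[OF g q] blinfun_compose_id_right)
  have "left_tangent (inv g) (g \<otimes> q) o\<^sub>L right_tangent q g = right_tangent q \<one> o\<^sub>L left_tangent (inv g) g"
    using left_right_tangent_commute[of "inv g" q g] g q by simp
  then have 2: "(\<alpha> o\<^sub>L left_tangent (inv g) (g \<otimes> q)) o\<^sub>L right_tangent q g =
      (\<alpha> o\<^sub>L right_tangent q \<one>) o\<^sub>L left_tangent (inv g) g" for \<alpha> :: "(real^'n) \<Rightarrow>\<^sub>L real"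
    by (simp add: blinfun_compose_assoc)
  show ?thesis
    unfolding translated_bivector_def bivector_at_one_def push_bivector_def
      multiplicative_eq[OF mult g q] 1 2 ..
qed

text \<open>Multiplicativity at the product of \<open>s = g q g\<^sup>-\<^sup>1\<close> and \<open>g\<close>, which is also \<open>g q\<close>.\<close>

lemma translated_bivector_left:
  assumes mult: "multiplicative G A \<pi>" and g: "g \<in> carrier G" and q: "q \<in> carrier G"
    and s: "s = g \<otimes> q \<otimes> inv g"
    and N: "N = tangent_map A A (\<lambda>z. inv g \<otimes> z \<otimes> inv (inv g)) s"
  shows "translated_bivector \<pi> g q \<alpha> \<beta> = \<pi> s (\<alpha> o\<^sub>L N) (\<beta> o\<^sub>L N) +
    bivector_at_one \<pi> g (\<alpha> o\<^sub>L left_tangent q \<one>) (\<beta> o\<^sub>L left_tangent q \<one>)"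
proof -
  have sc: "s \<in> carrier G" "s \<otimes> g = g \<otimes> q" "inv g \<otimes> s = q \<otimes> inv g"
    using g q by (auto simp: s m_assoc) (simp add: inv_solve_left m_assoc flip: m_assoc)
  have "left_tangent (inv g) (s \<otimes> g) o\<^sub>L left_tangent s g = left_tangent (inv g \<otimes> s) g"
    by (rule left_tangent_mult) (use g sc in auto)
  also have "\<dots> = left_tangent q (inv g \<otimes> g) o\<^sub>L left_tangent (inv g) g"
    unfolding sc(3) by (rule left_tangent_mult[symmetric]) (use g q in auto)
  finally have e1: "left_tangent (inv g) (g \<otimes> q) o\<^sub>L left_tangent s g = left_tangent q \<one> o\<^sub>L left_tangent (inv g) g"
    using g by (simp add: sc(2))
  have "has_tangent_map A A (\<lambda>z. inv g \<otimes> (z \<otimes> g)) s (left_tangent (inv g) (s \<otimes> g) o\<^sub>L right_tangent g s)"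
    by (rule has_tangent_map_compose[OF atlas atlas has_tangent_translation(2) has_tangent_translation(1)])
      (use g q sc in auto)
  moreover have "has_tangent_map A A (\<lambda>z. inv g \<otimes> z \<otimes> inv (inv g)) s N"
    unfolding N using smooth_map_has_tangent_map[OF atlas atlas smooth_conjugation[of "inv g"]] g sc(1)
    by (simp add: carrier_eq)
  ultimately have e2: "left_tangent (inv g) (g \<otimes> q) o\<^sub>L right_tangent g s = N"
    unfolding sc(2)[symmetric] by (rule tangent_eqI) (use g in \<open>simp add: m_assoc\<close>)
  have 1: "(\<alpha> o\<^sub>L left_tangent (inv g) (g \<otimes> q)) o\<^sub>L left_tangent s g =
      (\<alpha> o\<^sub>L left_tangent q \<one>) o\<^sub>L left_tangent (inv g) g" for \<alpha> :: "(real^'n) \<Rightarrow>\<^sub>L real"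
    by (simp add: blinfun_compose_assoc e1)
  have 2: "(\<alpha> o\<^sub>L left_tangent (inv g) (g \<otimes> q)) o\<^sub>L right_tangent g s = \<alpha> o\<^sub>L N" for \<alpha> :: "(real^'n) \<Rightarrow>\<^sub>L real"
    by (simp add: blinfun_compose_assoc e2)
  have "translated_bivector \<pi> g q \<alpha> \<beta> = \<pi> (s \<otimes> g) (\<alpha> o\<^sub>L left_tangent (inv g) (g \<otimes> q)) (\<beta> o\<^sub>L left_tangent (inv g) (g \<otimes> q))"
    by (simp add: translated_bivector_def push_bivector_def sc(2))
  also have "\<dots> = \<pi> s (\<alpha> o\<^sub>L N) (\<beta> o\<^sub>L N) +
    bivector_at_one \<pi> g (\<alpha> o\<^sub>L left_tangent q \<one>) (\<beta> o\<^sub>L left_tangent q \<one>)"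
    unfolding multiplicative_eq[OF mult sc(1) g] 1 2 bivector_at_one_def push_bivector_def by simp
  finally show ?thesis .
qed

lemma hamiltonian_left_translate:
  assumes \<pi>: "bivector_field A \<pi>" and F: "smooth_function A F" and g: "g \<in> carrier G" and q: "q \<in> carrier G"
  shows "left_tangent (inv g) (g \<otimes> q) (hamiltonian_vector_field A \<pi> F (g \<otimes> q)) =
    hamiltonian_vector_field A (translated_bivector \<pi> g) (\<lambda>x. F (g \<otimes> x)) q"
proof -
  let ?S = "left_tangent (inv g) (g \<otimes> q)"
  have gq: "g \<otimes> q \<in> atlas_carrier A" using g q by (simp add: carrier_eq)
  have P: "bilinear (\<pi> (g \<otimes> q))" by (rule bivector_field_at(1)[OF \<pi> gq])
  then have P': "bilinear (translated_bivector \<pi> g q)"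
    unfolding translated_bivector_def by (rule bilinear_push_bivector)
  have "has_tangent_map A euclidean_atlas (\<lambda>x. F (g \<otimes> x)) q (differential A F (g \<otimes> q) o\<^sub>L left_tangent g q)"
    by (rule has_tangent_map_compose[OF atlas atlas has_tangent_translation(1)[OF g q]
          smooth_map_has_tangent_map[OF atlas smooth_atlas_euclidean F gq]])
  then have dF: "differential A (\<lambda>x. F (g \<otimes> x)) q = differential A F (g \<otimes> q) o\<^sub>L left_tangent g q"
    by (rule has_tangent_map_imp_eq)
  have "left_tangent g q o\<^sub>L ?S = id_blinfun"
    using left_tangent_mult[of g "inv g" "g \<otimes> q"] g q by (simp add: translation_tangent_one flip: m_assoc)
  then have dFS: "differential A (\<lambda>x. F (g \<otimes> x)) q o\<^sub>L ?S = differential A F (g \<otimes> q)"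
    unfolding dF by (simp add: blinfun_compose_assoc blinfun_compose_id_right)
  have "blinfun_apply (dual_basis j) (?S (hamiltonian_vector_field A \<pi> F (g \<otimes> q))) =
    blinfun_apply (dual_basis j) (hamiltonian_vector_field A (translated_bivector \<pi> g) (\<lambda>x. F (g \<otimes> x)) q)" for j
  proof -
    have "blinfun_apply (dual_basis j) (?S (hamiltonian_vector_field A \<pi> F (g \<otimes> q))) =
      blinfun_apply (dual_basis j o\<^sub>L ?S) (sharp (\<pi> (g \<otimes> q)) (differential A F (g \<otimes> q)))"
      by (simp add: hamiltonian_vector_field_def)
    also have "\<dots> = \<pi> (g \<otimes> q) (differential A F (g \<otimes> q)) (dual_basis j o\<^sub>L ?S)"
      by (rule sharp_apply[OF P])
    also have "\<dots> = translated_bivector \<pi> g q (differential A (\<lambda>x. F (g \<otimes> x)) q) (dual_basis j)"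
      by (simp add: translated_bivector_def push_bivector_def dFS)
    also have "\<dots> = blinfun_apply (dual_basis j) (hamiltonian_vector_field A (translated_bivector \<pi> g) (\<lambda>x. F (g \<otimes> x)) q)"
      unfolding hamiltonian_vector_field_def by (rule sharp_apply[OF P', symmetric])
    finally show ?thesis .
  qed
  then show ?thesis by (simp add: vec_eq_iff)
qed

definition conj_domain where
  "conj_domain g = snd chart_one ` (fst chart_one \<inter> (\<lambda>x. g \<otimes> x \<otimes> inv g) -` fst chart_one)"

definition conj_coords where
  "conj_coords g y = snd chart_one (g \<otimes> chart_inv chart_one y \<otimes> inv g)"

lemma conj_coords_smooth:
  assumes g: "g \<in> carrier G"
  shows "open (conj_domain g)" "smooth_on (conj_domain g) (conj_coords g)" "origin \<in> conj_domain g"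
    "conj_coords g origin = origin"
proof -
  show "open (conj_domain g)"
    unfolding conj_domain_def
    by (rule coord_map_open(2)[OF atlas atlas smooth_conjugation[OF g] chart_one(1) chart_one(1)])
  show "smooth_on (conj_domain g) (conj_coords g)"
    unfolding conj_domain_def conj_coords_def[abs_def]
    by (rule smooth_map_coords[OF smooth_conjugation[OF g] chart_one(1) chart_one(1)])
  show "origin \<in> conj_domain g"
    unfolding conj_domain_def by (rule image_eqI[of _ _ \<one>]) (use g chart_one in auto)
  show "conj_coords g origin = origin" using g by (simp add: conj_coords_def chart_one)
qed

lemma conj_domain_point:
  assumes g: "g \<in> carrier G" and y: "y \<in> conj_domain g"
  shows "y \<in> snd chart_one ` fst chart_one" "g \<otimes> chart_inv chart_one y \<otimes> inv g \<in> fst chart_one"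
    "conj_coords g y \<in> conj_domain (inv g)" "conj_coords (inv g) (conj_coords g y) = y"
    "chart_inv chart_one (conj_coords g y) = g \<otimes> chart_inv chart_one y \<otimes> inv g"
proof -
  obtain q where q: "q \<in> fst chart_one" "g \<otimes> q \<otimes> inv g \<in> fst chart_one" "y = snd chart_one q"
    using y by (auto simp: conj_domain_def)
  have qy: "chart_inv chart_one y = q" using q chart_inv_left[OF atlas chart_one(1) q(1)] by simp
  have qc: "q \<in> carrier G" by (rule chart_carrier[OF chart_one(1) q(1)])
  have undo: "inv g \<otimes> (g \<otimes> q \<otimes> inv g) \<otimes> inv (inv g) = q"
    using g qc by (simp add: m_assoc) (simp flip: m_assoc)
  show "y \<in> snd chart_one ` fst chart_one" using q by simp
  show "g \<otimes> chart_inv chart_one y \<otimes> inv g \<in> fst chart_one" using q(2) by (simp only: qy)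
  show ci: "chart_inv chart_one (conj_coords g y) = g \<otimes> chart_inv chart_one y \<otimes> inv g"
    unfolding conj_coords_def by (rule chart_inv_left[OF atlas chart_one(1)]) (simp only: qy q(2))
  show "conj_coords (inv g) (conj_coords g y) = y"
    unfolding conj_coords_def[of "inv g"] ci qy undo by (simp add: q)
  show "conj_coords g y \<in> conj_domain (inv g)"
    unfolding conj_domain_def[of "inv g"] conj_coords_def qy
    by (rule imageI) (use q undo in auto)
qed

text \<open>The Jacobian of the inverse of conjugation by \<open>g\<close>, taken at the image of \<open>y\<close>.\<close>

definition conj_jacobian where
  "conj_jacobian g y = matrix (frechet_derivative (conj_coords (inv g)) (at (conj_coords g y)))"

lemma conj_jacobian_entry_differentiable:
  assumes g: "g \<in> carrier G"
  shows "(\<lambda>y. conj_jacobian g y $ i $ j) differentiable (at origin)"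
proof -
  have ig: "inv g \<in> carrier G" using g by simp
  note c = conj_coords_smooth[OF g]
  have "smooth_on (conj_domain g) (\<lambda>y. frechet_derivative (conj_coords (inv g)) (at (conj_coords g y)) (axis j 1))"
    by (rule smooth_on_compose[OF c(1) _ smooth_on_frechet_derivative[OF conj_coords_smooth(2)[OF ig]] c(2)])
      (use conj_domain_point(3)[OF g] in auto)
  from smooth_on_differentiable[OF smooth_on_vec_nth[OF c(1) this] c(3)]
  show ?thesis by (simp add: conj_jacobian_def matrix_def)
qed

lemma conj_jacobian_inverse:
  assumes g: "g \<in> carrier G"
  shows "conj_jacobian g origin ** matrix (frechet_derivative (conj_coords g) (at origin)) = mat 1"
proof -
  have ig: "inv g \<in> carrier G" using g by simp
  note c = conj_coords_smooth[OF g] and c' = conj_coords_smooth[OF ig]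
  let ?K = "frechet_derivative (conj_coords g) (at origin)"
  let ?J = "frechet_derivative (conj_coords (inv g)) (at (conj_coords g origin))"
  have K: "(conj_coords g has_derivative ?K) (at origin)" by (rule smooth_on_has_derivative[OF c(2,3)])
  have J: "(conj_coords (inv g) has_derivative ?J) (at (conj_coords g origin))"
    by (rule smooth_on_has_derivative[OF c'(2)]) (simp add: c c')
  have "((\<lambda>y. conj_coords (inv g) (conj_coords g y)) has_derivative (\<lambda>w. ?J (?K w))) (at origin)"
    by (rule has_derivative_compose[OF K J])
  moreover have "((\<lambda>y. conj_coords (inv g) (conj_coords g y)) has_derivative (\<lambda>w. w)) (at origin)"
    by (rule has_derivative_transform_within_open[OF has_derivative_ident c(1,3)])
      (simp add: conj_domain_point(4)[OF g])
  ultimately have "(\<lambda>w. ?J (?K w)) = (\<lambda>w. w)" by (rule has_derivative_unique)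
  then have "matrix (?J \<circ> ?K) = mat 1" by (simp add: o_def matrix_ident)
  then show ?thesis
    using matrix_compose[OF has_derivative_linear[OF K] has_derivative_linear[OF J]]
    by (simp add: conj_jacobian_def)
qed

lemma translated_coeff_right:
  assumes \<pi>: "bivector_field A \<pi>" and mult: "multiplicative G A \<pi>" and g: "g \<in> carrier G"
    and y: "y \<in> snd chart_one ` fst chart_one"
  shows "bivector_coeff A (translated_bivector \<pi> g) chart_one i j y = bivector_coeff A \<pi> chart_one i j y +
    conjugate_coeff (\<lambda>k l. bivector_at_one \<pi> g (dual_basis k) (dual_basis l)) (right_frame chart_one y) i j"
proof -
  have b: "bilinear (bivector_at_one \<pi> g)"
    unfolding bivector_at_one_def using g carrier_eq
    by (intro bilinear_push_bivector bivector_field_at(1)[OF \<pi>]) simp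
  show ?thesis
    unfolding right_frame_def bivector_pull_coeff[OF b, symmetric] bivector_coeff_def local_bivector_def
      push_bivector_def translated_bivector_right[OF mult g frame_points(2)[OF chart_one(1) y]]
    by (simp add: blinfun_compose_assoc)
qed

lemma translated_coeff_left:
  assumes \<pi>: "bivector_field A \<pi>" and mult: "multiplicative G A \<pi>" and g: "g \<in> carrier G"
    and y: "y \<in> conj_domain g"
  shows "bivector_coeff A (translated_bivector \<pi> g) chart_one i j y =
    conjugate_coeff (\<lambda>k l. bivector_coeff A \<pi> chart_one k l (conj_coords g y)) (conj_jacobian g y) i j +
    conjugate_coeff (\<lambda>k l. bivector_at_one \<pi> g (dual_basis k) (dual_basis l)) (left_frame chart_one y) i j"
proof -
  let ?q = "chart_inv chart_one y" and ?k = "conj_coords g y"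
  let ?s = "chart_inv chart_one ?k" and ?C = "to_coords A chart_one (chart_inv chart_one y)"
  have ig: "inv g \<in> carrier G" using g by simp
  note dp = conj_domain_point[OF g y] and fp = frame_points[OF chart_one(1) conj_domain_point(1)[OF g y]]
  have b: "bilinear (bivector_at_one \<pi> g)"
    unfolding bivector_at_one_def using g carrier_eq
    by (intro bilinear_push_bivector bivector_field_at(1)[OF \<pi>]) simp
  have s: "?s \<in> fst chart_one" using dp(2,5) by simp
  have k: "?k \<in> snd chart_one ` fst chart_one" "snd chart_one ?s = ?k"
    using s dp(2,5) by (auto simp: conj_coords_def)
  define N where "N = tangent_map A A (\<lambda>z. inv g \<otimes> z \<otimes> inv (inv g)) ?s"
  have hN: "has_tangent_map A A (\<lambda>z. inv g \<otimes> z \<otimes> inv (inv g)) ?s N"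
    unfolding N_def
    by (rule smooth_map_has_tangent_map[OF atlas atlas smooth_conjugation[OF ig] in_atlas_carrier[OF chart_one(1) s]])
  have sq: "inv g \<otimes> ?s \<otimes> inv (inv g) = ?q"
    unfolding dp(5) using g fp(2) by (simp add: m_assoc) (simp flip: m_assoc)
  define M where "M = ?C o\<^sub>L (N o\<^sub>L from_coords A chart_one ?s)"
  have "((\<lambda>x. snd chart_one (inv g \<otimes> chart_inv chart_one x \<otimes> inv (inv g))) has_derivative blinfun_apply M) (at ?k)"
    using tangent_map_coords[OF atlas atlas hN chart_one(1) s chart_one(1)] fp(1) unfolding sq k(2) M_def .
  then have M: "matrix (blinfun_apply M) = conj_jacobian g y"
    unfolding conj_jacobian_def
    by (simp add: frechet_derivative_at[symmetric] conj_coords_def[abs_def])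
  have "(\<alpha> o\<^sub>L ?C) o\<^sub>L N = (\<alpha> o\<^sub>L M) o\<^sub>L to_coords A chart_one ?s" for \<alpha> :: "(real^'n) \<Rightarrow>\<^sub>L real"
    by (simp add: M_def blinfun_compose_assoc to_coords_from_coords(2)[OF atlas chart_one(1) s] blinfun_compose_id_right)
  then have "\<pi> ?s ((dual_basis i o\<^sub>L ?C) o\<^sub>L N) ((dual_basis j o\<^sub>L ?C) o\<^sub>L N) =
      local_bivector A \<pi> chart_one ?k (dual_basis i o\<^sub>L M) (dual_basis j o\<^sub>L M)"
    by (simp add: local_bivector_def push_bivector_def)
  also have "\<dots> = conjugate_coeff (\<lambda>k l. bivector_coeff A \<pi> chart_one k l ?k) (conj_jacobian g y) i j"
    unfolding bivector_pull_coeff[OF local_bivector_at(1)[OF atlas \<pi> chart_one(1) k(1)]] M bivector_coeff_def ..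
  finally have 1: "\<pi> ?s ((dual_basis i o\<^sub>L ?C) o\<^sub>L N) ((dual_basis j o\<^sub>L ?C) o\<^sub>L N) =
     conjugate_coeff (\<lambda>k l. bivector_coeff A \<pi> chart_one k l ?k) (conj_jacobian g y) i j" .
  show ?thesis
    unfolding left_frame_def bivector_pull_coeff[OF b, symmetric] 1[symmetric]
    unfolding bivector_coeff_def[of A "translated_bivector \<pi> g"] local_bivector_def
      push_bivector_def translated_bivector_left[OF mult g fp(2) dp(5) N_def]
    by (simp add: blinfun_compose_assoc)
qed

text \<open>At \<open>g\<close> the divergence is moved to the identity by left translation, where the two splittings of
  the translated bivector field apply.\<close>

lemma geometric_mean_preserved:
  assumes P: "poisson_lie_group G A \<pi>" and conn: "connected (carrier G)"
    and m: "\<And>i. (\<Sum>j\<in>UNIV. partial_deriv j (bivector_coeff A \<pi> chart_one i j) origin) = 0"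
    and \<nu>: "alternating_form \<nu>" "\<nu> \<noteq> (\<lambda>v. 0)" and F: "smooth_function A F"
  shows "preserves A (hamiltonian_vector_field A \<pi> F) (geometric_mean_form \<nu>)"
  unfolding preserves_def
proof (intro ballI allI)
  fix g v assume "g \<in> atlas_carrier A"
  then have g: "g \<in> carrier G" by (simp add: carrier_eq)
  have gA: "g \<in> atlas_carrier A" using g by (simp add: carrier_eq)
  have \<pi>: "bivector_field A \<pi>" and mult: "multiplicative G A \<pi>"
    using P by (auto simp: poisson_lie_group_def poisson_structure_def)
  let ?X = "hamiltonian_vector_field A \<pi> F" and ?\<Psi> = "geometric_mean_form \<nu>"
  let ?d = "chart_at A g"
  note d = chart_at_group[OF g]
  have alt: "alternating_form (?\<Psi> p)" for p by (rule alternating_geometric_mean[OF \<nu>(1)])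
  have dg: "snd ?d g \<in> snd ?d ` fst ?d" using d by simp
  have \<Psi>d: "form_density A ?\<Psi> ?d differentiable (at (snd ?d g))"
    by (rule smooth_on_differentiable[OF smooth_on_geometric_mean_density[OF conn \<nu>(1) d(1)] dg])
  have Xd: "local_vector A ?X ?d differentiable (at (snd ?d g))"
    by (rule hamiltonian_divergence(1)[OF atlas \<pi> F d(1) dg \<Psi>d])
  let ?U = "snd chart_one ` fst chart_one"
  \<comment> \<open>where left translation by \<open>g\<close> is expressed in the charts at the identity and at \<open>g\<close>\<close>
  define W where "W = {y \<in> ?U. g \<otimes> chart_inv chart_one y \<in> fst ?d}"
  have W: "open W" "W \<subseteq> ?U" "origin \<in> W"
    using left_translation_coords(1)[OF chart_one(1) d(1) g] chart_one d g by (auto simp: W_def)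
  have \<tau>: "smooth_on W (\<lambda>y. snd ?d (g \<otimes> chart_inv chart_one y))"
    unfolding W_def by (rule left_translation_coords(2)[OF chart_one(1) d(1) g])
  \<comment> \<open>the pullbacks under left translation of the Hamiltonian vector field and of the density\<close>
  define Y where "Y = local_vector A (hamiltonian_vector_field A (translated_bivector \<pi> g) (\<lambda>x. F (g \<otimes> x))) chart_one"
  define \<psi> where "\<psi> y = sqrt (det_Ad_top G A g) * form_density A ?\<Psi> chart_one y" for y
  let ?q = "bivector_coeff A (translated_bivector \<pi> g) chart_one"
  let ?b = "bivector_coeff A \<pi> chart_one"
  let ?c = "\<lambda>k l. bivector_at_one \<pi> g (dual_basis k) (dual_basis l)"
  have bd: "?b i j differentiable (at origin)" for i j
    by (rule smooth_on_differentiable[OF smooth_on_bivector_coeff[OF \<pi> chart_one(1)] chart_one(4)])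
  have pg: "bilinear (\<pi> g)" "\<And>\<alpha>. \<pi> g \<alpha> \<alpha> = 0" using bivector_field_at[OF \<pi> gA] by auto
  have skew: "?c i j = - ?c j i" for i j
    unfolding bivector_at_one_def push_bivector_def by (rule bivector_skew[OF pg])
  have Rd: "(\<lambda>y. right_frame chart_one y $ i $ j) differentiable (at origin)"
    and Ld: "(\<lambda>y. left_frame chart_one y $ i $ j) differentiable (at origin)" for i j
    by (rule smooth_on_differentiable[OF smooth_on_frames(2)[OF chart_one(1)] chart_one(4)],
        rule smooth_on_differentiable[OF smooth_on_frames(1)[OF chart_one(1)] chart_one(4)])
  note cs = conj_coords_smooth[OF g]
  note lin = conjugate_linearization[OF bd bivector_coeff_origin[OF mult] m
      smooth_on_has_derivative[OF cs(2,3)] cs(4) conj_jacobian_entry_differentiable[OF g] conj_jacobian_inverse[OF g]]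
  have "form_density A ?\<Psi> chart_one differentiable (at origin)"
    by (rule smooth_on_differentiable[OF smooth_on_geometric_mean_density[OF conn \<nu>(1) chart_one(1)] chart_one(4)])
  then have \<psi>d: "\<psi> differentiable (at origin)"
    unfolding \<psi>_def by (intro derivative_intros)
  have f0: "det_Ad_top G A g > 0" by (rule det_Ad_top_pos[OF conn g])
  have const: "(\<psi> y)\<^sup>2 * (det (left_frame chart_one y) * det (right_frame chart_one y)) =
      det_Ad_top G A g * (\<nu> (\<lambda>i. axis i 1))\<^sup>2" if "y \<in> ?U" for y
    using geometric_mean_density_squared[OF conn \<nu>(1) chart_one(1) that] f0
    by (simp add: \<psi>_def power_mult_distrib mult.assoc)
  have \<nu>0: "\<nu> (\<lambda>i. axis i 1) \<noteq> 0"
  proof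
    assume "\<nu> (\<lambda>i. axis i 1) = 0"
    then have "\<nu> w = 0" for w using alternating_form_eq_det[OF \<nu>(1), of w] by simp
    with \<nu>(2) show False by (simp add: fun_eq_iff)
  qed
  have \<psi>0: "\<psi> origin \<noteq> 0"
    using const[OF chart_one(4)] f0 \<nu>0 by (auto simp: frames_at_origin)
  \<comment> \<open>conjugation by \<open>g\<close> must also stay inside the chart at the identity\<close>
  define V where "V = W \<inter> conj_domain g"
  have V: "open V" "origin \<in> V" using W cs by (auto simp: V_def)
  have VU: "y \<in> ?U" "y \<in> conj_domain g" if "y \<in> V" for y using that W(2) by (auto simp: V_def)
  note split = modular_coeff_zero_of_two_splittings[OF V bd bivector_coeff_origin[OF mult] m lin
      Rd frames_at_origin(2) Ld frames_at_origin(1) frames_mixed_derivative skew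
      translated_coeff_right[OF \<pi> mult g VU(1)] translated_coeff_left[OF \<pi> mult g VU(2)] \<psi>d \<psi>0 const[OF VU(1)]]
  have qd: "?q i j differentiable (at origin)" for i j by (rule split(1))
  have qskew: "?q i j y = - ?q j i y" if y: "y \<in> ?U" for i j y
  proof -
    have "g \<otimes> chart_inv chart_one y \<in> atlas_carrier A"
      using g frame_points(2)[OF chart_one(1) y] by (simp add: carrier_eq)
    note p = bivector_field_at[OF \<pi> this]
    show ?thesis
      unfolding bivector_coeff_def local_bivector_def translated_bivector_def push_bivector_def
      by (rule bivector_skew[OF p])
  qed
  have hs: "smooth_on W (\<lambda>y. F (g \<otimes> chart_inv chart_one y))"
  proof -
    have "smooth_on W (\<lambda>y. F (chart_inv ?d (snd ?d (g \<otimes> chart_inv chart_one y))))"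
      by (rule smooth_on_compose[OF W(1) _ smooth_function_coords[OF F d(1)] \<tau>]) (auto simp: W_def)
    then show ?thesis
      by (rule smooth_on_cong[OF W(1), rotated]) (simp add: W_def chart_inv_left[OF atlas d(1)])
  qed
  have Yq: "Y y $ j = (\<Sum>i\<in>UNIV. partial_deriv i (\<lambda>y. F (g \<otimes> chart_inv chart_one y)) y * ?q i j y)" if y: "y \<in> W" for y j
  proof -
    have yU: "y \<in> ?U" using y W(2) by blast
    have "g \<otimes> chart_inv chart_one y \<in> atlas_carrier A"
      using g frame_points(2)[OF chart_one(1) yU] by (simp add: carrier_eq)
    then have "bilinear (translated_bivector \<pi> g (chart_inv chart_one y))"
      unfolding translated_bivector_def by (intro bilinear_push_bivector bivector_field_at(1)[OF \<pi>])
    from local_hamiltonian_vector_field[where \<pi> = "translated_bivector \<pi> g" and F = "\<lambda>x. F (g \<otimes> x)" and c = chart_one and y = y, OF atlas this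
        smooth_on_differentiable[OF hs y] chart_one(1) yU]
    show ?thesis unfolding Y_def .
  qed
  have Yd: "Y differentiable (at origin)"
    by (rule weighted_divergence_hamiltonian(1)[OF W(1,3) hs qd qskew[OF chart_one(4)] \<psi>d Yq])
  have "weighted_divergence \<psi> Y origin =
     (\<Sum>i\<in>UNIV. partial_deriv i (\<lambda>y. F (g \<otimes> chart_inv chart_one y)) origin * modular_coeff \<psi> ?q origin i)"
    by (rule weighted_divergence_hamiltonian(2)[OF W(1,3) hs qd qskew[OF chart_one(4)] \<psi>d Yq])
  also have "\<dots> = 0" by (simp add: split(2))
  finally have 0: "weighted_divergence \<psi> Y origin = 0" .
  have g1: "g \<otimes> chart_inv chart_one origin = g" using g by (simp add: chart_one)
  have "\<exists>r. r \<noteq> 0 \<and> weighted_divergence \<psi> Y origin =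
     r * weighted_divergence (form_density A ?\<Psi> ?d) (local_vector A ?X ?d) (snd ?d (g \<otimes> chart_inv chart_one origin))"
  proof (rule weighted_divergence_tangent[where F = "\<lambda>x. g \<otimes> x" and T = "\<lambda>y. left_tangent g (chart_inv chart_one y)"
        and S = "left_tangent (inv g) g", OF atlas alt chart_one(1) d(1) W \<tau>])
    show "g \<otimes> chart_inv chart_one y \<in> fst ?d \<and>
        has_tangent_map A A (\<lambda>x. g \<otimes> x) (chart_inv chart_one y) (left_tangent g (chart_inv chart_one y))" if "y \<in> W" for y
      using that has_tangent_translation(1)[OF g frame_points(2)[OF chart_one(1)]] by (auto simp: W_def)
    show "left_tangent (inv g) g o\<^sub>L left_tangent g (chart_inv chart_one origin) = id_blinfun"
      using left_tangent_inverse[OF g one_closed] g by (simp add: chart_one)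
    show "local_vector A ?X ?d differentiable (at (snd ?d (g \<otimes> chart_inv chart_one origin)))" using Xd by (simp add: g1)
    show "form_density A ?\<Psi> ?d differentiable (at (snd ?d (g \<otimes> chart_inv chart_one origin)))" using \<Psi>d by (simp add: g1)
    show "Y differentiable (at origin)" by (rule Yd)
    fix y assume y: "y \<in> W"
    then have yU: "y \<in> ?U" using W(2) by blast
    let ?x = "chart_inv chart_one y"
    note fp = frame_points[OF chart_one(1) yU]
    have "from_coords A chart_one ?x (Y y) = left_tangent (inv g) (g \<otimes> ?x) (?X (g \<otimes> ?x))"
      using arg_cong[OF to_coords_from_coords(2)[OF atlas chart_one(1) fp(1)], of blinfun_apply]
      by (auto simp: Y_def local_vector_def hamiltonian_left_translate[OF \<pi> F g fp(2)] fun_eq_iff)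
    moreover have "left_tangent g ?x o\<^sub>L left_tangent (inv g) (g \<otimes> ?x) = id_blinfun"
      using left_tangent_mult[of g "inv g" "g \<otimes> ?x"] g fp(2) by (simp add: translation_tangent_one flip: m_assoc)
    from arg_cong[OF this, of blinfun_apply]
    have "left_tangent g ?x (left_tangent (inv g) (g \<otimes> ?x) u) = u" for u by (auto simp: fun_eq_iff)
    ultimately show "?X (g \<otimes> ?x) = left_tangent g ?x (from_coords A chart_one ?x (Y y))" by simp
    show "\<psi> y = ?\<Psi> (g \<otimes> ?x) (\<lambda>i. left_tangent g ?x (from_coords A chart_one ?x (axis i 1)))"
      by (simp add: geometric_mean_left_translate[OF g fp(2)] \<psi>_def form_density_def local_form_def)
  qed
  then have "weighted_divergence (form_density A ?\<Psi> ?d) (local_vector A ?X ?d) (snd ?d g) = 0"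
    using 0 by (auto simp: g1)
  then show "lie_derivative A ?X ?\<Psi> g v = 0"
    using lie_derivative_eq_weighted_divergence[OF atlas alt gA \<Psi>d Xd] by simp
qed

end

theorem theorem3p7:
  fixes G :: "('a::{t2_space,second_countable_topology}, 'm) monoid_scheme"
    and A :: "('a, real^'n) chart set"
    and \<pi> :: "'a \<Rightarrow> (real^'n) bivector"
    and H :: "'a \<Rightarrow> real"
    and \<Phi> :: "'a \<Rightarrow> ('n \<Rightarrow> real^'n) \<Rightarrow> real"
  assumes "poisson_lie_group G A \<pi>"
    and "connected (carrier G)"
    and "smooth_function A H"
    and "morse_at A H \<one>\<^bsub>G\<^esub>"
    and "volume_form A \<Phi>"
    and "preserves A (hamiltonian_vector_field A \<pi> H) \<Phi>"
  shows "unimodular (dual_bracket G A \<pi>) \<and>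
    (\<forall>\<nu>. alternating_form \<nu> \<and> \<nu> \<noteq> (\<lambda>v. 0) \<longrightarrow>
       (let \<Psi> = (\<lambda>g v. sqrt (det_Ad_top G A g) * left_invariant_form G A \<nu> g v) in
         volume_form A \<Psi> \<and>
         (\<forall>F. smooth_function A F \<longrightarrow> preserves A (hamiltonian_vector_field A \<pi> F) \<Psi>)))"
proof -
  interpret lie_group_atlas G A
    using assms(1) by unfold_locales (simp add: poisson_lie_group_def)
  have \<pi>: "bivector_field A \<pi>"
    using assms(1) by (simp add: poisson_lie_group_def poisson_structure_def)
  note m = linearization_divergence_free_if_morse[OF assms(1,3,4,5,6)]
  show ?thesis
    unfolding Let_def geometric_mean_form_def[symmetric]
    using unimodular_if_divergence_free[OF \<pi> m] geometric_mean_volume_form[OF assms(2)]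
      geometric_mean_preserved[OF assms(1,2) m] by blast
qed

end
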